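(* Let $S$ be a $d$-set in $\mathbb{R}^n$ with $n-1<d<n$. Suppose that $k\in\mathbb{N}$, $0<\alpha<k$, $1\le p,q<\infty$ and $1\le u\le p$. Then, for every function $f\in L^p(S)$, the extension $\tilde f=\mathrm{Ext}_{k,S}f$ (constructed with parameter $\Delta=16000$) satisfies $$\bigg(\sum_{j=0}^\infty\big(2^{\alpha j}\|\mathcal{E}_k(\tilde f,Q(\cdot,2^{-j}))_{L^u(\mathbb{R}^n)}\|_{L^p(\mathbb{R}^n)}\big)^q\bigg)^{1/q}+\|\tilde f\|_{L^p(\mathbb{R}^n)}$$ $$\le c\bigg\{\bigg(\sum_{j=0}^\infty\big(2^{j(\alpha-(n-d)/p)}\|\mathcal{E}_k(f,Q(\cdot,2^{-j}))_{L^u(S)}\|_{L^p(S)}\big)^q\bigg)^{1/q}+\|f\|_{L^p(S)}\bigg\}.$$ Here the constant $c$ depends on $S,n,u,k,p,q$ and $\alpha$ (not on $f$).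
   Context: $Q(x,r)=\{y\in\mathbb{R}^n:\|y-x\|_\infty\le r\}$ is the closed cube with center $x$ and side length $2r$; for a cube $Q=Q(x_Q,r_Q)$, $tQ=Q(x_Q,tr_Q)$. $\mathrm{dist}$ and $\mathrm{diam}$ are taken in the supremum metric. $\mathcal{H}^d$ is the $d$-dimensional Hausdorff measure. A (nonempty) closed set $S\subset\mathbb{R}^n$ is a $d$-set if there are constants $c_1,c_2>0$ such that $c_1r^d\le\mathcal{H}^d(Q(w,r)\cap S)\le c_2r^d$ for all $w\in S$, $0<r\le1$. $L^p(S)$ is taken with respect to $\mathcal{H}^d|_S$. $\mathcal{P}_m$ is the space of polynomials on $\mathbb{R}^n$ of degree at most $m$ ($\mathcal{P}_{-1}=\{0\}$). For a cube $Q$, $$\mathcal{E}_k(g,Q)_{L^u(\mathbb{R}^n)}:=\inf_{P\in\mathcal{P}_{k-1}}\bigg(\frac1{|Q|}\int_Q|g-P|^u\,dx\bigg)^{1/u},$$ and for a cube $Q$ centered in $S$, $$\mathcal{E}_k(f,Q)_{L^u(S)}:=\inf_{P\in\mathcal{P}_{k-1}}\bigg(\frac{1}{\mathcal{H}^d(Q\cap S)}\int_{Q\cap S}|f-P|^u\,d\mathcal{H}^d\bigg)^{1/u}.$$ Norms of $\mathcal{E}_k(\cdot,Q(\cdot,t))$ are taken with respect to the center of the cube. Extension operator (with parameter $\Delta>0$). Let $\mathcal{W}_S$ be a Whitney decomposition of $\mathbb{R}^n\setminus S$: a family of closed dyadic cubes with pairwise disjoint interiors, $\mathbb{R}^n\setminus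 S=\bigcup_{Q\in\mathcal{W}_S}Q$, and $\mathrm{diam}\,Q\le\mathrm{dist}(Q,S)\le4\,\mathrm{diam}\,Q$ for $Q\in\mathcal{W}_S$. Let $\{\varphi_Q\}_{Q\in\mathcal{W}_S}$ be a standard smooth partition of unity subordinate to it: $0\le\varphi_Q\le1$, $\sum_Q\varphi_Q=\chi_{\mathbb{R}^n\setminus S}$, $\mathrm{supp}\,\varphi_Q\subset\frac98Q$, and $|\partial^\beta\varphi_Q|\le c_{n,\beta}(\mathrm{diam}\,Q)^{-|\beta|}$. For $Q=Q(x_Q,r_Q)\in\mathcal{W}_S$ choose $a_Q\in S$ with $\|x_Q-a_Q\|_\infty=\mathrm{dist}(x_Q,S)$ and let $a(Q):=Q(a_Q,r_Q/2)$. For a cube $K$ centered in $S$ and $m\ge0$ let $P_{m,K}:L^1(K\cap S)\to\mathcal{P}_m$ be the projection $P_{m,K}f=\sum_{|\beta|\le m}\big(\int_{K\cap S}fP_\beta\,d\mathcal{H}^d\big)P_\beta$, where $\{P_\beta\}_{|\beta|\le m}$ is an orthonormal basis of $\mathcal{P}_m$ for the inner product $\langle g,h\rangle=\int_{K\cap S}gh\,d\mathcal{H}^d$ (this is an inner product on $\mathcal{P}_m$ since $d>n-1$). For $Q\in\mathcal{W}_S$ let $P_{m,Q}:=P_{m,a(Q)}$ if $\mathrm{diam}\,Q\le\Delta$ and $P_{m,Q}:=0$ if $\mathrm{diam}\,Q>\Delta$. For $f\in L^1_{\mathrm{loc}}(S)$ and $k\in\mathbb{N}$ define $$\mathrm{Ext}_{k,S}f(x):=\begin{cases}f(x),&x\in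 S,\\ \sum_{Q\in\mathcal{W}_S}\varphi_Q(x)\,P_{k-1,Q}f(x),&x\in\mathbb{R}^n\setminus S.\end{cases}$$ *)

theory Defs
  imports "HOL-Analysis.Analysis"
begin

section \<open>The supremum metric\<close>

definition cube :: "real ^ 'n \<Rightarrow> real \<Rightarrow> (real ^ 'n) set" where
  "cube x r = {y. infnorm (y - x) \<le> r}"

text \<open>The diameter is taken in the extended sense, so that unbounded sets get \<open>\<infinity>\<close>;
  the empty set gets \<open>0\<close>.\<close>

definition sup_ediam :: "(real ^ 'n) set \<Rightarrow> ennreal" where
  "sup_ediam A = (SUP x\<in>A. SUP y\<in>A. ennreal (infnorm (x - y)))"

definition sup_diam :: "(real ^ 'n) set \<Rightarrow> real" where
  "sup_diam A = enn2real (sup_ediam A)"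

definition sup_dist :: "(real ^ 'n) set \<Rightarrow> (real ^ 'n) set \<Rightarrow> real" where
  "sup_dist A B = (INF (x, y)\<in>A \<times> B. infnorm (x - y))"


section \<open>Powers and norms with values in the extended half-line\<close>

text \<open>Only used with exponents \<open>a > 0\<close>.\<close>

definition epowr :: "ennreal \<Rightarrow> real \<Rightarrow> ennreal" where
  "epowr x a = (if x = \<infinity> then \<infinity> else ennreal (enn2real x powr a))"

definition Lp_norm :: "'a measure \<Rightarrow> 'a set \<Rightarrow> real \<Rightarrow> ('a \<Rightarrow> ennreal) \<Rightarrow> ennreal" where
  "Lp_norm M A p g = epowr (\<integral>\<^sup>+x\<in>A. epowr (g x) p \<partial>M) (1 / p)"

definition in_Lp :: "'a measure \<Rightarrow> 'a set \<Rightarrow> real \<Rightarrow> ('a \<Rightarrow> real) \<Rightarrow> bool" where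
  "in_Lp M A p f \<longleftrightarrow> set_borel_measurable M A f \<and> Lp_norm M A p (\<lambda>x. ennreal \<bar>f x\<bar>) < \<infinity>"


section \<open>Hausdorff measure\<close>

text \<open>Hausdorff measure with respect to the supremum metric and without a normalising constant.
  As usual, it is the restriction of the outer measure to its Caratheodory measurable sets
  (\<^const>\<open>lambda_system\<close>), which makes it a measure; see \<open>emeasure_hausdorff\<close> below.\<close>

definition hausdorff_pre :: "real \<Rightarrow> real \<Rightarrow> (real ^ 'n) set \<Rightarrow> ennreal" where
  "hausdorff_pre d \<delta> A =
     (INF U\<in>{U :: nat \<Rightarrow> (real ^ 'n) set. A \<subseteq> (\<Union>i. U i) \<and> (\<forall>i. sup_ediam (U i) \<le> ennreal \<delta>)}.
        \<Sum>i. epowr (sup_ediam (U i)) d)"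

definition hausdorff_outer :: "real \<Rightarrow> (real ^ 'n) set \<Rightarrow> ennreal" where
  "hausdorff_outer d A = (SUP \<delta>\<in>{0<..}. hausdorff_pre d \<delta> A)"

definition hausdorff :: "real \<Rightarrow> (real ^ 'n) measure" where
  "hausdorff d = measure_of UNIV (lambda_system UNIV UNIV (hausdorff_outer d)) (hausdorff_outer d)"

lemma sup_ediam_mono: "A \<subseteq> B \<Longrightarrow> sup_ediam A \<le> sup_ediam B"
  unfolding sup_ediam_def
  by (intro SUP_subset_mono order_refl SUP_mono) (auto intro: SUP_subset_mono)

lemma epowr_mono: "0 \<le> a \<Longrightarrow> x \<le> y \<Longrightarrow> epowr x a \<le> epowr y a"
  unfolding epowr_def
  by (auto simp: top_unique less_top[symmetric] intro!: ennreal_leI powr_mono2 enn2real_mono)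

lemma hausdorff_pre_eq_outer_measure:
  fixes A :: "(real ^ 'n) set"
  assumes "0 \<le> d"
  defines "g \<equiv> (\<lambda>\<delta> U :: (real ^ 'n) set.
    if sup_ediam U \<le> ennreal \<delta> then epowr (sup_ediam U) d else \<infinity>)"
  shows "positive UNIV (g \<delta>)" "increasing UNIV (g \<delta>)"
    "hausdorff_pre d \<delta> A = outer_measure UNIV (g \<delta>) A"
proof -
  have [simp]: "sup_ediam {} = 0" by (simp add: sup_ediam_def bot_ennreal)
  show pos: "positive UNIV (g \<delta>)"
    by (simp add: positive_def g_def epowr_def)
  show inc: "increasing UNIV (g \<delta>)"
    unfolding increasing_def g_def
    using assms(1) by (auto intro: epowr_mono sup_ediam_mono dest: sup_ediam_mono)
  interpret ring_of_sets "UNIV :: (real ^ 'n) set" UNIV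
    using ring_of_sets_Pow[of UNIV] by simp
  show "hausdorff_pre d \<delta> A = outer_measure UNIV (g \<delta>) A"
  proof (rule antisym)
    show "hausdorff_pre d \<delta> A \<le> outer_measure UNIV (g \<delta>) A"
      unfolding outer_measure_def
    proof (rule INF_greatest, safe)
      fix U :: "nat \<Rightarrow> (real ^ 'n) set"
      assume U: "A \<subseteq> (\<Union>i. U i)"
      show "hausdorff_pre d \<delta> A \<le> (\<Sum>i. g \<delta> (U i))"
      proof (cases "\<forall>i. sup_ediam (U i) \<le> ennreal \<delta>")
        case True
        then show ?thesis
          unfolding hausdorff_pre_def using U
          by (intro INF_lower2[of U]) (auto simp: g_def)
      next
        case False
        then obtain i where "\<not> sup_ediam (U i) \<le> ennreal \<delta>" by blast
        then have "g \<delta> (U i) = \<infinity>" by (simp add: g_def)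
        then have "(\<Sum>i. g \<delta> (U i)) = \<infinity>"
          using ennreal_suminf_lessD[of "\<lambda>i. g \<delta> (U i)" \<infinity> i]
            by (cases "(\<Sum>i. g \<delta> (U i)) = \<infinity>") (simp_all add: less_top)
        then show ?thesis by simp
      qed
    qed
    show "outer_measure UNIV (g \<delta>) A \<le> hausdorff_pre d \<delta> A"
      unfolding hausdorff_pre_def
    proof (rule INF_greatest, safe)
      fix U :: "nat \<Rightarrow> (real ^ 'n) set"
      assume U: "A \<subseteq> (\<Union>i. U i)" "\<forall>i. sup_ediam (U i) \<le> ennreal \<delta>"
      have "outer_measure UNIV (g \<delta>) A \<le> (\<Sum>i. g \<delta> (U i))"
        by (rule outer_measure_le[OF pos inc]) (use U in auto)
      with U show "outer_measure UNIV (g \<delta>) A \<le> (\<Sum>i. epowr (sup_ediam (U i)) d)"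
        by (simp add: g_def)
    qed
  qed
qed

lemma outer_measure_space_hausdorff:
  assumes "0 \<le> d"
  shows "outer_measure_space UNIV (hausdorff_outer d :: (real ^ 'n) set \<Rightarrow> ennreal)"
proof -
  interpret ring_of_sets "UNIV :: (real ^ 'n) set" UNIV
    using ring_of_sets_Pow[of UNIV] by simp
  have *: "outer_measure_space UNIV (hausdorff_pre d \<delta> :: (real ^ 'n) set \<Rightarrow> ennreal)" for \<delta>
    using outer_measure_space_outer_measure[OF hausdorff_pre_eq_outer_measure(1,2)[OF assms]]
    unfolding hausdorff_pre_eq_outer_measure(3)[OF assms, abs_def] by simp
  show ?thesis
    unfolding outer_measure_space_def
  proof (intro conjI)
    show "positive UNIV (hausdorff_outer d :: (real ^ 'n) set \<Rightarrow> ennreal)"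
      using * by (simp add: outer_measure_space_def positive_def hausdorff_outer_def)
    show "increasing UNIV (hausdorff_outer d :: (real ^ 'n) set \<Rightarrow> ennreal)"
      using * unfolding outer_measure_space_def increasing_def hausdorff_outer_def
      by (auto intro!: SUP_mono)
    show "countably_subadditive UNIV (hausdorff_outer d :: (real ^ 'n) set \<Rightarrow> ennreal)"
      unfolding countably_subadditive_def
    proof safe
      fix A :: "nat \<Rightarrow> (real ^ 'n) set"
      assume dis: "disjoint_family A"
      show "hausdorff_outer d (\<Union>i. A i) \<le> (\<Sum>i. hausdorff_outer d (A i))"
        unfolding hausdorff_outer_def[of d "\<Union>i. A i"]
      proof (rule SUP_least)
        fix \<delta> :: real assume \<delta>: "\<delta> \<in> {0<..}"
        have "hausdorff_pre d \<delta> (\<Union>i. A i) \<le> (\<Sum>i. hausdorff_pre d \<delta> (A i))"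
          using *[of \<delta>] dis by (auto simp: outer_measure_space_def countably_subadditive_def)
        also have "\<dots> \<le> (\<Sum>i. hausdorff_outer d (A i))"
          unfolding hausdorff_outer_def using \<delta>
          by (intro suminf_le summableI SUP_upper)
        finally show "hausdorff_pre d \<delta> (\<Union>i. A i) \<le> (\<Sum>i. hausdorff_outer d (A i))" .
      qed
    qed
  qed
qed

lemma sets_hausdorff:
  assumes "0 \<le> d"
  shows "sets (hausdorff d :: (real ^ 'n) measure) = lambda_system UNIV UNIV (hausdorff_outer d)"
proof -
  have "measure_space (UNIV :: (real ^ 'n) set)
      (lambda_system UNIV UNIV (hausdorff_outer d)) (hausdorff_outer d)"
    using sigma_algebra.caratheodory_lemma[OF sigma_algebra_Pow[of UNIV]]
      outer_measure_space_hausdorff[OF assms] by simp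
  then show ?thesis
    unfolding hausdorff_def measure_space_def
    by (simp add: sigma_algebra.sigma_sets_eq[of UNIV])
qed

lemma emeasure_hausdorff:
  fixes A :: "(real ^ 'n) set"
  assumes "0 \<le> d" "A \<in> sets (hausdorff d)"
  shows "emeasure (hausdorff d) A = hausdorff_outer d A"
proof -
  have "measure_space (UNIV :: (real ^ 'n) set)
      (lambda_system UNIV UNIV (hausdorff_outer d)) (hausdorff_outer d)"
    using sigma_algebra.caratheodory_lemma[OF sigma_algebra_Pow[of UNIV]]
      outer_measure_space_hausdorff[OF assms(1)] by simp
  moreover have "A \<in> lambda_system UNIV UNIV (hausdorff_outer d)"
    using assms sets_hausdorff by blast
  ultimately show ?thesis
    unfolding hausdorff_def measure_space_def
    by (intro emeasure_measure_of_sigma) auto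
qed

definition d_set :: "real \<Rightarrow> (real ^ 'n) set \<Rightarrow> bool" where
  "d_set d S \<longleftrightarrow> closed S \<and> S \<noteq> {} \<and>
     (\<exists>c1>0. \<exists>c2>0. \<forall>w\<in>S. \<forall>r. 0 < r \<and> r \<le> 1 \<longrightarrow>
        ennreal (c1 * r powr d) \<le> emeasure (hausdorff d) (cube w r \<inter> S) \<and>
        emeasure (hausdorff d) (cube w r \<inter> S) \<le> ennreal (c2 * r powr d))"


section \<open>Polynomials and local best approximation\<close>

text \<open>A multi-index is a function \<open>'n \<Rightarrow> nat\<close>. The degree bound is an integer because
  \<open>m = -1\<close> is allowed and gives the zero space.\<close>

definition multi_indices :: "int \<Rightarrow> ('n::finite \<Rightarrow> nat) set" where
  "multi_indices m = {\<beta>. int (\<Sum>i\<in>UNIV. \<beta> i) \<le> m}"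

definition polys :: "int \<Rightarrow> (real ^ 'n \<Rightarrow> real) set" where
  "polys m = {P. \<exists>c. P = (\<lambda>x. \<Sum>\<beta>\<in>multi_indices m. c \<beta> * (\<Prod>i\<in>UNIV. (x $ i) ^ \<beta> i))}"

text \<open>The quantity \<open>\<E>\<^sub>k(g, Q)\<close> in \<open>L\<^sup>u\<close>: on \<open>\<real>\<^sup>n\<close> take \<open>M = lebesgue\<close>, \<open>A = Q\<close>; on a \<open>d\<close>-set \<open>S\<close>
  take \<open>M = hausdorff d\<close>, \<open>A = Q \<inter> S\<close>.\<close>

definition best_approx ::
  "(real ^ 'n) measure \<Rightarrow> nat \<Rightarrow> real \<Rightarrow> (real ^ 'n \<Rightarrow> real) \<Rightarrow> (real ^ 'n) set \<Rightarrow> ennreal" where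
  "best_approx M k u g A =
     (INF P\<in>polys (int k - 1).
        epowr ((\<integral>\<^sup>+x\<in>A. ennreal (\<bar>g x - P x\<bar> powr u) \<partial>M) / emeasure M A) (1 / u))"

definition orthonormal_poly_basis ::
  "(real ^ 'n) measure \<Rightarrow> (real ^ 'n) set \<Rightarrow> int \<Rightarrow> (('n \<Rightarrow> nat) \<Rightarrow> real ^ 'n \<Rightarrow> real) \<Rightarrow> bool" where
  "orthonormal_poly_basis M A m B \<longleftrightarrow>
     (\<forall>\<beta>\<in>multi_indices m. B \<beta> \<in> polys m) \<and>
     (\<forall>P\<in>polys m. \<exists>c. P = (\<lambda>x. \<Sum>\<beta>\<in>multi_indices m. c \<beta> * B \<beta> x)) \<and>
     (\<forall>\<beta>\<in>multi_indices m. \<forall>\<gamma>\<in>multi_indices m.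
        (LINT x:A|M. B \<beta> x * B \<gamma> x) = (if \<beta> = \<gamma> then 1 else 0))"

text \<open>The projection does not depend on which orthonormal basis is selected.\<close>

definition poly_proj ::
  "(real ^ 'n) measure \<Rightarrow> (real ^ 'n) set \<Rightarrow> int \<Rightarrow> (real ^ 'n \<Rightarrow> real) \<Rightarrow> real ^ 'n \<Rightarrow> real" where
  "poly_proj M A m f x =
     (let B = (SOME B. orthonormal_poly_basis M A m B)
      in \<Sum>\<beta>\<in>multi_indices m. (LINT y:A|M. f y * B \<beta> y) * B \<beta> x)"


section \<open>Whitney decompositions and partitions of unity\<close>

text \<open>In Whitney families a cube is represented by the pair of its centre and half its side
  length.\<close>

type_synonym 'n qube = "(real ^ 'n) \<times> real"

abbreviation cube_of :: "'n::finite qube \<Rightarrow> (real ^ 'n) set" where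
  "cube_of Q \<equiv> cube (fst Q) (snd Q)"

text \<open>The dyadic cubes are the sets \<open>\<Prod>\<^sub>i [2\<^sup>-\<^sup>j m\<^sub>i, 2\<^sup>-\<^sup>j (m\<^sub>i + 1)]\<close> with integers \<open>j\<close> and \<open>m\<^sub>i\<close>.\<close>

definition dyadic :: "'n::finite qube \<Rightarrow> bool" where
  "dyadic Q \<longleftrightarrow> (\<exists>(j::int) (m :: 'n \<Rightarrow> int). snd Q = 2 powi (- j) / 2 \<and>
     (\<forall>i. fst Q $ i = 2 powi (- j) * (of_int (m i) + 1 / 2)))"

definition whitney_decomposition :: "(real ^ 'n) set \<Rightarrow> 'n::finite qube set \<Rightarrow> bool" where
  "whitney_decomposition S W \<longleftrightarrow>
     (\<forall>Q\<in>W. dyadic Q) \<and>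
     (\<forall>Q\<in>W. \<forall>Q'\<in>W. Q \<noteq> Q' \<longrightarrow> interior (cube_of Q) \<inter> interior (cube_of Q') = {}) \<and>
     - S = (\<Union>Q\<in>W. cube_of Q) \<and>
     (\<forall>Q\<in>W. sup_diam (cube_of Q) \<le> sup_dist (cube_of Q) S \<and>
             sup_dist (cube_of Q) S \<le> 4 * sup_diam (cube_of Q))"

definition partial_deriv :: "'n::finite \<Rightarrow> (real ^ 'n \<Rightarrow> real) \<Rightarrow> real ^ 'n \<Rightarrow> real" where
  "partial_deriv i f x = frechet_derivative f (at x) (axis i 1)"

text \<open>\<open>partial_derivs [i\<^sub>1, \<dots>, i\<^sub>m] f\<close> is the derivative of \<open>f\<close> in the directions \<open>i\<^sub>1, \<dots>, i\<^sub>m\<close>, that is,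
  \<open>\<partial>\<^sup>\<beta> f\<close> for the multi-index \<open>\<beta> = count_list [i\<^sub>1, \<dots>, i\<^sub>m]\<close>, whose order is \<open>m\<close>. Differentiability of
  all of these everywhere is \<open>C\<^sup>\<infinity>\<close>.\<close>

definition partial_derivs :: "'n::finite list \<Rightarrow> (real ^ 'n \<Rightarrow> real) \<Rightarrow> real ^ 'n \<Rightarrow> real" where
  "partial_derivs is f = foldr partial_deriv is f"

definition C_infinity :: "(real ^ 'n::finite \<Rightarrow> real) \<Rightarrow> bool" where
  "C_infinity f \<longleftrightarrow> (\<forall>is x. partial_derivs is f differentiable (at x))"

text \<open>\<open>C \<beta>\<close> is the constant \<open>c\<^sub>n\<^sub>,\<^sub>\<beta>\<close> in the derivative bounds.\<close>

definition whitney_partition ::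
  "(('n::finite \<Rightarrow> nat) \<Rightarrow> real) \<Rightarrow> (real ^ 'n) set \<Rightarrow> 'n qube set \<Rightarrow>
   ('n qube \<Rightarrow> real ^ 'n \<Rightarrow> real) \<Rightarrow> bool" where
  "whitney_partition C S W \<phi> \<longleftrightarrow>
     (\<forall>Q\<in>W. C_infinity (\<phi> Q) \<and>
        (\<forall>x. 0 \<le> \<phi> Q x \<and> \<phi> Q x \<le> 1) \<and>
        closure {x. \<phi> Q x \<noteq> 0} \<subseteq> cube (fst Q) (9 / 8 * snd Q) \<and>
        (\<forall>is x. \<bar>partial_derivs is (\<phi> Q) x\<bar>
                  \<le> C (count_list is) / sup_diam (cube_of Q) ^ length is)) \<and>
     (\<forall>x. ((\<lambda>Q. \<phi> Q x) has_sum indicator (- S) x) W)"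

definition nearest_points ::
  "(real ^ 'n) set \<Rightarrow> 'n::finite qube set \<Rightarrow> ('n qube \<Rightarrow> real ^ 'n) \<Rightarrow> bool" where
  "nearest_points S W a \<longleftrightarrow>
     (\<forall>Q\<in>W. a Q \<in> S \<and> infnorm (fst Q - a Q) = sup_dist {fst Q} S)"


section \<open>The extension operator\<close>

definition whitney_poly ::
  "real \<Rightarrow> real \<Rightarrow> (real ^ 'n) set \<Rightarrow> ('n::finite qube \<Rightarrow> real ^ 'n) \<Rightarrow> int \<Rightarrow>
   (real ^ 'n \<Rightarrow> real) \<Rightarrow> 'n qube \<Rightarrow> real ^ 'n \<Rightarrow> real" where
  "whitney_poly \<Delta> d S a m f Q =
     (if sup_diam (cube_of Q) \<le> \<Delta>
      then poly_proj (hausdorff d) (cube (a Q) (snd Q / 2) \<inter> S) m f else (\<lambda>x. 0))"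

text \<open>For every \<open>x\<close> only finitely many summands are nonzero.\<close>

definition Ext ::
  "real \<Rightarrow> real \<Rightarrow> (real ^ 'n) set \<Rightarrow> 'n::finite qube set \<Rightarrow> ('n qube \<Rightarrow> real ^ 'n \<Rightarrow> real) \<Rightarrow>
   ('n qube \<Rightarrow> real ^ 'n) \<Rightarrow> nat \<Rightarrow> (real ^ 'n \<Rightarrow> real) \<Rightarrow> real ^ 'n \<Rightarrow> real" where
  "Ext \<Delta> d S W \<phi> a k f x =
     (if x \<in> S then f x
      else (\<Sum>\<^sub>\<infinity>Q\<in>W. \<phi> Q x * whitney_poly \<Delta> d S a (int k - 1) f Q x))"

end

theory Submission
  imports Defs
begin

text \<open>The Hausdorff measure of a \<open>d\<close>-set enters only through upper and lower \<open>d\<close>-regularity. As \<open>d > n - 1\<close>,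
  a neighbourhood of the zero set of a polynomial has small measure (induction on the degree, since
  off the sublevel set of a derivative the zero set is a Lipschitz graph). Hence the mean over a cube
  centred in \<open>S\<close> controls all coefficients, and the projections are bounded in \<open>L\<^sup>1\<close>.

  For a cube of radius \<open>t\<close> within distance \<open>2t\<close> of \<open>S\<close> one compares the extension with a polynomial
  \<open>P\<close> directly: summing over the Whitney cubes costs a factor \<open>t\<close> to the power \<open>n - d\<close>, a convergent geometric
  series over the generations. For a cube at distance \<open>\<delta> \<ge> 2t\<close> the extension minus \<open>P\<close> is a bounded sum of
  smooth functions times small polynomials, and Taylor expansion gains \<open>(t / \<delta>)\<^sup>k\<close>. Integration over
  the centres at distance about \<open>2\<^sup>-\<^sup>i\<close> bounds level \<open>j\<close> of the left side by a geometrically weighted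
  sum over the levels \<open>i \<le> j\<close> of the right side, and \<open>\<alpha> < k\<close> allows a discrete Hardy inequality. Scales
  above \<open>2\<^sup>-\<^sup>6\<close> are absorbed by the \<open>L\<^sup>p\<close> norm.

  Measurability of the local approximation errors in the centre is avoided: their integrals are only
  compared with those of functions that are constant on grid cells.\<close>

section \<open>Cubes and polynomials\<close>

text \<open>Polynomials are read in coordinates \<open>(y - w) / r\<close> of a cube with centre
  \<open>w\<close> and radius \<open>r\<close>; coefficients, supremum and mean are then equivalent
  with constants free of \<open>w\<close> and \<open>r\<close>. As the projections reproduce
  polynomials, f may be replaced by f - P throughout, and P stays arbitrary until the infimum is
  taken.

  The numbers come from the geometry: a point of 9/8 Q is within 12 \<open>snd Q\<close> of
  \<open>a Q\<close> and at least 15/8 \<open>snd Q\<close> from S. The factor 27 collects the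
  resulting enlargements. Recentring at a nearby point of S needs up to 58 radii; 64 keeps radii
  dyadic, and this shift by six levels is the origin of 2^-6. Truncation at diameter 16000, that is
  \<open>snd Q \<le> 8000\<close>, makes the extension vanish at distances above 96000; hence the
  cutoff 100000 and the regularity radius 10^7, which exceeds 27 * 100000.

  For non-measurable functions \<open>nn_integral\<close> is monotone but in general not additive,
  so sums are split only after passing to measurable majorants. A constant defined in a locale
  depends only on the parameters it mentions; this yields independence of f and of the Whitney
  data.\<close>

lemma infnorm_le_iff: "infnorm (x :: real ^ 'n) \<le> r \<longleftrightarrow> (\<forall>i. \<bar>x $ i\<bar> \<le> r)"
proof
  assume "infnorm x \<le> r"
  then show "\<forall>i. \<bar>x $ i\<bar> \<le> r"
    by (meson component_le_infnorm_cart order_trans)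
next
  assume "\<forall>i. \<bar>x $ i\<bar> \<le> r"
  then show "infnorm x \<le> r"
    unfolding infnorm_cart by (intro cSup_least) auto
qed

lemma mem_cube_iff: "y \<in> cube x r \<longleftrightarrow> (\<forall>i. \<bar>y $ i - x $ i\<bar> \<le> r)"
  by (simp add: cube_def infnorm_le_iff)

lemma mem_cube_infnorm: "y \<in> cube x r \<longleftrightarrow> infnorm (x - y) \<le> r"
  by (simp add: cube_def infnorm_sub)

lemma cube_eq_cbox: "cube (x :: real ^ 'n) r = cbox (x - (\<chi> i. r)) (x + (\<chi> i. r))"
proof (rule set_eqI)
  fix y
  have "\<bar>y $ i - x $ i\<bar> \<le> r \<longleftrightarrow> x $ i - r \<le> y $ i \<and> y $ i \<le> x $ i + r" for i by arith
  then show "y \<in> cube x r \<longleftrightarrow> y \<in> cbox (x - (\<chi> i. r)) (x + (\<chi> i. r))"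
    by (simp add: mem_cube_iff mem_box_cart)
qed

lemma closed_cube [simp]: "closed (cube x r)"
  by (simp add: cube_eq_cbox closed_cbox)

lemma cube_borel [measurable, simp]: "cube x r \<in> sets borel"
  by (simp add: borel_closed)

lemma cube_mono: "infnorm (x - y) + r \<le> s \<Longrightarrow> cube y r \<subseteq> cube x s"
proof
  fix z assume a: "infnorm (x - y) + r \<le> s" "z \<in> cube y r"
  have "infnorm (x - z) \<le> infnorm (x - y) + infnorm (y - z)"
    using infnorm_triangle[of "x - y" "y - z"] by simp
  then show "z \<in> cube x s" using a by (simp add: mem_cube_infnorm)
qed

lemma infnorm_triangle3: "infnorm (x - z) \<le> infnorm (x - y) + infnorm (y - z)" for x :: "real ^ 'n"
  using infnorm_triangle[of "x - y" "y - z"] by simp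

lemma emeasure_cube:
  fixes x :: "real ^ 'n"
  assumes "0 \<le> r"
  shows "emeasure lebesgue (cube x r) = ennreal ((2 * r) ^ CARD('n))"
proof -
  have "emeasure lebesgue (cube x r) = emeasure lborel (cube x r)" by simp
  also have "\<dots> = ennreal (\<Prod>b\<in>Basis. ((x + (\<chi> i. r)) - (x - (\<chi> i. r))) \<bullet> b)"
    unfolding cube_eq_cbox using assms
    by (intro emeasure_lborel_cbox) (auto simp: Basis_vec_def inner_axis)
  also have "(\<Prod>b\<in>Basis. ((x + (\<chi> i. r)) - (x - (\<chi> i. r))) \<bullet> b) = (\<Prod>b\<in>(Basis::(real^'n) set). 2 * r)"
    by (intro prod.cong) (auto simp: Basis_vec_def inner_axis)
  finally show ?thesis by simp
qed

section \<open>Polynomials described by their coefficients\<close>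

definition pmon :: "('n::finite \<Rightarrow> nat) \<Rightarrow> real ^ 'n \<Rightarrow> real" where
  "pmon \<beta> x = (\<Prod>i\<in>UNIV. (x $ i) ^ \<beta> i)"

text \<open>The coefficient family stays an explicit argument because the largest coefficient serves
  as the norm of a polynomial in all later estimates.\<close>

definition pol :: "int \<Rightarrow> (('n::finite \<Rightarrow> nat) \<Rightarrow> real) \<Rightarrow> real ^ 'n \<Rightarrow> real" where
  "pol m c x = (\<Sum>\<beta>\<in>multi_indices m. c \<beta> * pmon \<beta> x)"

lemma polys_iff: "P \<in> polys m \<longleftrightarrow> (\<exists>c. P = pol m c)"
  by (simp add: polys_def pol_def[abs_def] pmon_def)

lemma finite_multi_indices [simp, intro]: "finite (multi_indices m :: ('n::finite \<Rightarrow> nat) set)"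
proof (rule finite_subset)
  show "multi_indices m \<subseteq> (PiE UNIV (\<lambda>_. {..nat m}) :: ('n \<Rightarrow> nat) set)"
  proof
    fix \<beta> :: "'n \<Rightarrow> nat" assume "\<beta> \<in> multi_indices m"
    then have "int (sum \<beta> UNIV) \<le> m" by (simp add: multi_indices_def del: of_nat_sum)
    then have "sum \<beta> UNIV \<le> nat m" by linarith
    then have "\<beta> i \<le> nat m" for i
      using member_le_sum[of i UNIV \<beta>] by auto
    then show "\<beta> \<in> PiE UNIV (\<lambda>_. {..nat m})" by auto
  qed
qed (auto intro: finite_PiE)

lemma multi_indices_sum_le: "\<beta> \<in> multi_indices m \<Longrightarrow> sum \<beta> UNIV \<le> nat m"
proof -
  assume "\<beta> \<in> multi_indices m"
  then have "int (sum \<beta> UNIV) \<le> m" by (simp add: multi_indices_def del: of_nat_sum)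
  then show "sum \<beta> UNIV \<le> nat m" by linarith
qed

lemma multi_indices_neg: "m < 0 \<Longrightarrow> multi_indices m = {}"
  by (auto simp: multi_indices_def not_le) (meson le_less_trans not_less of_nat_0_le_iff not_le sum_nonneg)

lemma multi_indices_mono: "m \<le> m' \<Longrightarrow> multi_indices m \<subseteq> multi_indices m'"
  by (auto simp: multi_indices_def)

lemma zero_mem_multi_indices: "0 \<le> m \<Longrightarrow> (\<lambda>i. 0) \<in> multi_indices m"
  by (simp add: multi_indices_def)

lemma pmon_mem_polys:
  assumes "\<beta> \<in> multi_indices m" shows "pmon \<beta> \<in> polys m"
proof -
  have "pmon \<beta> = pol m (\<lambda>\<gamma>. if \<gamma> = \<beta> then 1 else 0)"
    using assms
    by (simp add: pol_def[abs_def] fun_eq_iff[of "pmon \<beta>"] if_distrib[of "\<lambda>c. c * _"]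
        sum.delta cong: if_cong)
  then show ?thesis by (auto simp: polys_iff)
qed

lemma polys_add: "P \<in> polys m \<Longrightarrow> Q \<in> polys m \<Longrightarrow> (\<lambda>x. P x + Q x) \<in> polys m"
proof -
  assume "P \<in> polys m" "Q \<in> polys m"
  then obtain c c' where "P = pol m c" "Q = pol m c'" by (auto simp: polys_iff)
  then have "(\<lambda>x. P x + Q x) = pol m (\<lambda>\<beta>. c \<beta> + c' \<beta>)"
    by (simp add: pol_def fun_eq_iff sum.distrib distrib_right)
  then show ?thesis by (auto simp: polys_iff)
qed

lemma polys_scale: "P \<in> polys m \<Longrightarrow> (\<lambda>x. a * P x) \<in> polys m"
proof -
  assume "P \<in> polys m"
  then obtain c where "P = pol m c" by (auto simp: polys_iff)
  then have "(\<lambda>x. a * P x) = pol m (\<lambda>\<beta>. a * c \<beta>)"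
    by (simp add: pol_def fun_eq_iff sum_distrib_left mult.assoc)
  then show ?thesis by (auto simp: polys_iff)
qed

lemma polys_zero: "(\<lambda>x. 0) \<in> polys m"
proof -
  have "(\<lambda>x. 0) = pol m (\<lambda>\<beta>. 0)" by (simp add: pol_def fun_eq_iff)
  then show ?thesis by (auto simp: polys_iff)
qed

lemma polys_sum: "(\<And>i. i \<in> I \<Longrightarrow> P i \<in> polys m) \<Longrightarrow> (\<lambda>x. \<Sum>i\<in>I. P i x) \<in> polys m"
  by (induction I rule: infinite_finite_induct) (auto intro: polys_add polys_zero)

lemma polys_mono: "m \<le> m' \<Longrightarrow> P \<in> polys m \<Longrightarrow> P \<in> polys m'"
proof -
  assume m: "m \<le> m'" and "P \<in> polys m"
  then obtain c where P: "P = pol m c" by (auto simp: polys_iff)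
  have "(\<lambda>x. \<Sum>\<beta>\<in>multi_indices m. c \<beta> * pmon \<beta> x) \<in> polys m'"
    using multi_indices_mono[OF m] by (intro polys_sum polys_scale pmon_mem_polys) auto
  then show ?thesis using P by (simp add: pol_def[abs_def])
qed

lemma pmon_add: "pmon (\<lambda>i. \<beta> i + \<gamma> i) x = pmon \<beta> x * pmon \<gamma> x"
  by (simp add: pmon_def power_add prod.distrib)

lemma polys_mult:
  assumes "P \<in> polys m" "Q \<in> polys m'" shows "(\<lambda>x. P x * Q x) \<in> polys (m + m')"
proof -
  obtain c c' where PQ: "P = pol m c" "Q = pol m' c'" using assms by (auto simp: polys_iff)
  have "(\<lambda>x. \<Sum>\<beta>\<in>multi_indices m. \<Sum>\<gamma>\<in>multi_indices m'. (c \<beta> * c' \<gamma>) * pmon (\<lambda>i. \<beta> i + \<gamma> i) x)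
      \<in> polys (m + m')"
    by (intro polys_sum polys_scale pmon_mem_polys) (auto simp: multi_indices_def sum.distrib)
  also have "(\<lambda>x. \<Sum>\<beta>\<in>multi_indices m. \<Sum>\<gamma>\<in>multi_indices m'. (c \<beta> * c' \<gamma>) * pmon (\<lambda>i. \<beta> i + \<gamma> i) x)
      = (\<lambda>x. P x * Q x)"
    unfolding PQ pol_def sum_product pmon_add by (simp add: mult_ac)
  finally show ?thesis .
qed

lemma polys_const: "0 \<le> m \<Longrightarrow> (\<lambda>x. a) \<in> polys m"
  using polys_scale[OF pmon_mem_polys[OF zero_mem_multi_indices], of m a]
  by (simp add: pmon_def[abs_def])

lemma polys_coord: "(\<lambda>x. x $ i) \<in> polys 1"
proof -
  have "(\<Sum>x\<in>UNIV. if x = i then 1 else 0 :: nat) = 1" by simp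
  then have "(\<lambda>j. if j = i then 1 else 0) \<in> multi_indices 1"
    unfolding multi_indices_def mem_Collect_eq by presburger
  from pmon_mem_polys[OF this] show ?thesis
    by (simp add: pmon_def[abs_def] if_distrib[of "\<lambda>k. _ ^ k"] cong: if_cong)
qed

lemma polys_power: "P \<in> polys m \<Longrightarrow> (\<lambda>x. P x ^ j) \<in> polys (int j * m)"
proof (induction j)
  case 0
  then show ?case by (simp add: polys_const)
next
  case (Suc j)
  then show ?case using polys_mult[of P m "\<lambda>x. P x ^ j" "int j * m"]
    by (simp add: algebra_simps)
qed

lemma polys_prod:
  "finite I \<Longrightarrow> (\<And>i. i \<in> I \<Longrightarrow> P i \<in> polys (m i)) \<Longrightarrow> (\<lambda>x. \<Prod>i\<in>I. P i x) \<in> polys (\<Sum>i\<in>I. m i)"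
  by (induction I rule: finite_induct) (auto simp: polys_const intro: polys_mult)

lemma polys_affine_coord: "(\<lambda>x. a + b * x $ i) \<in> polys 1"
  using polys_add[OF polys_const polys_scale[OF polys_coord]] by auto

lemma polys_pmon_affine:
  assumes "\<beta> \<in> multi_indices m"
  shows "(\<lambda>x. pmon \<beta> (a + b *\<^sub>R x)) \<in> polys m"
proof -
  have "(\<lambda>x. \<Prod>i\<in>UNIV. (a $ i + b * x $ i) ^ \<beta> i) \<in> polys (\<Sum>i\<in>UNIV. int (\<beta> i) * 1)"
    by (intro polys_prod polys_power polys_affine_coord) auto
  then show ?thesis
    using assms by (auto simp: pmon_def multi_indices_def intro: polys_mono)
qed

lemma polys_affine:
  assumes "P \<in> polys m"
  shows "(\<lambda>x. P (a + b *\<^sub>R x)) \<in> polys m"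
proof -
  obtain c where P: "P = pol m c" using assms by (auto simp: polys_iff)
  have "(\<lambda>x. \<Sum>\<beta>\<in>multi_indices m. c \<beta> * pmon \<beta> (a + b *\<^sub>R x)) \<in> polys m"
    by (intro polys_sum polys_scale polys_pmon_affine) auto
  then show ?thesis by (simp add: P pol_def)
qed

text \<open>Affine substitution preserves the degree bound, so a polynomial can be expanded about
  \<open>w\<close> in units of \<open>r\<close>. In these coordinates \<open>cube w r\<close>
  becomes the unit cube.\<close>

lemma polys_scaled_coeffs:
  assumes "P \<in> polys m" "r \<noteq> 0"
  obtains c where "\<And>y. P y = pol m c ((1 / r) *\<^sub>R (y - w))"
proof -
  obtain c where c: "(\<lambda>x. P (w + r *\<^sub>R x)) = pol m c"
    using polys_affine[OF assms(1), of w r] by (auto simp: polys_iff)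
  have "P y = pol m c ((1 / r) *\<^sub>R (y - w))" for y
    using fun_cong[OF c, of "(1 / r) *\<^sub>R (y - w)"] assms(2) by simp
  then show ?thesis by (rule that)
qed

lemma abs_pmon_le:
  assumes "\<beta> \<in> multi_indices m" "1 \<le> B" "\<And>i. \<bar>x $ i\<bar> \<le> B"
  shows "\<bar>pmon \<beta> x\<bar> \<le> B ^ nat m"
proof -
  have "\<bar>pmon \<beta> x\<bar> = (\<Prod>i\<in>UNIV. \<bar>x $ i\<bar> ^ \<beta> i)" by (simp add: pmon_def abs_prod power_abs)
  also have "\<dots> \<le> (\<Prod>i\<in>UNIV. B ^ \<beta> i)" using assms by (intro prod_mono) (auto intro: power_mono)
  also have "\<dots> = B ^ (\<Sum>i\<in>UNIV. \<beta> i)" by (simp add: power_sum)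
  also have "\<dots> \<le> B ^ nat m"
    using assms by (intro power_increasing multi_indices_sum_le) auto
  finally show ?thesis .
qed

lemma abs_pol_le:
  fixes c :: "('n::finite \<Rightarrow> nat) \<Rightarrow> real"
  assumes "1 \<le> B" "\<And>i. \<bar>x $ i\<bar> \<le> B" "\<And>\<beta>. \<beta> \<in> multi_indices m \<Longrightarrow> \<bar>c \<beta>\<bar> \<le> L"
  shows "\<bar>pol m c x\<bar> \<le> real (card (multi_indices m :: ('n \<Rightarrow> nat) set)) * B ^ nat m * L"
proof -
  have "\<bar>pol m c x\<bar> \<le> (\<Sum>\<beta>\<in>multi_indices m. \<bar>c \<beta> * pmon \<beta> x\<bar>)" unfolding pol_def by (rule sum_abs)
  also have "\<dots> \<le> (\<Sum>\<beta>\<in>(multi_indices m :: ('n \<Rightarrow> nat) set). L * B ^ nat m)"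
  proof (intro sum_mono)
    fix \<beta> :: "'n \<Rightarrow> nat" assume b: "\<beta> \<in> multi_indices m"
    have "0 \<le> L" using assms(3)[OF b] by linarith
    then show "\<bar>c \<beta> * pmon \<beta> x\<bar> \<le> L * B ^ nat m"
      using abs_pmon_le[OF b assms(1,2)] assms(3)[OF b] by (simp add: abs_mult mult_mono)
  qed
  finally show ?thesis by (simp add: mult_ac)
qed

lemma continuous_on_pmon [continuous_intros]: "continuous_on A (pmon \<beta>)"
  unfolding pmon_def by (intro continuous_intros)

lemma continuous_on_pol: "continuous_on A (pol m c)"
  unfolding pol_def by (intro continuous_intros)

lemma pol_borel [measurable]: "pol m c \<in> borel_measurable borel"
  by (intro borel_measurable_continuous_onI continuous_on_pol)

lemma polys_borel: "P \<in> polys m \<Longrightarrow> P \<in> borel_measurable borel"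
  by (auto simp: polys_iff)

section \<open>Sublevel sets of polynomials\<close>

text \<open>An interval of length 2b contains at most 2b + 1 integers, and the box is a product of
  intervals. All later counts of grid cells and dyadic cubes reduce to this bound.\<close>

lemma card_int_box:
  fixes z b :: "'n::finite \<Rightarrow> real"
  assumes "\<And>i. 0 \<le> b i"
  shows "finite {m :: 'n \<Rightarrow> int. \<forall>i. \<bar>of_int (m i) - z i\<bar> \<le> b i}"
    and "real (card {m :: 'n \<Rightarrow> int. \<forall>i. \<bar>of_int (m i) - z i\<bar> \<le> b i}) \<le> (\<Prod>i\<in>UNIV. 2 * b i + 1)"
proof -
  have eq: "{m :: 'n \<Rightarrow> int. \<forall>i. \<bar>of_int (m i) - z i\<bar> \<le> b i} =
      PiE UNIV (\<lambda>i. {\<lceil>z i - b i\<rceil>..\<lfloor>z i + b i\<rfloor>})"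
    by (auto simp: PiE_UNIV_domain abs_le_iff ceiling_le_iff le_floor_iff algebra_simps
        intro: order_trans[OF _ add_le_cancel_left[THEN iffD2]])
  show "finite {m :: 'n \<Rightarrow> int. \<forall>i. \<bar>of_int (m i) - z i\<bar> \<le> b i}"
    unfolding eq by (intro finite_PiE) auto
  have "real (card {\<lceil>z i - b i\<rceil>..\<lfloor>z i + b i\<rfloor>}) \<le> 2 * b i + 1" for i
    using assms[of i] by simp linarith
  then show "real (card {m :: 'n \<Rightarrow> int. \<forall>i. \<bar>of_int (m i) - z i\<bar> \<le> b i}) \<le> (\<Prod>i\<in>UNIV. 2 * b i + 1)"
    unfolding eq card_PiE[OF finite_class.finite_UNIV] of_nat_prod by (intro prod_mono) auto
qed

text \<open>In the unit cube the product and power difference bounds change a monomial by at most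
  its degree times \<open>e\<close>.\<close>

lemma pol_lipschitz:
  fixes x y :: "real ^ 'n"
  assumes "x \<in> cube 0 1" "y \<in> cube 0 1" "\<And>i. \<bar>x $ i - y $ i\<bar> \<le> e"
    and "\<And>\<beta>. \<beta> \<in> multi_indices m \<Longrightarrow> \<bar>c \<beta>\<bar> \<le> L"
  shows "\<bar>pol m c x - pol m c y\<bar> \<le>
    real (card (multi_indices m :: ('n \<Rightarrow> nat) set)) * L * real (nat m) * e"
proof -
  have e0: "0 \<le> e" using assms(3) abs_ge_zero order_trans by blast
  have xy: "\<bar>x $ i\<bar> \<le> 1" "\<bar>y $ i\<bar> \<le> 1" for i using assms(1,2) by (auto simp: mem_cube_iff)
  have *: "\<bar>pmon \<beta> x - pmon \<beta> y\<bar> \<le> real (nat m) * e" if b: "\<beta> \<in> multi_indices m" for \<beta> :: "'n \<Rightarrow> nat"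
  proof -
    have "\<bar>pmon \<beta> x - pmon \<beta> y\<bar> \<le> (\<Sum>i\<in>UNIV. \<bar>x $ i ^ \<beta> i - y $ i ^ \<beta> i\<bar>)"
      unfolding pmon_def real_norm_def[symmetric]
      using xy by (intro norm_prod_diff) (auto simp: power_abs power_le_one)
    also have "\<dots> \<le> (\<Sum>i\<in>UNIV. real (\<beta> i) * e)"
    proof (intro sum_mono)
      fix i
      have "\<bar>x $ i ^ \<beta> i - y $ i ^ \<beta> i\<bar> \<le> real (\<beta> i) * \<bar>x $ i - y $ i\<bar>"
        using norm_power_diff[of "x $ i" "y $ i" "\<beta> i"] xy by simp
      also have "\<dots> \<le> real (\<beta> i) * e" using assms(3) by (intro mult_left_mono) auto
      finally show "\<bar>x $ i ^ \<beta> i - y $ i ^ \<beta> i\<bar> \<le> real (\<beta> i) * e" .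
    qed
    also have "\<dots> = real (sum \<beta> UNIV) * e" by (simp add: sum_distrib_right)
    also have "\<dots> \<le> real (nat m) * e"
      using multi_indices_sum_le[OF b] e0 by (intro mult_right_mono) (simp_all del: of_nat_sum)
    finally show ?thesis .
  qed
  have "\<bar>pol m c x - pol m c y\<bar> = \<bar>\<Sum>\<beta>\<in>multi_indices m. c \<beta> * (pmon \<beta> x - pmon \<beta> y)\<bar>"
    by (simp add: pol_def sum_subtractf algebra_simps)
  also have "\<dots> \<le> (\<Sum>\<beta>\<in>multi_indices m. \<bar>c \<beta> * (pmon \<beta> x - pmon \<beta> y)\<bar>)" by (rule sum_abs)
  also have "\<dots> \<le> (\<Sum>\<beta>\<in>(multi_indices m :: ('n \<Rightarrow> nat) set). L * (real (nat m) * e))"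
  proof (intro sum_mono)
    fix \<beta> :: "'n \<Rightarrow> nat" assume b: "\<beta> \<in> multi_indices m"
    have "0 \<le> L" using assms(4)[OF b] by linarith
    then show "\<bar>c \<beta> * (pmon \<beta> x - pmon \<beta> y)\<bar> \<le> L * (real (nat m) * e)"
      unfolding abs_mult using *[OF b] assms(4)[OF b] by (intro mult_mono) auto
  qed
  finally show ?thesis by (simp add: mult_ac)
qed

text \<open>These are the coefficients of the partial derivative in direction \<open>i\<close>.
  Indexing by the lowered multi-index \<open>\<gamma>\<close> avoids truncated subtraction.\<close>

definition dcoeff :: "'n \<Rightarrow> (('n::finite \<Rightarrow> nat) \<Rightarrow> real) \<Rightarrow> ('n \<Rightarrow> nat) \<Rightarrow> real" where
  "dcoeff i c \<gamma> = c (\<gamma>(i := Suc (\<gamma> i))) * real (Suc (\<gamma> i))"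

text \<open>With \<open>s\<close> varying, this runs along the line through \<open>z\<close>
  parallel to the axis \<open>i\<close>, so that one-variable calculus applies.\<close>

definition upd :: "real ^ 'n \<Rightarrow> 'n::finite \<Rightarrow> real \<Rightarrow> real ^ 'n" where
  "upd z i s = (\<chi> j. if j = i then s else z $ j)"

lemma upd_nth [simp]: "upd z i s $ j = (if j = i then s else z $ j)"
  by (simp add: upd_def)

lemma multi_indices_upd_Suc:
  "\<gamma>(i := Suc (\<gamma> i)) \<in> multi_indices (m + 1) \<longleftrightarrow> \<gamma> \<in> multi_indices m"
proof -
  have "(\<Sum>j\<in>UNIV. (\<gamma>(i := Suc (\<gamma> i))) j) = (\<Sum>j\<in>UNIV. \<gamma> j + (if j = i then 1 else 0))"
    by (intro sum.cong) auto
  also have "\<dots> = Suc (sum \<gamma> UNIV)" by (simp add: sum.distrib)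
  finally show ?thesis unfolding multi_indices_def mem_Collect_eq by linarith
qed

lemma pmon_upd: "pmon \<beta> (upd z i s) = s ^ \<beta> i * (\<Prod>j\<in>UNIV - {i}. z $ j ^ \<beta> j)"
  unfolding pmon_def by (subst prod.remove[of _ i]) (auto intro!: prod.cong)

lemma DERIV_pol_upd:
  "((\<lambda>s. pol (m + 1) c (upd z i s)) has_real_derivative pol m (dcoeff i c) (upd z i s)) (at s)"
proof -
  let ?g = "\<lambda>\<beta>. c \<beta> * (real (\<beta> i) * s ^ (\<beta> i - 1) * (\<Prod>j\<in>UNIV - {i}. z $ j ^ \<beta> j))"
  have "((\<lambda>s. \<Sum>\<beta>\<in>multi_indices (m + 1). c \<beta> * (s ^ \<beta> i * (\<Prod>j\<in>UNIV - {i}. z $ j ^ \<beta> j)))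
     has_real_derivative (\<Sum>\<beta>\<in>multi_indices (m + 1). ?g \<beta>)) (at s)"
    by (auto intro!: derivative_eq_intros sum.cong simp: mult_ac)
  also have "(\<Sum>\<beta>\<in>multi_indices (m + 1). ?g \<beta>) = (\<Sum>\<beta>\<in>{\<beta>\<in>multi_indices (m + 1). 0 < \<beta> i}. ?g \<beta>)"
    by (intro sum.mono_neutral_right) auto
  also have "\<dots> = (\<Sum>\<gamma>\<in>multi_indices m. ?g (\<gamma>(i := Suc (\<gamma> i))))"
  proof (rule sum.reindex_bij_witness[of _ "\<lambda>\<gamma>. \<gamma>(i := Suc (\<gamma> i))" "\<lambda>\<beta>. \<beta>(i := \<beta> i - 1)"])
    fix \<beta> assume b: "\<beta> \<in> {\<beta> \<in> multi_indices (m + 1). 0 < \<beta> i}"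
    let ?\<gamma> = "\<beta>(i := \<beta> i - 1)"
    show eq: "?\<gamma>(i := Suc (?\<gamma> i)) = \<beta>" using b by auto
    show "?\<gamma> \<in> multi_indices m" using b multi_indices_upd_Suc[of ?\<gamma> i m] unfolding eq by simp
    show "?g (?\<gamma>(i := Suc (?\<gamma> i))) = ?g \<beta>" unfolding eq ..
  qed (auto simp: multi_indices_upd_Suc)
  also have "\<dots> = pol m (dcoeff i c) (upd z i s)"
    unfolding pol_def pmon_upd dcoeff_def by (intro sum.cong refl) (auto intro!: prod.cong simp: mult_ac)
  finally show ?thesis by (simp add: pol_def pmon_upd)
qed

lemma exists_small_power:
  fixes A s \<theta> b :: real
  assumes "0 < s" "0 < \<theta>" "0 < b" "0 \<le> A"
  shows "\<exists>\<eta>>0. \<eta> \<le> b \<and> A * \<eta> powr s \<le> \<theta>"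
proof -
  \<comment> \<open>The denominator \<open>A + 1\<close> also covers \<open>A = 0\<close>.\<close>
  define \<eta> where "\<eta> = min b ((\<theta> / (A + 1)) powr (1 / s))"
  have \<eta>: "0 < \<eta>" "\<eta> \<le> b" using assms by (auto simp: \<eta>_def)
  have "\<eta> powr s \<le> ((\<theta> / (A + 1)) powr (1 / s)) powr s"
    using \<open>0 < \<eta>\<close> assms by (intro powr_mono2) (auto simp: \<eta>_def)
  then have "\<eta> powr s \<le> \<theta> / (A + 1)" using assms by (simp add: powr_powr)
  then have "A * \<eta> powr s \<le> A * (\<theta> / (A + 1))" using assms by (intro mult_left_mono) auto
  also have "\<dots> \<le> \<theta>" using assms by (simp add: field_simps)
  finally have "A * \<eta> powr s \<le> \<theta>" .
  with \<eta> show ?thesis by blast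
qed

text \<open>In a thin box, the region where the polynomial is small while its derivative in the direction
  of the long side is not is a Lipschitz graph over the short sides.\<close>

lemma steep_part_in_cube:
  fixes x y :: "real ^ 'n"
  assumes m: "0 \<le> m" and \<rho>: "0 < \<rho>" "\<Lambda> * \<rho> \<le> \<epsilon>' / 2" and \<epsilon>': "0 < \<epsilon>'" and \<eta>: "0 < \<eta>" "\<eta> \<le> \<rho>"
    and c: "\<And>\<beta>. \<beta> \<in> multi_indices (m + 1) \<Longrightarrow> \<bar>c \<beta>\<bar> \<le> L"
    and \<Lambda>1: "real (card (multi_indices (m + 1) :: ('n \<Rightarrow> nat) set)) * L * real (nat (m + 1)) \<le> \<Lambda>"
    and \<Lambda>2: "real (card (multi_indices m :: ('n \<Rightarrow> nat) set)) * L' * real (nat m) \<le> \<Lambda>"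
    and c': "\<And>\<beta>. \<beta> \<in> multi_indices m \<Longrightarrow> \<bar>dcoeff i c \<beta>\<bar> \<le> L'"
    and xy: "x \<in> cube 0 1" "y \<in> cube 0 1" "\<bar>pol (m + 1) c x\<bar> \<le> \<eta>" "\<bar>pol (m + 1) c y\<bar> \<le> \<eta>"
      "\<epsilon>' < \<bar>pol m (dcoeff i c) x\<bar>"
    and close: "\<And>j. j \<noteq> i \<Longrightarrow> \<bar>x $ j - y $ j\<bar> \<le> \<eta>" "\<bar>x $ i - y $ i\<bar> \<le> \<rho>"
  shows "y \<in> cube x (max 1 (2 * (2 + \<Lambda>) / \<epsilon>') * \<eta>)"
proof -
  let ?H = "max 1 (2 * (2 + \<Lambda>) / \<epsilon>')"
  have H: "\<eta> \<le> ?H * \<eta>" using mult_right_mono[of 1 ?H \<eta>] \<eta> by simp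
  \<comment> \<open>The passage from \<open>x\<close> to \<open>y\<close> is broken at
    \<open>x'\<close>: the first leg runs along the axis \<open>i\<close>, where the derivative is
    large, and the second changes only the short coordinates.\<close>
  define x' where "x' = upd x i (y $ i)"
  have x'c: "upd x i s \<in> cube 0 1" if "s \<in> {min (x$i) (y$i)..max (x$i) (y$i)}" for s
  proof -
    have "\<bar>x $ i\<bar> \<le> 1" "\<bar>y $ i\<bar> \<le> 1" using xy(1,2) by (auto simp: mem_cube_iff)
    then have "\<bar>s\<bar> \<le> 1" using that by (auto simp: min_def max_def split: if_splits)
    then show ?thesis using xy(1) by (auto simp: mem_cube_iff)
  qed
  have x'1: "x' \<in> cube 0 1" unfolding x'_def by (rule x'c) auto
  have "\<bar>pol (m + 1) c x' - pol (m + 1) c y\<bar> \<le>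
      real (card (multi_indices (m + 1) :: ('n \<Rightarrow> nat) set)) * L * real (nat (m + 1)) * \<eta>"
    using close(1) \<eta> by (intro pol_lipschitz[OF x'1 xy(2) _ c]) (auto simp: x'_def)
  also have "\<dots> \<le> \<Lambda> * \<eta>" using \<Lambda>1 \<eta> by (intro mult_right_mono) auto
  finally have A: "\<bar>pol (m + 1) c x' - pol (m + 1) c y\<bar> \<le> \<Lambda> * \<eta>" .
  \<comment> \<open>The derivative exceeds \<open>\<epsilon>'\<close> at \<open>x\<close>, and a
    move of at most \<open>\<rho>\<close> along the axis changes it by at most
    \<open>\<Lambda> * \<rho>\<close>, which is at most half of that.\<close>
  have D: "\<epsilon>' / 2 \<le> \<bar>pol m (dcoeff i c) (upd x i s)\<bar>"
    if s: "s \<in> {min (x$i) (y$i)..max (x$i) (y$i)}" for s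
  proof -
    have "\<bar>x $ i - s\<bar> \<le> \<rho>" using s close(2) by (auto simp: min_def max_def split: if_splits)
    then have "\<bar>pol m (dcoeff i c) x - pol m (dcoeff i c) (upd x i s)\<bar> \<le>
       real (card (multi_indices m :: ('n \<Rightarrow> nat) set)) * L' * real (nat m) * \<rho>"
      using \<rho> by (intro pol_lipschitz[OF xy(1) x'c[OF s] _ c']) auto
    also have "\<dots> \<le> \<Lambda> * \<rho>" using \<Lambda>2 \<rho> by (intro mult_right_mono) auto
    finally show ?thesis using xy(5) \<rho>(2) by linarith
  qed
  \<comment> \<open>Mean value theorem between \<open>x\<close> and \<open>x'\<close>: the slope is
    at least \<open>\<epsilon>' / 2\<close>, while the values differ by at most
    \<open>2 * \<eta>\<close> from the sublevel condition and \<open>\<Lambda> * \<eta>\<close> from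
    the second leg.\<close>
  have "\<bar>x $ i - y $ i\<bar> * (\<epsilon>' / 2) \<le> (2 + \<Lambda>) * \<eta>"
  proof (cases "x $ i = y $ i")
    case True
    then have "x' = x" by (auto simp: x'_def vec_eq_iff)
    have "0 \<le> \<Lambda> * \<eta>" using A by linarith
    then show ?thesis using True \<eta> by (simp add: algebra_simps)
  next
    case False
    let ?a = "min (x$i) (y$i)" and ?b = "max (x$i) (y$i)"
    have "?a < ?b" using False by auto
    from MVT2[OF this DERIV_pol_upd, of m c x i]
    obtain s where s: "?a < s" "s < ?b"
      "pol (m + 1) c (upd x i ?b) - pol (m + 1) c (upd x i ?a) =
        (?b - ?a) * pol m (dcoeff i c) (upd x i s)" by auto
    have upx: "upd x i (x $ i) = x" by (auto simp: vec_eq_iff)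
    have "\<bar>x $ i - y $ i\<bar> * (\<epsilon>' / 2) \<le> \<bar>?b - ?a\<bar> * \<bar>pol m (dcoeff i c) (upd x i s)\<bar>"
    proof (intro mult_mono)
      show "\<bar>x $ i - y $ i\<bar> \<le> \<bar>?b - ?a\<bar>" by (cases "x $ i \<le> y $ i") auto
    qed (use D[of s] s \<epsilon>' in auto)
    also have "\<dots> = \<bar>pol (m + 1) c (upd x i ?b) - pol (m + 1) c (upd x i ?a)\<bar>"
      unfolding s(3) abs_mult ..
    also have "\<dots> = \<bar>pol (m + 1) c x - pol (m + 1) c x'\<bar>"
      by (cases "x $ i \<le> y $ i") (simp_all add: min_def max_def x'_def upx abs_minus_commute)
    also have "\<dots> \<le> 2 * \<eta> + \<Lambda> * \<eta>" using A xy(3,4) by linarith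
    finally show ?thesis by (simp add: algebra_simps)
  qed
  then have "\<bar>x $ i - y $ i\<bar> \<le> 2 * (2 + \<Lambda>) / \<epsilon>' * \<eta>"
    using \<epsilon>' by (simp add: field_simps)
  also have "\<dots> \<le> ?H * \<eta>" using \<eta> by (intro mult_right_mono) auto
  finally have i: "\<bar>x $ i - y $ i\<bar> \<le> ?H * \<eta>" .
  have "\<bar>y $ j - x $ j\<bar> \<le> ?H * \<eta>" for j
  proof (cases "j = i")
    case True
    then show ?thesis using i by (simp add: abs_minus_commute)
  next
    case False
    then have "\<bar>x $ j - y $ j\<bar> \<le> ?H * \<eta>" using close(1)[OF False] H by linarith
    then show ?thesis by (simp only: abs_minus_commute)
  qed
  then show ?thesis unfolding mem_cube_iff by blast
qed

text \<open>The unit cube is cut into boxes of side \<open>\<rho>\<close> in direction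
  \<open>i\<close> and \<open>\<eta>\<close> in the other n - 1 directions. By \<open>close\<close>,
  the part of \<open>T\<close> in one box lies in a single cube of radius \<open>h * \<eta>\<close>.
  The number of boxes, of order \<eta> to the power -(n - 1), times the measure of such a cube gives
  the exponent d - (n - 1), whose positivity later makes the bound small.\<close>

lemma emeasure_steep_part:
  fixes \<nu> :: "(real ^ 'n) measure" and T :: "(real ^ 'n) set"
  assumes sets: "sets \<nu> = sets borel"
    and reg: "\<And>z r. 0 < r \<Longrightarrow> r \<le> 1 \<Longrightarrow> emeasure \<nu> (cube z r) \<le> ennreal (H * r powr d * V)"
    and pos: "0 \<le> H" "0 \<le> V" "0 < \<eta>" "\<eta> \<le> \<rho>" "\<rho> \<le> 1" "0 < h" "h * \<eta> \<le> 1"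
    and T: "T \<subseteq> cube 0 1"
    and close: "\<And>x y. x \<in> T \<Longrightarrow> y \<in> T \<Longrightarrow> (\<And>j. j \<noteq> i \<Longrightarrow> \<bar>x $ j - y $ j\<bar> \<le> \<eta>) \<Longrightarrow>
        \<bar>x $ i - y $ i\<bar> \<le> \<rho> \<Longrightarrow> y \<in> cube x (h * \<eta>)"
  shows "emeasure \<nu> T \<le> ennreal (5 ^ CARD('n) / \<rho> * H * h powr d * \<eta> powr (d - (real CARD('n) - 1)) * V)"
proof -
  define side where "side j = (if j = i then \<rho> else \<eta>)" for j
  have side: "0 < side j" "side j \<le> 1" for j using pos by (auto simp: side_def)
  have side': "0 \<le> 1 / side j + 1" for j using side[of j] by (intro add_nonneg_nonneg) auto
  define B where "B = {m :: 'n \<Rightarrow> int. \<forall>j. \<bar>of_int (m j) - 0\<bar> \<le> 1 / side j + 1}"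
  define cell where "cell m = {z \<in> T. \<forall>j. \<lfloor>z $ j / side j\<rfloor> = m j}" for m :: "'n \<Rightarrow> int"
  \<comment> \<open>The covering cube may be centred at any point of the cell; empty cells get the
    empty set so that the choice is never evaluated there.\<close>
  define U where "U m = (if cell m = {} then {} else cube (SOME x. x \<in> cell m) (h * \<eta>))" for m
  have finB: "finite B" unfolding B_def using side' by (intro card_int_box)
  have cellU: "cell m \<subseteq> U m" for m
  proof
    fix y assume y: "y \<in> cell m"
    define x where "x = (SOME x. x \<in> cell m)"
    have x: "x \<in> cell m" unfolding x_def using y by (rule someI)
    have *: "\<bar>x $ j - y $ j\<bar> \<le> side j" for j
    proof -
      have "\<lfloor>x $ j / side j\<rfloor> = \<lfloor>y $ j / side j\<rfloor>" using x y by (simp add: cell_def)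
      then have "\<bar>x $ j / side j - y $ j / side j\<bar> \<le> 1" by linarith
      then show ?thesis using side[of j]
        by (simp add: diff_divide_distrib[symmetric] abs_divide pos_divide_le_eq)
    qed
    have "y \<in> cube x (h * \<eta>)"
    proof (rule close)
      show "x \<in> T" "y \<in> T" using x y by (auto simp: cell_def)
      show "\<bar>x $ j - y $ j\<bar> \<le> \<eta>" if "j \<noteq> i" for j using *[of j] that by (simp add: side_def)
      show "\<bar>x $ i - y $ i\<bar> \<le> \<rho>" using *[of i] by (simp add: side_def)
    qed
    then show "y \<in> U m" using y by (auto simp: U_def x_def)
  qed
  have TU: "T \<subseteq> (\<Union>m\<in>B. U m)"
  proof
    fix x assume x: "x \<in> T"
    define m where "m = (\<lambda>j. \<lfloor>x $ j / side j\<rfloor>)"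
    have "\<bar>real_of_int (m j)\<bar> \<le> 1 / side j + 1" for j
    proof -
      have "\<bar>x $ j\<bar> \<le> 1" using x T by (auto simp: mem_cube_iff)
      then have "\<bar>x $ j / side j\<bar> \<le> 1 / side j"
        using side[of j] by (simp add: abs_divide divide_right_mono)
      then show ?thesis unfolding m_def by linarith
    qed
    then have "m \<in> B" by (simp add: B_def)
    moreover have "x \<in> cell m" using x by (simp add: cell_def m_def)
    ultimately show "x \<in> (\<Union>m\<in>B. U m)" using cellU by blast
  qed
  have "emeasure \<nu> T \<le> emeasure \<nu> (\<Union>m\<in>B. U m)"
    using TU finB by (intro emeasure_mono) (auto simp: sets U_def)
  also have "\<dots> \<le> (\<Sum>m\<in>B. emeasure \<nu> (U m))"
    using finB by (intro emeasure_subadditive_finite) (auto simp: sets U_def)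
  also have "\<dots> \<le> (\<Sum>m\<in>B. ennreal (H * (h * \<eta>) powr d * V))"
  proof (intro sum_mono)
    fix m show "emeasure \<nu> (U m) \<le> ennreal (H * (h * \<eta>) powr d * V)"
      using reg[of "h * \<eta>"] pos by (auto simp: U_def)
  qed
  also have "\<dots> = ennreal (real (card B) * (H * (h * \<eta>) powr d * V))"
    by (simp add: ennreal_mult' ennreal_of_nat_eq_real_of_nat)
  also have "\<dots> \<le> ennreal (5 ^ CARD('n) / \<rho> * H * h powr d * \<eta> powr (d - (real CARD('n) - 1)) * V)"
  proof (rule ennreal_leI)
    have "real (card B) \<le> (\<Prod>j\<in>UNIV. 2 * (1 / side j + 1) + 1)"
      unfolding B_def using side' by (intro card_int_box)
    \<comment> \<open>Since \<open>side j \<le> 1\<close>, the summand 3 is at most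
      \<open>3 / side j\<close>. This produces the 5 in the bound.\<close>
    also have "\<dots> \<le> (\<Prod>j\<in>UNIV. 5 / side j)"
    proof (intro prod_mono conjI)
      fix j
      show "0 \<le> 2 * (1 / side j + 1) + 1" using side[of j]
        by (intro add_nonneg_nonneg mult_nonneg_nonneg) auto
      show "2 * (1 / side j + 1) + 1 \<le> 5 / side j" using side[of j] by (simp add: field_simps)
    qed
    also have "\<dots> = 5 / \<rho> * (\<Prod>j\<in>UNIV - {i}. 5 / side j)"
      by (subst prod.remove[of _ i]) (auto simp: side_def)
    also have "(\<Prod>j\<in>UNIV - {i}. 5 / side j) = (\<Prod>j\<in>UNIV - {i}. 5 / \<eta>)"
      by (intro prod.cong) (auto simp: side_def)
    also have "\<dots> = (5 / \<eta>) ^ (CARD('n) - 1)" by (simp add: card_Diff_singleton)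
    also have "5 / \<rho> * \<dots> = 5 ^ CARD('n) / \<rho> * (1 / \<eta>) ^ (CARD('n) - 1)"
      using power_Suc[of "5::real" "CARD('n) - 1"] by (simp add: power_divide)
    also have "(1 / \<eta>) ^ (CARD('n) - 1) = \<eta> powr (- (real CARD('n) - 1))"
    proof -
      have "real (CARD('n) - 1) = real CARD('n) - 1" by (simp add: of_nat_diff Suc_leI)
      then show ?thesis using pos powr_realpow[of \<eta> "CARD('n) - 1"]
        by (simp add: powr_minus power_divide inverse_eq_divide del: minus_diff_eq)
    qed
    finally have cB: "real (card B) \<le> 5 ^ CARD('n) / \<rho> * \<eta> powr (- (real CARD('n) - 1))" .
    have "real (card B) * (H * (h * \<eta>) powr d * V) \<le>
        (5 ^ CARD('n) / \<rho> * \<eta> powr (- (real CARD('n) - 1))) * (H * (h * \<eta>) powr d * V)"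
      using pos by (intro mult_right_mono cB) auto
    also have "\<dots> = 5 ^ CARD('n) / \<rho> * H * h powr d * (\<eta> powr (- (real CARD('n) - 1)) * \<eta> powr d) * V"
      using pos by (simp add: powr_mult)
    also have "\<eta> powr (- (real CARD('n) - 1)) * \<eta> powr d = \<eta> powr (d - (real CARD('n) - 1))"
      by (simp add: powr_add[symmetric] algebra_simps)
    finally show "real (card B) * (H * (h * \<eta>) powr d * V) \<le>
        5 ^ CARD('n) / \<rho> * H * h powr d * \<eta> powr (d - (real CARD('n) - 1)) * V" .
  qed
  finally show ?thesis .
qed


lemma multi_indices_0: "multi_indices 0 = {\<lambda>i::'n::finite. 0}"
proof -
  have "\<beta> = (\<lambda>i. 0)" if "\<beta> \<in> multi_indices 0" for \<beta> :: "'n \<Rightarrow> nat"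
    using multi_indices_sum_le[OF that] by (simp add: fun_eq_iff)
  then show ?thesis using zero_mem_multi_indices[of 0] by blast
qed

lemma pol_0: "pol 0 c x = c (\<lambda>i. 0)"
  by (simp add: pol_def pmon_def multi_indices_0)

text \<open>On the unit cube monomials are bounded by 1, so small nonconstant coefficients cannot
  cancel the constant term. This is the degenerate case of the induction below.\<close>

lemma pol_lower_bound:
  fixes c :: "('n::finite \<Rightarrow> nat) \<Rightarrow> real"
  assumes m: "0 \<le> m" and x: "x \<in> cube 0 1" and e: "0 \<le> e"
    and small: "\<And>\<beta>. \<beta> \<in> multi_indices m \<Longrightarrow> \<beta> \<noteq> (\<lambda>i. 0) \<Longrightarrow> \<bar>c \<beta>\<bar> \<le> e"
  shows "\<bar>c (\<lambda>i. 0)\<bar> - real (card (multi_indices m :: ('n \<Rightarrow> nat) set)) * e \<le> \<bar>pol m c x\<bar>"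
proof -
  let ?I = "multi_indices m :: ('n \<Rightarrow> nat) set" and ?z = "(\<lambda>i. 0) :: 'n \<Rightarrow> nat"
  have z: "?z \<in> ?I" using m by (rule zero_mem_multi_indices)
  have 1: "pol m c x = c ?z + (\<Sum>\<beta>\<in>?I - {?z}. c \<beta> * pmon \<beta> x)"
    unfolding pol_def using z by (subst sum.remove[of _ ?z]) (auto simp: pmon_def)
  have "\<bar>\<Sum>\<beta>\<in>?I - {?z}. c \<beta> * pmon \<beta> x\<bar> \<le> (\<Sum>\<beta>\<in>?I - {?z}. \<bar>c \<beta> * pmon \<beta> x\<bar>)" by (rule sum_abs)
  also have "\<dots> \<le> (\<Sum>\<beta>\<in>?I - {?z}. e)"
  proof (intro sum_mono)
    fix \<beta> assume b: "\<beta> \<in> ?I - {?z}"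
    have "\<bar>pmon \<beta> x\<bar> \<le> 1 ^ nat m"
      using b x by (intro abs_pmon_le) (auto simp: mem_cube_iff)
    then have "\<bar>c \<beta>\<bar> * \<bar>pmon \<beta> x\<bar> \<le> e * 1"
      using small[of \<beta>] b by (intro mult_mono) auto
    then show "\<bar>c \<beta> * pmon \<beta> x\<bar> \<le> e" by (simp add: abs_mult)
  qed
  also have "\<dots> \<le> (\<Sum>\<beta>\<in>?I. e)" using e by (intro sum_mono2) auto
  finally have "\<bar>\<Sum>\<beta>\<in>?I - {?z}. c \<beta> * pmon \<beta> x\<bar> \<le> real (card ?I) * e" by simp
  then show ?thesis using 1 by linarith
qed

text \<open>The factor \<open>V\<close> makes the claim homogeneous in the measure: for the image of
  a cube of radius r under rescaling it is r to the power d, so \<open>\<epsilon>\<close> does not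
  depend on the scale. In the induction step either the constant coefficient dominates, and the
  sublevel set is empty, or some first derivative has a coefficient of size at least
  \<open>\<tau>'\<close>. In the latter case the set where that derivative is small and the steep
  remainder each receive half of \<open>\<theta>\<close>.\<close>

theorem small_values:
  fixes d H :: real and m :: nat
  assumes d: "real CARD('n::finite) - 1 < d" and H: "0 \<le> H"
    and "0 < \<tau>" "0 < \<theta>"
  shows "\<exists>\<epsilon>>0. \<forall>(\<nu> :: (real ^ 'n) measure) V c.
    sets \<nu> = sets borel \<longrightarrow> 0 \<le> V \<longrightarrow>
    (\<forall>z r. 0 < r \<longrightarrow> r \<le> 1 \<longrightarrow> emeasure \<nu> (cube z r) \<le> ennreal (H * r powr d * V)) \<longrightarrow>
    (\<forall>\<beta>\<in>multi_indices (int m). \<bar>c \<beta>\<bar> \<le> L) \<longrightarrow> (\<exists>\<beta>\<in>multi_indices (int m). \<tau> \<le> \<bar>c \<beta>\<bar>) \<longrightarrow>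
    emeasure \<nu> {z \<in> cube 0 1. \<bar>pol (int m) c z\<bar> \<le> \<epsilon>} \<le> ennreal (\<theta> * V)"
  using assms(3,4)
proof (induction m arbitrary: \<tau> \<theta> L)
  case 0
  have "{z \<in> cube 0 1. \<bar>pol (int 0) c z\<bar> \<le> \<tau> / 2} = {}"
    if "\<exists>\<beta>\<in>multi_indices (int 0). \<tau> \<le> \<bar>c \<beta>\<bar>" for c :: "('n \<Rightarrow> nat) \<Rightarrow> real"
    using that 0 by (auto simp: pol_0 multi_indices_0)
  then have "emeasure \<nu> {z \<in> cube 0 1. \<bar>pol (int 0) c z\<bar> \<le> \<tau> / 2} \<le> ennreal (\<theta> * V)"
    if "\<exists>\<beta>\<in>multi_indices (int 0). \<tau> \<le> \<bar>c \<beta>\<bar>" for c V and \<nu> :: "(real ^ 'n) measure"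
    using that by (simp only: emeasure_empty zero_le)
  then show ?case using 0 by (intro exI[of _ "\<tau> / 2"] conjI allI impI) auto
next
  case (Suc m)
  let ?I = "multi_indices (int (Suc m)) :: ('n \<Rightarrow> nat) set"
  let ?J = "multi_indices (int m) :: ('n \<Rightarrow> nat) set"
  define K where "K = real (card ?I)"
  have JI: "?J \<subseteq> ?I" by (intro multi_indices_mono) auto
  have "?I \<noteq> {}" using zero_mem_multi_indices[of "int (Suc m)"] by auto
  then have K1: "1 \<le> K" by (simp add: K_def Suc_le_eq card_gt_0_iff)
  have KJ: "real (card ?J) \<le> K" unfolding K_def using card_mono[OF _ JI] by simp
  \<comment> \<open>With all nonconstant coefficients below \<open>\<tau>'\<close>, the nonconstant
    part is at most \<open>K * \<tau>' = \<tau> / 2\<close> on the unit cube.\<close>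
  define \<tau>' where "\<tau>' = \<tau> / (2 * K)"
  have \<tau>': "0 < \<tau>'" using Suc.prems K1 by (simp add: \<tau>'_def)
  \<comment> \<open>Differentiation multiplies a coefficient by an exponent, which is at most
    \<open>Suc m\<close>.\<close>
  define L' where "L' = real (Suc m) * \<bar>L\<bar>"
  obtain \<epsilon>' where \<epsilon>': "0 < \<epsilon>'" and IH: "\<And>(\<nu> :: (real ^ 'n) measure) V c.
    sets \<nu> = sets borel \<Longrightarrow> 0 \<le> V \<Longrightarrow>
    (\<And>z r. 0 < r \<Longrightarrow> r \<le> 1 \<Longrightarrow> emeasure \<nu> (cube z r) \<le> ennreal (H * r powr d * V)) \<Longrightarrow>
    (\<And>\<beta>. \<beta> \<in> ?J \<Longrightarrow> \<bar>c \<beta>\<bar> \<le> L') \<Longrightarrow> (\<exists>\<beta>\<in>?J. \<tau>' \<le> \<bar>c \<beta>\<bar>) \<Longrightarrow>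
    emeasure \<nu> {z \<in> cube 0 1. \<bar>pol (int m) c z\<bar> \<le> \<epsilon>'} \<le> ennreal (\<theta> / 2 * V)"
    using Suc.IH[of \<tau>' "\<theta> / 2" L'] Suc.prems \<tau>' by auto
  define \<Lambda> where "\<Lambda> = K * L' * real (Suc m) + 1"
  have L'0: "0 \<le> L'" by (simp add: L'_def)
  have \<Lambda>1: "1 \<le> \<Lambda>" using K1 L'0 by (simp add: \<Lambda>_def)
  define \<rho> where "\<rho> = min 1 (\<epsilon>' / (2 * \<Lambda>))"
  have \<rho>: "0 < \<rho>" "\<rho> \<le> 1" "\<Lambda> * \<rho> \<le> \<epsilon>' / 2"
  proof -
    show "0 < \<rho>" "\<rho> \<le> 1" using \<epsilon>' \<Lambda>1 by (auto simp: \<rho>_def)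
    have "\<rho> \<le> \<epsilon>' / (2 * \<Lambda>)" by (simp add: \<rho>_def)
    then show "\<Lambda> * \<rho> \<le> \<epsilon>' / 2" using \<Lambda>1 by (simp add: field_simps)
  qed
  define h where "h = max 1 (2 * (2 + \<Lambda>) / \<epsilon>')"
  have h: "0 < h" by (simp add: h_def)
  let ?A = "5 ^ CARD('n) / \<rho> * H * h powr d"
  \<comment> \<open>The third property gives the steep part at most half of the measure budget. The
    bound \<open>1 / h\<close> keeps the radius of the covering cubes below 1, where the regularity
    hypothesis applies.\<close>
  obtain \<eta> where \<eta>: "0 < \<eta>" "\<eta> \<le> min \<rho> (1 / h)" "?A * \<eta> powr (d - (real CARD('n) - 1)) \<le> \<theta> / 2"
    using exists_small_power[of "d - (real CARD('n) - 1)" "\<theta> / 2" "min \<rho> (1 / h)" ?A] d Suc.prems \<rho> h H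
    by auto
  have h\<eta>: "h * \<eta> \<le> 1" using \<eta>(2) h by (simp add: field_simps)
  \<comment> \<open>\<open>\<tau> / 4\<close> makes the sublevel set empty when the constant term
    dominates; \<open>\<eta>\<close> is the threshold of the steep part.\<close>
  define \<epsilon> where "\<epsilon> = min (\<tau> / 4) \<eta>"
  have main: "emeasure \<nu> {z \<in> cube 0 1. \<bar>pol (int (Suc m)) c z\<bar> \<le> \<epsilon>} \<le> ennreal (\<theta> * V)"
    if sets: "sets \<nu> = sets borel" and V: "0 \<le> V"
      and reg: "\<And>z r. 0 < r \<Longrightarrow> r \<le> 1 \<Longrightarrow> emeasure \<nu> (cube z r) \<le> ennreal (H * r powr d * V)"
      and cL: "\<And>\<beta>. \<beta> \<in> ?I \<Longrightarrow> \<bar>c \<beta>\<bar> \<le> L" and c\<tau>: "\<exists>\<beta>\<in>?I. \<tau> \<le> \<bar>c \<beta>\<bar>"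
    for \<nu> :: "(real ^ 'n) measure" and V c
  proof (cases "\<forall>\<beta>\<in>?I. \<beta> \<noteq> (\<lambda>i. 0) \<longrightarrow> \<bar>c \<beta>\<bar> < \<tau>'")
    case True
    have \<tau>'\<tau>: "\<tau>' \<le> \<tau>" "K * \<tau>' = \<tau> / 2" using Suc.prems K1 by (auto simp: \<tau>'_def field_simps)
    have c0: "\<tau> \<le> \<bar>c (\<lambda>i. 0)\<bar>" using c\<tau> True \<tau>'\<tau> by force
    have "\<tau> / 2 \<le> \<bar>pol (int (Suc m)) c z\<bar>" if "z \<in> cube 0 1" for z
      using pol_lower_bound[of "int (Suc m)" z \<tau>' c] that True c0 \<tau>'\<tau> \<tau>' by (force simp: K_def)
    then have "{z \<in> cube 0 1. \<bar>pol (int (Suc m)) c z\<bar> \<le> \<epsilon>} = {}"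
      using Suc.prems by (force simp: \<epsilon>_def)
    then show ?thesis by (simp only: emeasure_empty zero_le)
  next
    case False
    then obtain \<beta> where \<beta>: "\<beta> \<in> ?I" "\<beta> \<noteq> (\<lambda>i. 0)" "\<tau>' \<le> \<bar>c \<beta>\<bar>" by force
    then obtain i where i: "0 < \<beta> i" by auto
    define c' where "c' = dcoeff i c"
    have c'L: "\<bar>c' \<gamma>\<bar> \<le> L'" if g: "\<gamma> \<in> ?J" for \<gamma>
    proof -
      have gi: "\<gamma>(i := Suc (\<gamma> i)) \<in> ?I"
        using multi_indices_upd_Suc[of \<gamma> i "int m"] g by (simp add: add.commute)
      have "\<gamma> i \<le> m"
        using multi_indices_sum_le[OF g] member_le_sum[of i UNIV \<gamma>] by auto
      then have "\<bar>c (\<gamma>(i := Suc (\<gamma> i)))\<bar> * real (Suc (\<gamma> i)) \<le> \<bar>L\<bar> * real (Suc m)"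
        using cL[OF gi] by (intro mult_mono) auto
      then show ?thesis by (simp add: c'_def dcoeff_def L'_def abs_mult mult.commute)
    qed
    have c'\<tau>: "\<exists>\<gamma>\<in>?J. \<tau>' \<le> \<bar>c' \<gamma>\<bar>"
    proof
      let ?\<gamma> = "\<beta>(i := \<beta> i - 1)"
      have eq: "?\<gamma>(i := Suc (?\<gamma> i)) = \<beta>" using i by auto
      show "?\<gamma> \<in> ?J"
        using multi_indices_upd_Suc[of ?\<gamma> i "int m"] \<beta>(1) unfolding eq by (simp add: add.commute)
      have "\<bar>c \<beta>\<bar> * 1 \<le> \<bar>c \<beta>\<bar> * real (Suc (?\<gamma> i))" by (intro mult_left_mono) auto
      then show "\<tau>' \<le> \<bar>c' ?\<gamma>\<bar>" using \<beta>(3) unfolding c'_def dcoeff_def eq by (simp add: abs_mult)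
    qed
    define T where "T = {z \<in> cube 0 1. \<bar>pol (int (Suc m)) c z\<bar> \<le> \<eta> \<and> \<epsilon>' < \<bar>pol (int m) c' z\<bar>}"
    have sucm: "int (Suc m) = int m + 1" by simp
    have T: "emeasure \<nu> T \<le> ennreal (?A * \<eta> powr (d - (real CARD('n) - 1)) * V)"
    proof (rule emeasure_steep_part[OF sets reg H V \<eta>(1) _ \<rho>(2) h h\<eta>])
      fix x y assume xy: "x \<in> T" "y \<in> T" "\<And>j. j \<noteq> i \<Longrightarrow> \<bar>x $ j - y $ j\<bar> \<le> \<eta>" "\<bar>x $ i - y $ i\<bar> \<le> \<rho>"
      show "y \<in> cube x (h * \<eta>)"
        unfolding h_def
      proof (rule steep_part_in_cube[where i = i and m = "int m" and c = c and L = L and L' = L' and \<rho> = \<rho>])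
        show "real (card (multi_indices (int m + 1) :: ('n \<Rightarrow> nat) set)) * L * real (nat (int m + 1)) \<le> \<Lambda>"
        proof -
          have "K * L * real (Suc m) \<le> K * L' * real (Suc m)"
          proof (intro mult_right_mono mult_left_mono)
            have "\<bar>L\<bar> * 1 \<le> \<bar>L\<bar> * real (Suc m)" by (intro mult_left_mono) auto
            then show "L \<le> L'" by (simp add: L'_def mult.commute)
          qed (use K1 in auto)
          moreover have "nat (int m + 1) = Suc m" by simp
          ultimately show ?thesis unfolding sucm[symmetric] K_def[symmetric] \<Lambda>_def by simp
        qed
        have "real (card ?J) * L' * real m \<le> K * L' * real (Suc m)"
          using KJ K1 L'0 by (intro mult_mono) auto
        then show "real (card (multi_indices (int m) :: ('n \<Rightarrow> nat) set)) * L' * real (nat (int m)) \<le> \<Lambda>"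
          by (simp add: \<Lambda>_def)
      qed (use xy \<rho> \<epsilon>' \<eta> cL c'L in \<open>auto simp: T_def c'_def sucm simp del: of_nat_Suc\<close>)
    qed (use \<eta> T_def in auto)
    have E: "emeasure \<nu> {z \<in> cube 0 1. \<bar>pol (int m) c' z\<bar> \<le> \<epsilon>'} \<le> ennreal (\<theta> / 2 * V)"
      by (rule IH[OF sets V reg c'L c'\<tau>])
    have meas: "{z \<in> cube 0 1. \<bar>pol (int m) c' z\<bar> \<le> \<epsilon>'} \<in> sets \<nu>" "T \<in> sets \<nu>"
      unfolding sets T_def by measurable
    have "emeasure \<nu> {z \<in> cube 0 1. \<bar>pol (int (Suc m)) c z\<bar> \<le> \<epsilon>} \<le>
        emeasure \<nu> ({z \<in> cube 0 1. \<bar>pol (int m) c' z\<bar> \<le> \<epsilon>'} \<union> T)"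
      using meas by (intro emeasure_mono) (auto simp: T_def \<epsilon>_def)
    also have "\<dots> \<le> emeasure \<nu> {z \<in> cube 0 1. \<bar>pol (int m) c' z\<bar> \<le> \<epsilon>'} + emeasure \<nu> T"
      using meas by (intro emeasure_subadditive)
    also have "\<dots> \<le> ennreal (\<theta> / 2 * V) + ennreal (\<theta> / 2 * V)"
      using V \<eta>(3) by (intro add_mono E order_trans[OF T] ennreal_leI mult_right_mono)
    also have "\<dots> = ennreal (\<theta> * V)"
      using V Suc.prems by (subst ennreal_plus[symmetric]) auto
    finally show ?thesis .
  qed
  show ?case
    using \<eta>(1) Suc.prems(1) main by (intro exI[of _ \<epsilon>]) (auto simp: \<epsilon>_def)
qed

section \<open>The projection onto polynomials on a regular set\<close>

text \<open>The form is required to be bilinear only on the space \<open>V\<close>, as integrals of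
  products are additive only under integrability. Hypothesis \<open>pd\<close> expresses positivity
  and independence of the family at once. The new family keeps the index set \<open>I\<close>,
  because \<open>orthonormal_poly_basis\<close> is indexed by multi-indices.\<close>

lemma gram_schmidt:
  fixes e :: "'i \<Rightarrow> 'a \<Rightarrow> real" and ip :: "('a \<Rightarrow> real) \<Rightarrow> ('a \<Rightarrow> real) \<Rightarrow> real" and V :: "('a \<Rightarrow> real) set"
  assumes I: "finite I"
    and V0: "(\<lambda>x. 0) \<in> V" and V_add: "\<And>f g. f \<in> V \<Longrightarrow> g \<in> V \<Longrightarrow> (\<lambda>x. f x + g x) \<in> V"
    and V_scale: "\<And>f a. f \<in> V \<Longrightarrow> (\<lambda>x. a * f x) \<in> V"
    and ip_sym: "\<And>f g. f \<in> V \<Longrightarrow> g \<in> V \<Longrightarrow> ip f g = ip g f"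
    and ip_add: "\<And>f g h. f \<in> V \<Longrightarrow> g \<in> V \<Longrightarrow> h \<in> V \<Longrightarrow> ip (\<lambda>x. f x + g x) h = ip f h + ip g h"
    and ip_scale: "\<And>f g a. f \<in> V \<Longrightarrow> g \<in> V \<Longrightarrow> ip (\<lambda>x. a * f x) g = a * ip f g"
    and e: "\<And>i. i \<in> I \<Longrightarrow> e i \<in> V"
    and pd: "\<And>c i. i \<in> I \<Longrightarrow> c i \<noteq> 0 \<Longrightarrow>
      0 < ip (\<lambda>x. \<Sum>j\<in>I. c j * e j x) (\<lambda>x. \<Sum>j\<in>I. c j * e j x)"
  shows "\<exists>B. (\<forall>i\<in>I. \<exists>c. B i = (\<lambda>x. \<Sum>j\<in>I. c j * e j x)) \<and>
    (\<forall>i\<in>I. \<exists>c. e i = (\<lambda>x. \<Sum>j\<in>I. c j * B j x)) \<and>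
    (\<forall>i\<in>I. \<forall>j\<in>I. ip (B i) (B j) = (if i = j then 1 else 0))"
proof -
  have V_sum: "(\<lambda>x. \<Sum>j\<in>J. c j * g j x) \<in> V" if "\<And>j. j \<in> J \<Longrightarrow> g j \<in> V"
    for J c and g :: "'i \<Rightarrow> 'a \<Rightarrow> real"
    using that
  proof (induction J rule: infinite_finite_induct)
    case (insert j J)
    then show ?case using V_add[OF V_scale[of "g j" "c j"] insert.IH] by simp
  qed (auto intro: V0)
  have ip0: "ip (\<lambda>x. 0) h = 0" if "h \<in> V" for h using ip_scale[OF V0 that, of 0] by simp
  have ip_sum: "ip (\<lambda>x. \<Sum>j\<in>J. c j * g j x) h = (\<Sum>j\<in>J. c j * ip (g j) h)"
    if "\<And>j. j \<in> J \<Longrightarrow> g j \<in> V" "h \<in> V" for J c h and g :: "'i \<Rightarrow> 'a \<Rightarrow> real"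
    using that
    by (induction J rule: infinite_finite_induct) (auto simp: ip0 ip_add V_scale V_sum ip_scale)
  show ?thesis
    using I e pd
  proof (induction I rule: finite_induct)
    case empty
    then show ?case by simp
  next
    case (insert a I)
    have pd': "0 < ip (\<lambda>x. \<Sum>j\<in>I. c j * e j x) (\<lambda>x. \<Sum>j\<in>I. c j * e j x)"
      if "i \<in> I" "c i \<noteq> 0" for c i
    proof -
      have "(\<lambda>x. \<Sum>j\<in>insert a I. (c(a := 0)) j * e j x) = (\<lambda>x. \<Sum>j\<in>I. c j * e j x)"
        using insert.hyps by (auto intro!: sum.cong)
      moreover have "i \<noteq> a" using insert.hyps that by auto
      ultimately show ?thesis using insert.prems(2)[of i "c(a := 0)"] that by auto
    qed
    have "\<exists>B. (\<forall>i\<in>I. \<exists>c. B i = (\<lambda>x. \<Sum>j\<in>I. c j * e j x)) \<and>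
        (\<forall>i\<in>I. \<exists>c. e i = (\<lambda>x. \<Sum>j\<in>I. c j * B j x)) \<and>
        (\<forall>i\<in>I. \<forall>j\<in>I. ip (B i) (B j) = (if i = j then 1 else 0))"
      by (rule insert.IH) (auto intro: insert.prems(1) simp: pd')
    then obtain B
      where B1: "\<forall>i\<in>I. \<exists>c. B i = (\<lambda>x. \<Sum>j\<in>I. c j * e j x)"
        and B2: "\<forall>i\<in>I. \<exists>c. e i = (\<lambda>x. \<Sum>j\<in>I. c j * B j x)"
        and B3: "\<forall>i\<in>I. \<forall>j\<in>I. ip (B i) (B j) = (if i = j then 1 else 0)" by auto
    from B1 obtain cc where cc: "\<And>i. i \<in> I \<Longrightarrow> B i = (\<lambda>x. \<Sum>j\<in>I. cc i j * e j x)" by metis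
    have BV: "B i \<in> V" if "i \<in> I" for i
      unfolding cc[OF that] by (intro V_sum insert.prems) auto
    have eaV: "e a \<in> V" using insert.prems by auto
    \<comment> \<open>The component of \<open>e a\<close> orthogonal to the span of the
      \<open>B j\<close>.\<close>
    define v where "v = (\<lambda>x. e a x + (\<Sum>j\<in>I. (- ip (e a) (B j)) * B j x))"
    have vV: "v \<in> V" unfolding v_def using eaV BV by (intro V_add V_sum) auto
    \<comment> \<open>The coefficients of \<open>v\<close> in the original family. The one at
      \<open>a\<close> is 1, so \<open>pd\<close> applies and \<open>ip v v\<close> is
      positive.\<close>
    define b where "b = (\<lambda>l. if l = a then 1 else \<Sum>j\<in>I. - ip (e a) (B j) * cc j l)"
    have v_e: "v = (\<lambda>x. \<Sum>l\<in>insert a I. b l * e l x)"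
    proof
      fix x
      have "(\<Sum>j\<in>I. (- ip (e a) (B j)) * B j x) = (\<Sum>j\<in>I. \<Sum>l\<in>I. (- ip (e a) (B j) * cc j l) * e l x)"
      proof (intro sum.cong refl)
        fix j assume "j \<in> I"
        then have "B j x = (\<Sum>l\<in>I. cc j l * e l x)" using fun_cong[OF cc] by blast
        then show "(- ip (e a) (B j)) * B j x = (\<Sum>l\<in>I. (- ip (e a) (B j) * cc j l) * e l x)"
          by (simp add: sum_distrib_left mult_ac)
      qed
      also have "\<dots> = (\<Sum>l\<in>I. b l * e l x)"
        using insert.hyps
        by (subst sum.swap) (auto intro!: sum.cong simp: b_def sum_distrib_right)
      finally show "v x = (\<Sum>l\<in>insert a I. b l * e l x)"
        using insert.hyps by (simp add: v_def b_def)
    qed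
    have vpos: "0 < ip v v" unfolding v_e by (rule insert.prems(2)[of a]) (auto simp: b_def)
    define s where "s = sqrt (ip v v)"
    have s: "0 < s" "s * s = ip v v" using vpos by (auto simp: s_def)
    have vB: "ip v (B l) = 0" if l: "l \<in> I" for l
    proof -
      have "ip v (B l) = ip (e a) (B l) + (\<Sum>j\<in>I. (- ip (e a) (B j)) * ip (B j) (B l))"
        unfolding v_def
        by (subst ip_add[OF eaV V_sum BV[OF l]], fact BV) (subst ip_sum[OF _ BV[OF l]], auto intro: BV)
      also have "(\<Sum>j\<in>I. (- ip (e a) (B j)) * ip (B j) (B l)) =
          (\<Sum>j\<in>I. if j = l then - ip (e a) (B l) else 0)"
        using B3 l by (intro sum.cong) auto
      finally show ?thesis using l insert.hyps by simp
    qed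
    define B' where "B' = B(a := (\<lambda>x. (1 / s) * v x))"
    have B'I: "B' i = B i" if "i \<in> I" for i using that insert.hyps by (auto simp: B'_def)
    have B'a: "B' a = (\<lambda>x. (1 / s) * v x)" by (simp add: B'_def)
    have B'aV: "(\<lambda>x. (1 / s) * v x) \<in> V" using vV by (rule V_scale)
    show ?case
    proof (intro exI[of _ B'] conjI ballI)
      fix i assume i: "i \<in> insert a I"
      show "\<exists>c. B' i = (\<lambda>x. \<Sum>j\<in>insert a I. c j * e j x)"
      proof (cases "i = a")
        case True
        have "B' i = (\<lambda>x. \<Sum>j\<in>insert a I. (b j / s) * e j x)"
          unfolding True B'a v_e by (simp only: sum_distrib_left) (simp add: mult_ac)
        then show ?thesis by (intro exI)
      next
        case False
        then have iI: "i \<in> I" using i by auto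
        have "B' i = (\<lambda>x. \<Sum>j\<in>insert a I. ((cc i)(a := 0)) j * e j x)"
          unfolding B'I[OF iI] cc[OF iI] using insert.hyps by (auto intro!: sum.cong)
        then show ?thesis by (intro exI)
      qed
      show "\<exists>c. e i = (\<lambda>x. \<Sum>j\<in>insert a I. c j * B' j x)"
      proof (cases "i = a")
        case True
        have "e i = (\<lambda>x. \<Sum>j\<in>insert a I. (if j = a then s else ip (e a) (B j)) * B' j x)"
        proof
          fix x
          have "(\<Sum>j\<in>I. (if j = a then s else ip (e a) (B j)) * B' j x) = (\<Sum>j\<in>I. ip (e a) (B j) * B j x)"
            using insert.hyps B'I by (intro sum.cong) auto
          then show "e i x = (\<Sum>j\<in>insert a I. (if j = a then s else ip (e a) (B j)) * B' j x)"
            using insert.hyps s(1) by (simp add: B'a v_def True sum_negf)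
        qed
        then show ?thesis by (intro exI)
      next
        case False
        then have iI: "i \<in> I" using i by auto
        then obtain c where c: "e i = (\<lambda>x. \<Sum>j\<in>I. c j * B j x)" using B2 by blast
        have "e i = (\<lambda>x. \<Sum>j\<in>insert a I. (c(a := 0)) j * B' j x)"
          unfolding c using insert.hyps B'I by (auto intro!: sum.cong)
        then show ?thesis by (intro exI)
      qed
      fix j assume j: "j \<in> insert a I"
      have vv: "ip (\<lambda>x. (1 / s) * v x) (\<lambda>x. (1 / s) * v x) = 1"
      proof -
        have "ip (\<lambda>x. (1 / s) * v x) (\<lambda>x. (1 / s) * v x) = (1 / s) * ((1 / s) * ip v v)"
          by (simp only: ip_scale[OF vV B'aV] ip_sym[OF vV B'aV] ip_scale[OF vV vV])
        also have "\<dots> = 1" using s by (simp add: s(2)[symmetric])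
        finally show ?thesis .
      qed
      have vBl: "ip (\<lambda>x. (1 / s) * v x) (B l) = 0" "ip (B l) (\<lambda>x. (1 / s) * v x) = 0" if "l \<in> I" for l
        using ip_scale[OF vV BV[OF that], of "1 / s"] vB[OF that] ip_sym[OF BV[OF that] B'aV] by auto
      show "ip (B' i) (B' j) = (if i = j then 1 else 0)"
        using i j B3 B'I vv vBl insert.hyps by (cases "i = a"; cases "j = a") (auto simp: B'a)
    qed
  qed
qed

lemma polys_bounded_on_cube:
  assumes "P \<in> polys m" shows "\<exists>B\<ge>0. \<forall>y\<in>cube w r. \<bar>P y\<bar> \<le> B"
proof -
  have "continuous_on (cube w r) P" using assms by (auto simp: polys_iff intro: continuous_on_pol)
  then have "compact (P ` cube w r)" by (intro compact_continuous_image) (auto simp: cube_eq_cbox)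
  then obtain B where "\<forall>y\<in>cube w r. norm (P y) \<le> B" using compact_imp_bounded bounded_iff by (metis imageI)
  then have "\<forall>y\<in>cube w r. \<bar>P y\<bar> \<le> max 0 B" by (auto simp: le_max_iff_disj)
  then show ?thesis by (intro exI[of _ "max 0 B"]) auto
qed

text \<open>\<open>N\<close> stands for the Hausdorff measure restricted to S, and
  \<open>id_measurable\<close> says that Borel sets have measurable traces on S. The upper bound is
  wanted for centres anywhere, as cubes around points off S occur. Radii up to \<open>R\<close> are
  far above 1 because untruncated Whitney cubes and the cutoff distance are large.\<close>

locale regular_set =
  fixes N :: "(real ^ 'n::finite) measure" and S :: "(real ^ 'n) set" and d R c1 c2 :: real
  assumes closed_S: "closed S" and S_nonempty: "S \<noteq> {}"
    and space_N: "space N = S" and id_measurable: "(\<lambda>x. x) \<in> measurable N borel"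
    and d_gt: "real CARD('n) - 1 < d" and d_less: "d < real CARD('n)"
    and c1: "0 < c1" and c2: "0 < c2" and R: "10 ^ 7 \<le> R"
    and lower: "\<And>w r. w \<in> S \<Longrightarrow> 0 < r \<Longrightarrow> r \<le> R \<Longrightarrow>
      ennreal (c1 * r powr d) \<le> emeasure N (cube w r \<inter> S)"
    and upper: "\<And>w r. 0 < r \<Longrightarrow> r \<le> R \<Longrightarrow> emeasure N (cube w r \<inter> S) \<le> ennreal (c2 * r powr d)"
begin

lemma measurable_N: "f \<in> measurable borel M \<Longrightarrow> f \<in> measurable N M"
  by (rule measurable_compose[OF id_measurable])

lemma indicator_cube_measurable [measurable]:
  "(indicator (cube w r) :: _ \<Rightarrow> real) \<in> borel_measurable N"
  "(indicator (cube w r) :: _ \<Rightarrow> ennreal) \<in> borel_measurable N"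
  by (auto intro!: measurable_N)

lemma sets_N: "A \<in> sets borel \<Longrightarrow> A \<inter> S \<in> sets N"
  using measurable_sets[OF id_measurable, of A] by (simp add: space_N)

lemma d_nonneg: "0 \<le> d"
proof -
  have "1 \<le> CARD('n)" by (simp add: Suc_le_eq)
  then have "1 \<le> real CARD('n)" by linarith
  then show ?thesis using d_gt by linarith
qed

lemma nn_integral_indicator_cube: "(\<integral>\<^sup>+y. indicator (cube w r) y \<partial>N) = emeasure N (cube w r \<inter> S)"
proof -
  have "(\<integral>\<^sup>+y. indicator (cube w r) y \<partial>N) = (\<integral>\<^sup>+y. indicator (cube w r \<inter> S) y \<partial>N)"
    by (intro nn_integral_cong) (auto simp: space_N indicator_def)
  then show ?thesis by (simp add: nn_integral_indicator sets_N)
qed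

text \<open>Brings the regularity bound to unit scale; the factor r to the power d plays the role of
  \<open>V\<close> in \<open>small_values\<close>.\<close>

lemma emeasure_scaled:
  assumes r: "0 < r" "r \<le> R" and \<rho>: "0 < \<rho>" "\<rho> \<le> 1"
  shows "emeasure (distr N borel (\<lambda>y. (1 / r) *\<^sub>R (y - w))) (cube z \<rho>) \<le> ennreal (c2 * \<rho> powr d * r powr d)"
proof -
  have [measurable]: "(\<lambda>y. (1 / r) *\<^sub>R (y - w)) \<in> measurable borel borel"
    by (intro borel_measurable_continuous_onI continuous_intros)
  have eq: "(1 / r) *\<^sub>R (y - w) \<in> cube z \<rho> \<longleftrightarrow> y \<in> cube (w + r *\<^sub>R z) (r * \<rho>)" for y
  proof -
    have "\<bar>((1 / r) *\<^sub>R (y - w)) $ i - z $ i\<bar> \<le> \<rho> \<longleftrightarrow> \<bar>y $ i - (w + r *\<^sub>R z) $ i\<bar> \<le> r * \<rho>" for i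
    proof -
      have "y $ i - (w + r *\<^sub>R z) $ i = r * (((1 / r) *\<^sub>R (y - w)) $ i - z $ i)"
        using r by (simp add: field_simps)
      then show ?thesis using r by (simp add: abs_mult)
    qed
    then show ?thesis unfolding mem_cube_iff by blast
  qed
  have "emeasure (distr N borel (\<lambda>y. (1 / r) *\<^sub>R (y - w))) (cube z \<rho>) =
      emeasure N (cube (w + r *\<^sub>R z) (r * \<rho>) \<inter> S)"
    by (subst emeasure_distr) (auto simp: space_N eq intro!: measurable_N arg_cong[where f = "emeasure N"])
  also have "\<dots> \<le> ennreal (c2 * (r * \<rho>) powr d)"
    using r \<rho> mult_mono[of r R \<rho> 1] by (intro upper) auto
  finally show ?thesis using r \<rho> by (simp add: powr_mult mult_ac)
qed

text \<open>After division by the largest coefficient M, the set where the polynomial is at most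
  \<open>\<epsilon> * M\<close> carries at most half of the lower regularity bound. On the rest of
  the cube, of measure at least \<open>c1 / 2 * r powr d\<close>, the polynomial exceeds
  \<open>\<epsilon> * M\<close>. Integration over that part bounds M.\<close>

theorem remez:
  fixes m :: nat
  shows "\<exists>C>0. \<forall>w r c. \<forall>\<beta>\<in>multi_indices (int m). w \<in> S \<longrightarrow> 0 < r \<longrightarrow> r \<le> R \<longrightarrow>
    ennreal (\<bar>c \<beta>\<bar> * r powr d) \<le>
      ennreal C * (\<integral>\<^sup>+y\<in>cube w r. ennreal \<bar>pol (int m) c ((1 / r) *\<^sub>R (y - w))\<bar> \<partial>N)"
proof -
  let ?I = "multi_indices (int m) :: ('n \<Rightarrow> nat) set"
  from small_values[where 'n = 'n, OF d_gt less_imp_le[OF c2], of 1 "c1 / 2" m 1] c1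
  obtain \<epsilon> where \<epsilon>: "0 < \<epsilon>" and small: "\<And>(\<nu> :: (real ^ 'n) measure) V c.
    sets \<nu> = sets borel \<Longrightarrow> 0 \<le> V \<Longrightarrow>
    (\<And>z r. 0 < r \<Longrightarrow> r \<le> 1 \<Longrightarrow> emeasure \<nu> (cube z r) \<le> ennreal (c2 * r powr d * V)) \<Longrightarrow>
    (\<And>\<beta>. \<beta> \<in> ?I \<Longrightarrow> \<bar>c \<beta>\<bar> \<le> 1) \<Longrightarrow> (\<exists>\<beta>\<in>?I. 1 \<le> \<bar>c \<beta>\<bar>) \<Longrightarrow>
    emeasure \<nu> {z \<in> cube 0 1. \<bar>pol (int m) c z\<bar> \<le> \<epsilon>} \<le> ennreal (c1 / 2 * V)"
    by auto
  have main: "ennreal (\<bar>c \<beta>\<bar> * r powr d) \<le> ennreal (2 / (\<epsilon> * c1)) *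
      (\<integral>\<^sup>+y\<in>cube w r. ennreal \<bar>pol (int m) c ((1 / r) *\<^sub>R (y - w))\<bar> \<partial>N)"
    if w: "w \<in> S" and r: "0 < r" "r \<le> R" and \<beta>: "\<beta> \<in> ?I" for w r c \<beta>
  proof -
    define M where "M = Max ((\<lambda>\<beta>. \<bar>c \<beta>\<bar>) ` ?I)"
    have M: "\<bar>c \<gamma>\<bar> \<le> M" if "\<gamma> \<in> ?I" for \<gamma> using that by (auto simp: M_def)
    have "M \<in> (\<lambda>\<beta>. \<bar>c \<beta>\<bar>) ` ?I" unfolding M_def using \<beta> by (intro Max_in) auto
    then obtain \<beta>0 where \<beta>0: "\<beta>0 \<in> ?I" "\<bar>c \<beta>0\<bar> = M" by auto
    show ?thesis
    proof (cases "M = 0")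
      case True
      then have "c \<beta> = 0" using M[OF \<beta>] by auto
      then show ?thesis by simp
    next
      case False
      then have Mpos: "0 < M" using \<beta>0 by auto
      define sc where "sc = (\<lambda>y :: real ^ 'n. (1 / r) *\<^sub>R (y - w))"
      have sc [measurable]: "sc \<in> measurable borel borel"
        unfolding sc_def by (intro borel_measurable_continuous_onI continuous_intros)
      define P where "P = (\<lambda>y. pol (int m) c (sc y))"
      have P: "P \<in> borel_measurable borel" unfolding P_def by measurable
      have polM: "pol (int m) (\<lambda>\<beta>. c \<beta> / M) z = pol (int m) c z / M" for z
        by (simp add: pol_def sum_divide_distrib)
      have inc: "sc y \<in> cube 0 1 \<longleftrightarrow> y \<in> cube w r" for y
        using r by (simp add: mem_cube_iff sc_def abs_mult pos_divide_le_eq)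
      define Bad where "Bad = {y. \<bar>P y\<bar> \<le> \<epsilon> * M} \<inter> cube w r"
      have Bad [measurable]: "Bad \<in> sets borel" unfolding Bad_def using P by measurable
      define G where "G = cube w r - Bad"
      have G [measurable]: "G \<in> sets borel" unfolding G_def by measurable
      have "emeasure (distr N borel sc) {z \<in> cube 0 1. \<bar>pol (int m) (\<lambda>\<beta>. c \<beta> / M) z\<bar> \<le> \<epsilon>} \<le>
          ennreal (c1 / 2 * r powr d)"
      proof (rule small)
        show "emeasure (distr N borel sc) (cube z \<rho>) \<le> ennreal (c2 * \<rho> powr d * r powr d)"
          if "0 < \<rho>" "\<rho> \<le> 1" for z \<rho> unfolding sc_def by (rule emeasure_scaled[OF r that])
      qed (use Mpos M \<beta>0 in \<open>auto simp: abs_divide intro!: bexI[of _ \<beta>0]\<close>)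
      also have "emeasure (distr N borel sc) {z \<in> cube 0 1. \<bar>pol (int m) (\<lambda>\<beta>. c \<beta> / M) z\<bar> \<le> \<epsilon>} =
          emeasure N (Bad \<inter> S)"
      proof (subst emeasure_distr)
        show "emeasure N (sc -` {z \<in> cube 0 1. \<bar>pol (int m) (\<lambda>\<beta>. c \<beta> / M) z\<bar> \<le> \<epsilon>} \<inter> space N) =
            emeasure N (Bad \<inter> S)"
          using Mpos
          by (intro arg_cong[where f = "emeasure N"])
            (auto simp: space_N Bad_def polM P_def inc abs_divide pos_divide_le_eq)
      qed (auto intro: measurable_N)
      finally have bad: "emeasure N (Bad \<inter> S) \<le> ennreal (c1 / 2 * r powr d)" .
      have "ennreal (c1 / 2 * r powr d) + ennreal (c1 / 2 * r powr d) = ennreal (c1 * r powr d)"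
        using c1 by (subst ennreal_plus[symmetric]) (auto simp: field_simps)
      also have "\<dots> \<le> emeasure N (cube w r \<inter> S)" by (rule lower[OF w r])
      also have "\<dots> \<le> emeasure N ((Bad \<inter> S) \<union> (G \<inter> S))"
        by (intro emeasure_mono sets.Un sets_N) (auto simp: G_def)
      also have "\<dots> \<le> emeasure N (Bad \<inter> S) + emeasure N (G \<inter> S)"
        by (intro emeasure_subadditive sets_N) auto
      also have "\<dots> \<le> ennreal (c1 / 2 * r powr d) + emeasure N (G \<inter> S)" by (intro add_right_mono bad)
      finally have good: "ennreal (c1 / 2 * r powr d) \<le> emeasure N (G \<inter> S)"
        by (simp add: ennreal_add_left_cancel_le)
      have "ennreal (\<epsilon> * M) * ennreal (c1 / 2 * r powr d) \<le> ennreal (\<epsilon> * M) * emeasure N (G \<inter> S)"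
        by (intro mult_left_mono good) auto
      also have "\<dots> = (\<integral>\<^sup>+y. ennreal (\<epsilon> * M) * indicator (G \<inter> S) y \<partial>N)"
        by (simp add: nn_integral_cmult_indicator sets_N)
      also have "\<dots> \<le> (\<integral>\<^sup>+y\<in>cube w r. ennreal \<bar>P y\<bar> \<partial>N)"
        by (intro nn_integral_mono) (auto simp: G_def Bad_def indicator_def intro!: ennreal_leI)
      finally have *: "ennreal (\<epsilon> * M) * ennreal (c1 / 2 * r powr d) \<le>
          (\<integral>\<^sup>+y\<in>cube w r. ennreal \<bar>P y\<bar> \<partial>N)" .
      have "ennreal (\<bar>c \<beta>\<bar> * r powr d) \<le> ennreal (M * r powr d)"
        using M[OF \<beta>] by (intro ennreal_leI mult_right_mono) auto
      also have "M * r powr d = 2 / (\<epsilon> * c1) * (\<epsilon> * M * (c1 / 2 * r powr d))"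
        using \<epsilon> c1 by (simp add: field_simps)
      also have "ennreal \<dots> = ennreal (2 / (\<epsilon> * c1)) * (ennreal (\<epsilon> * M) * ennreal (c1 / 2 * r powr d))"
        using \<epsilon> c1 Mpos by (subst ennreal_mult[symmetric], simp, simp)+ (rule refl)
      also have "\<dots> \<le> ennreal (2 / (\<epsilon> * c1)) * (\<integral>\<^sup>+y\<in>cube w r. ennreal \<bar>P y\<bar> \<partial>N)"
        by (intro mult_left_mono *) auto
      finally show ?thesis by (simp add: P_def sc_def)
    qed
  qed
  show ?thesis using \<epsilon> c1 by (intro exI[of _ "2 / (\<epsilon> * c1)"] conjI allI ballI impI main) auto
qed

lemma emeasure_cube_finite: "r \<le> R \<Longrightarrow> emeasure N (cube w r \<inter> S) < \<infinity>"
proof (cases "0 < r")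
  case True
  assume "r \<le> R"
  from upper[OF True this, of w] show ?thesis by (rule order_le_less_trans) simp
next
  case False
  have "emeasure N (cube w r \<inter> S) \<le> emeasure N (cube w 1 \<inter> S)"
    using False cube_mono[of w w r 1] by (intro emeasure_mono sets_N) (auto simp: infnorm_0)
  also have "\<dots> \<le> ennreal (c2 * 1 powr d)" using R by (intro upper) auto
  finally show ?thesis by (rule order_le_less_trans) simp
qed

lemma set_integrable_mult_poly:
  assumes f: "f \<in> borel_measurable N" and fin: "(\<integral>\<^sup>+y\<in>cube w r. ennreal \<bar>f y\<bar> \<partial>N) < \<infinity>"
    and P: "P \<in> polys m"
  shows "set_integrable N (cube w r) (\<lambda>y. f y * P y)"
  unfolding set_integrable_def
proof (rule integrableI_bounded)
  show "(\<lambda>y. indicator (cube w r) y *\<^sub>R (f y * P y)) \<in> borel_measurable N"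
    using f measurable_N[OF polys_borel[OF P]] by measurable
  obtain B where B: "0 \<le> B" "\<And>y. y \<in> cube w r \<Longrightarrow> \<bar>P y\<bar> \<le> B"
    using polys_bounded_on_cube[OF P] by blast
  have "(\<integral>\<^sup>+y. ennreal (norm (indicator (cube w r) y *\<^sub>R (f y * P y))) \<partial>N) \<le>
      (\<integral>\<^sup>+y. ennreal B * (ennreal \<bar>f y\<bar> * indicator (cube w r) y) \<partial>N)"
    using B by (intro nn_integral_mono)
      (auto simp: indicator_def abs_mult ennreal_mult[symmetric] mult.commute[of B] intro!: ennreal_leI mult_left_mono)
  also have "\<dots> = ennreal B * (\<integral>\<^sup>+y\<in>cube w r. ennreal \<bar>f y\<bar> \<partial>N)"
    using f by (intro nn_integral_cmult borel_measurable_times_ennreal indicator_cube_measurable) measurable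
  also have "\<dots> < \<infinity>" using fin by (simp add: ennreal_mult_less_top)
  finally show "(\<integral>\<^sup>+y. ennreal (norm (indicator (cube w r) y *\<^sub>R (f y * P y))) \<partial>N) < \<infinity>" .
qed

lemma set_integrable_poly:
  assumes "P \<in> polys m" "r \<le> R" shows "set_integrable N (cube w r) P"
  using set_integrable_mult_poly[of "\<lambda>y. 1" w r P m] assms emeasure_cube_finite[of r w]
  by (simp add: nn_integral_indicator_cube)

lemma set_integrable_abs_nn:
  assumes "set_integrable N A f"
  shows "ennreal (LINT y:A|N. \<bar>f y\<bar>) = (\<integral>\<^sup>+y\<in>A. ennreal \<bar>f y\<bar> \<partial>N)"
proof -
  have i: "integrable N (\<lambda>y. indicator A y *\<^sub>R \<bar>f y\<bar>)"
    using set_integrable_abs[OF assms] by (simp add: set_integrable_def)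
  have "(\<integral>\<^sup>+y\<in>A. ennreal \<bar>f y\<bar> \<partial>N) = (\<integral>\<^sup>+y. ennreal (indicator A y *\<^sub>R \<bar>f y\<bar>) \<partial>N)"
    by (intro nn_integral_cong) (auto simp: indicator_def)
  also have "\<dots> = ennreal (LINT y:A|N. \<bar>f y\<bar>)"
    unfolding set_lebesgue_integral_def by (intro nn_integral_eq_integral i) (auto simp: indicator_def)
  finally show ?thesis ..
qed

text \<open>Gram-Schmidt is applied to the monomials in \<open>(x - w) / r\<close>. Definiteness
  comes from \<open>remez\<close>: a polynomial whose square has integral zero vanishes almost
  everywhere on the cube, hence has mean zero in absolute value and only zero coefficients.\<close>

lemma exists_orthonormal_poly_basis:
  fixes m :: nat
  assumes w: "w \<in> S" and r: "0 < r" "r \<le> R"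
  shows "\<exists>B. orthonormal_poly_basis N (cube w r) (int m) B"
proof -
  let ?I = "multi_indices (int m) :: ('n \<Rightarrow> nat) set" and ?V = "polys (int m) :: (real ^ 'n \<Rightarrow> real) set"
  define ip where "ip f g = (LINT x:cube w r|N. f x * g x)" for f g :: "real ^ 'n \<Rightarrow> real"
  have int: "set_integrable N (cube w r) (\<lambda>x. f x * g x)" if "f \<in> ?V" "g \<in> ?V" for f g
    using set_integrable_poly[OF polys_mult[OF that] r(2)] .
  obtain C where C: "0 < C" and rem: "\<And>w r c \<beta>. w \<in> S \<Longrightarrow> 0 < r \<Longrightarrow> r \<le> R \<Longrightarrow> \<beta> \<in> ?I \<Longrightarrow>
    ennreal (\<bar>c \<beta>\<bar> * r powr d) \<le>
      ennreal C * (\<integral>\<^sup>+y\<in>cube w r. ennreal \<bar>pol (int m) c ((1 / r) *\<^sub>R (y - w))\<bar> \<partial>N)"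
    using remez[of m] by blast
  have e: "(\<lambda>x. pmon \<beta> ((1 / r) *\<^sub>R (x - w))) \<in> ?V" if "\<beta> \<in> ?I" for \<beta>
    using polys_affine[OF pmon_mem_polys[OF that], of "- (1 / r) *\<^sub>R w" "1 / r"]
    by (simp add: algebra_simps)
  have "\<exists>B. (\<forall>\<beta>\<in>?I. \<exists>c. B \<beta> = (\<lambda>x. \<Sum>\<gamma>\<in>?I. c \<gamma> * pmon \<gamma> ((1 / r) *\<^sub>R (x - w)))) \<and>
    (\<forall>\<beta>\<in>?I. \<exists>c. (\<lambda>x. pmon \<beta> ((1 / r) *\<^sub>R (x - w))) = (\<lambda>x. \<Sum>\<gamma>\<in>?I. c \<gamma> * B \<gamma> x)) \<and>
    (\<forall>\<beta>\<in>?I. \<forall>\<gamma>\<in>?I. ip (B \<beta>) (B \<gamma>) = (if \<beta> = \<gamma> then 1 else 0))"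
  proof (rule gram_schmidt[where V = ?V])
    fix c :: "('n \<Rightarrow> nat) \<Rightarrow> real" and \<beta> assume \<beta>: "\<beta> \<in> ?I" "c \<beta> \<noteq> 0"
    define P where "P = (\<lambda>x. \<Sum>\<gamma>\<in>?I. c \<gamma> * pmon \<gamma> ((1 / r) *\<^sub>R (x - w)))"
    have P: "P \<in> ?V" unfolding P_def by (intro polys_sum polys_scale e)
    have PP: "set_integrable N (cube w r) (\<lambda>x. P x * P x)" by (rule int[OF P P])
    have "0 \<le> ip P P" unfolding ip_def set_lebesgue_integral_def
      by (intro integral_nonneg_AE) (auto simp: indicator_def)
    moreover have "ip P P \<noteq> 0"
    proof
      assume 0: "ip P P = 0"
      have "(\<integral>x. indicator (cube w r) x *\<^sub>R (P x * P x) \<partial>N) = 0"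
        using 0 by (simp add: ip_def set_lebesgue_integral_def)
      then have ae: "AE x in N. indicator (cube w r) x *\<^sub>R (P x * P x) = 0"
        using PP unfolding set_integrable_def
        by (subst (asm) integral_nonneg_eq_0_iff_AE) (auto simp: indicator_def)
      have "(\<integral>\<^sup>+y\<in>cube w r. ennreal \<bar>P y\<bar> \<partial>N) = (\<integral>\<^sup>+y. 0 \<partial>N)"
        by (rule nn_integral_cong_AE) (use ae in eventually_elim, auto simp: indicator_def split: if_splits)
      then have "ennreal (\<bar>c \<beta>\<bar> * r powr d) \<le> 0"
        using rem[OF w r \<beta>(1), of c] by (simp add: P_def pol_def)
      moreover have "0 < \<bar>c \<beta>\<bar> * r powr d" using \<beta> r by auto
      ultimately show False by (metis ennreal_less_zero_iff leD)
    qed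
    ultimately show "0 < ip (\<lambda>x. \<Sum>\<gamma>\<in>?I. c \<gamma> * pmon \<gamma> ((1 / r) *\<^sub>R (x - w)))
        (\<lambda>x. \<Sum>\<gamma>\<in>?I. c \<gamma> * pmon \<gamma> ((1 / r) *\<^sub>R (x - w)))"
      unfolding P_def by linarith
  next
    fix f g h assume "f \<in> ?V" "g \<in> ?V" "h \<in> ?V"
    then show "ip (\<lambda>x. f x + g x) h = ip f h + ip g h"
      unfolding ip_def distrib_right by (intro set_integral_add(2) int)
  next
    fix f g and a :: real
    show "ip (\<lambda>x. a * f x) g = a * ip f g" unfolding ip_def mult.assoc by (rule set_integral_mult_right)
  qed (auto simp: ip_def mult.commute polys_zero intro: polys_add polys_scale e)
  then obtain B where B1: "\<And>\<beta>. \<beta> \<in> ?I \<Longrightarrow> \<exists>c. B \<beta> = (\<lambda>x. \<Sum>\<gamma>\<in>?I. c \<gamma> * pmon \<gamma> ((1 / r) *\<^sub>R (x - w)))"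
    and B2: "\<And>\<beta>. \<beta> \<in> ?I \<Longrightarrow> \<exists>c. (\<lambda>x. pmon \<beta> ((1 / r) *\<^sub>R (x - w))) = (\<lambda>x. \<Sum>\<gamma>\<in>?I. c \<gamma> * B \<gamma> x)"
    and B3: "\<And>\<beta> \<gamma>. \<beta> \<in> ?I \<Longrightarrow> \<gamma> \<in> ?I \<Longrightarrow> ip (B \<beta>) (B \<gamma>) = (if \<beta> = \<gamma> then 1 else 0)" by blast
  have "orthonormal_poly_basis N (cube w r) (int m) B"
    unfolding orthonormal_poly_basis_def
  proof (intro conjI ballI)
    fix \<beta> assume "\<beta> \<in> ?I"
    then obtain c where c: "B \<beta> = (\<lambda>x. \<Sum>\<gamma>\<in>?I. c \<gamma> * pmon \<gamma> ((1 / r) *\<^sub>R (x - w)))" using B1 by blast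
    show "B \<beta> \<in> polys (int m)" unfolding c by (intro polys_sum polys_scale e)
  next
    fix P assume "P \<in> ?V"
    then obtain c where c: "\<And>y. P y = pol (int m) c ((1 / r) *\<^sub>R (y - w))"
      using polys_scaled_coeffs[of P "int m" r w] r by auto
    obtain b where b: "\<And>\<beta>. \<beta> \<in> ?I \<Longrightarrow> (\<lambda>x. pmon \<beta> ((1 / r) *\<^sub>R (x - w))) = (\<lambda>x. \<Sum>\<gamma>\<in>?I. b \<beta> \<gamma> * B \<gamma> x)"
      using B2 by metis
    have "P x = (\<Sum>\<gamma>\<in>?I. (\<Sum>\<beta>\<in>?I. c \<beta> * b \<beta> \<gamma>) * B \<gamma> x)" for x
    proof -
      have "P x = (\<Sum>\<beta>\<in>?I. \<Sum>\<gamma>\<in>?I. c \<beta> * b \<beta> \<gamma> * B \<gamma> x)"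
        unfolding c pol_def
        by (intro sum.cong refl) (simp add: fun_cong[OF b] sum_distrib_left mult_ac)
      then show ?thesis by (subst (asm) sum.swap) (simp add: sum_distrib_right)
    qed
    then show "\<exists>c. P = (\<lambda>x. \<Sum>\<beta>\<in>multi_indices (int m). c \<beta> * B \<beta> x)"
      by (intro exI[of _ "\<lambda>\<gamma>. \<Sum>\<beta>\<in>?I. c \<beta> * b \<beta> \<gamma>"] ext)
  next
    fix \<beta> \<gamma> assume "\<beta> \<in> ?I" "\<gamma> \<in> ?I"
    then show "(LINT x:cube w r|N. B \<beta> x * B \<gamma> x) = (if \<beta> = \<gamma> then 1 else 0)"
      using B3[of \<beta> \<gamma>] by (simp add: ip_def)
  qed
  then show ?thesis by blast
qed

end

context regular_set begin

text \<open>Cauchy-Schwarz in pointwise form: \<bar>b\<bar> is at most l b^2 + 1/l. The weight l =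
  r^(d/2) balances the terms, since the measure of the cube is of order r^d.\<close>

lemma integral_abs_le_by_square:
  assumes b: "b \<in> polys m" and r: "0 < r" "r \<le> R"
    and one: "(LINT y:cube w r|N. b y * b y) = 1"
  shows "(\<integral>\<^sup>+y\<in>cube w r. ennreal \<bar>b y\<bar> \<partial>N) \<le> ennreal ((1 + c2) * r powr (d / 2))"
proof -
  let ?l = "r powr (d / 2)"
  have l: "0 < ?l" "?l * ?l = r powr d" using r by (auto simp: powr_add[symmetric])
  have b_int: "set_integrable N (cube w r) b" by (rule set_integrable_poly[OF b r(2)])
  have bb_int: "set_integrable N (cube w r) (\<lambda>y. b y * b y)"
    by (rule set_integrable_poly[OF polys_mult[OF b b] r(2)])
  have c_int: "set_integrable N (cube w r) (\<lambda>y. 1 / ?l)"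
    by (rule set_integrable_poly[OF polys_const[of 0] r(2)]) auto
  have "emeasure N (cube w r \<inter> S) \<le> ennreal (c2 * r powr d)" by (rule upper[OF r])
  then have meas: "measure N (cube w r \<inter> S) \<le> c2 * r powr d"
    unfolding measure_def using c2 by (intro enn2real_leI) auto
  have "(LINT y:cube w r|N. 1 / ?l) = (1 / ?l) * measure N (cube w r \<inter> S)"
  proof -
    have "(LINT y:cube w r|N. 1 / ?l) = (LINT y|N. (1 / ?l) * indicator (cube w r \<inter> S) y)"
      unfolding set_lebesgue_integral_def
      by (intro Bochner_Integration.integral_cong) (auto simp: space_N indicator_def)
    also have "\<dots> = (1 / ?l) * measure N (cube w r \<inter> S)"
      using sets_N[of "cube w r"] by (simp add: space_N Int_absorb1)
    finally show ?thesis .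
  qed
  also have "\<dots> \<le> (1 / ?l) * (c2 * r powr d)" using l by (intro mult_left_mono meas) auto
  also have "\<dots> = c2 * ?l" using l(1) unfolding l(2)[symmetric] by simp
  finally have cc: "(LINT y:cube w r|N. 1 / ?l) \<le> c2 * ?l" .
  have "(LINT y:cube w r|N. \<bar>b y\<bar>) \<le> (LINT y:cube w r|N. ?l * (b y * b y) + 1 / ?l)"
  proof (rule set_integral_mono)
    show "set_integrable N (cube w r) (\<lambda>y. \<bar>b y\<bar>)" using b_int by (rule set_integrable_abs)
    show "set_integrable N (cube w r) (\<lambda>y. ?l * (b y * b y) + 1 / ?l)"
      using bb_int c_int by (intro set_integral_add(1) set_integrable_mult_right) auto
    fix y
    have "0 \<le> (?l * \<bar>b y\<bar> - 1)\<^sup>2" by simp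
    also have "\<dots> = ?l * ?l * (b y * b y) + 1 - 2 * (?l * \<bar>b y\<bar>)"
      by (simp add: power2_eq_square algebra_simps abs_mult_self_eq)
    finally have "2 * (?l * \<bar>b y\<bar>) \<le> ?l * ?l * (b y * b y) + 1" by simp
    moreover have "0 \<le> ?l * \<bar>b y\<bar>" using l by simp
    ultimately have "?l * \<bar>b y\<bar> \<le> ?l * ?l * (b y * b y) + 1" by linarith
    also have "\<dots> = ?l * (?l * (b y * b y) + 1 / ?l)" using l by (simp add: field_simps)
    finally show "\<bar>b y\<bar> \<le> ?l * (b y * b y) + 1 / ?l" using l(1) mult_le_cancel_left_pos by blast
  qed
  also have "\<dots> = ?l * (LINT y:cube w r|N. b y * b y) + (LINT y:cube w r|N. 1 / ?l)"
    using bb_int c_int by (subst set_integral_add(2)) auto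
  also have "\<dots> \<le> (1 + c2) * ?l" using cc by (simp add: one algebra_simps)
  finally show ?thesis
    using set_integrable_abs_nn[OF b_int] by (metis ennreal_leI)
qed

text \<open>Since \<open>P\<close> is a combination of the basis, the difference is the combination
  of the \<open>B \<beta>\<close> with weights \<open>a \<beta>\<close>, the integrals of (f - P)
  times \<open>B \<beta>\<close>. Basis elements have supremum and coefficients of order r^(-d/2);
  one such factor enters through the weights and one through re-expansion. The bound is kept in
  coefficient form because one application needs suprema and another needs products with smooth
  functions.\<close>

theorem poly_proj_error:
  fixes m :: nat
  obtains C where "0 < C" and "\<And>w r f P. w \<in> S \<Longrightarrow> 0 < r \<Longrightarrow> r \<le> R \<Longrightarrow> f \<in> borel_measurable N \<Longrightarrow>
    (\<integral>\<^sup>+y\<in>cube w r. ennreal \<bar>f y\<bar> \<partial>N) < \<infinity> \<Longrightarrow> P \<in> polys (int m) \<Longrightarrow>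
    \<exists>c I. 0 \<le> I \<and> ennreal I = (\<integral>\<^sup>+y\<in>cube w r. ennreal \<bar>f y - P y\<bar> \<partial>N) \<and>
      (\<forall>y. poly_proj N (cube w r) (int m) f y - P y = pol (int m) c ((1 / r) *\<^sub>R (y - w))) \<and>
      (\<forall>\<beta>\<in>multi_indices (int m). \<bar>c \<beta>\<bar> \<le> C * r powr - d * I)"
proof -
  let ?I = "multi_indices (int m) :: ('n \<Rightarrow> nat) set"
  obtain C0 where C0: "0 < C0" and rem: "\<And>w r c \<beta>. w \<in> S \<Longrightarrow> 0 < r \<Longrightarrow> r \<le> R \<Longrightarrow> \<beta> \<in> ?I \<Longrightarrow>
    ennreal (\<bar>c \<beta>\<bar> * r powr d) \<le>
      ennreal C0 * (\<integral>\<^sup>+y\<in>cube w r. ennreal \<bar>pol (int m) c ((1 / r) *\<^sub>R (y - w))\<bar> \<partial>N)"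
    using remez[of m] by blast
  define C1 where "C1 = C0 * (1 + c2)"
  define K where "K = real (card ?I)"
  have C1: "0 < C1" using C0 c2 by (simp add: C1_def)
  have "?I \<noteq> {}" using zero_mem_multi_indices[of "int m"] by auto
  then have K: "0 < K" by (simp add: K_def card_gt_0_iff)
  show ?thesis
  proof (rule that)
    show "0 < K * K * C1 * C1" using K C1 by simp
    fix w r f and P :: "real ^ 'n \<Rightarrow> real"
    assume w: "w \<in> S" and r: "0 < r" "r \<le> R" and f: "f \<in> borel_measurable N"
      and fin: "(\<integral>\<^sup>+y\<in>cube w r. ennreal \<bar>f y\<bar> \<partial>N) < \<infinity>" and P: "P \<in> polys (int m)"
    define B where "B = (SOME B. orthonormal_poly_basis N (cube w r) (int m) B)"
    have "orthonormal_poly_basis N (cube w r) (int m) B"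
      unfolding B_def by (rule someI_ex[OF exists_orthonormal_poly_basis[OF w r]])
    then have B: "\<And>\<beta>. \<beta> \<in> ?I \<Longrightarrow> B \<beta> \<in> polys (int m)"
      "\<And>P. P \<in> polys (int m) \<Longrightarrow> \<exists>c. P = (\<lambda>x. \<Sum>\<beta>\<in>?I. c \<beta> * B \<beta> x)"
      "\<And>\<beta> \<gamma>. \<beta> \<in> ?I \<Longrightarrow> \<gamma> \<in> ?I \<Longrightarrow> (LINT x:cube w r|N. B \<beta> x * B \<gamma> x) = (if \<beta> = \<gamma> then 1 else 0)"
      by (auto simp: orthonormal_poly_basis_def)
    have "\<exists>c. \<forall>y. B \<beta> y = pol (int m) c ((1 / r) *\<^sub>R (y - w))" if "\<beta> \<in> ?I" for \<beta>
      using polys_scaled_coeffs[OF B(1)[OF that], of r w] r(1) by (metis less_irrefl)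
    then obtain cc where cc: "\<And>\<beta> y. \<beta> \<in> ?I \<Longrightarrow> B \<beta> y = pol (int m) (cc \<beta>) ((1 / r) *\<^sub>R (y - w))"
      by metis
    \<comment> \<open>\<open>remez\<close> bounds a coefficient by the integral of the absolute
      value of \<open>B \<beta>\<close>, which normalisation in the square mean bounds by a multiple
      of r^(d/2).\<close>
    have ccb: "\<bar>cc \<beta> \<gamma>\<bar> \<le> C1 * r powr (- (d / 2))" if b: "\<beta> \<in> ?I" "\<gamma> \<in> ?I" for \<beta> \<gamma>
    proof -
      have "ennreal (\<bar>cc \<beta> \<gamma>\<bar> * r powr d) \<le> ennreal C0 * (\<integral>\<^sup>+y\<in>cube w r. ennreal \<bar>B \<beta> y\<bar> \<partial>N)"
        using rem[OF w r b(2), of "cc \<beta>"] by (simp add: cc[OF b(1)])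
      also have "\<dots> \<le> ennreal C0 * ennreal ((1 + c2) * r powr (d / 2))"
        using B(3)[OF b(1) b(1)] by (intro mult_left_mono integral_abs_le_by_square[OF B(1)[OF b(1)] r]) auto
      also have "\<dots> = ennreal (C1 * r powr (d / 2))" using C0 c2 by (simp add: C1_def ennreal_mult[symmetric] mult_ac)
      finally have "\<bar>cc \<beta> \<gamma>\<bar> * r powr d \<le> C1 * r powr (d / 2)"
        using C1 by (subst (asm) ennreal_le_iff) auto
      then have "\<bar>cc \<beta> \<gamma>\<bar> * r powr d * r powr - d \<le> C1 * r powr (d / 2) * r powr - d"
        by (intro mult_right_mono) auto
      then show ?thesis using r by (simp add: mult.assoc powr_add[symmetric])
    qed
    define g where "g = (\<lambda>y. f y - P y)"
    have g_int: "set_integrable N (cube w r) g"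
    proof -
      have "set_integrable N (cube w r) (\<lambda>y. f y * 1)"
        using set_integrable_mult_poly[OF f fin polys_const[of 0 1]] by simp
      then show ?thesis unfolding g_def using set_integrable_poly[OF P r(2)]
        by (intro set_integral_diff(1)) auto
    qed
    define I where "I = (LINT y:cube w r|N. \<bar>g y\<bar>)"
    have I: "ennreal I = (\<integral>\<^sup>+y\<in>cube w r. ennreal \<bar>g y\<bar> \<partial>N)"
      unfolding I_def by (rule set_integrable_abs_nn[OF g_int])
    have I0: "0 \<le> I" unfolding I_def set_lebesgue_integral_def
      by (intro integral_nonneg_AE) (auto simp: indicator_def)
    have P_int: "set_integrable N (cube w r) (\<lambda>y. P y * B \<beta> y)" if "\<beta> \<in> ?I" for \<beta>
      using set_integrable_poly[OF polys_mult[OF P B(1)[OF that]] r(2)] .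
    have f_int: "set_integrable N (cube w r) (\<lambda>y. f y * B \<beta> y)" if "\<beta> \<in> ?I" for \<beta>
      by (rule set_integrable_mult_poly[OF f fin B(1)[OF that]])
    define a where "a \<beta> = (LINT y:cube w r|N. g y * B \<beta> y)" for \<beta>
    have gB_int: "set_integrable N (cube w r) (\<lambda>y. g y * B \<beta> y)" if "\<beta> \<in> ?I" for \<beta>
      unfolding g_def left_diff_distrib using f_int[OF that] P_int[OF that] by (rule set_integral_diff(1))
    have Bb: "\<bar>B \<beta> y\<bar> \<le> K * C1 * r powr (- (d / 2))" if b: "\<beta> \<in> ?I" and y: "y \<in> cube w r" for \<beta> y
    proof -
      have "\<bar>((1 / r) *\<^sub>R (y - w)) $ i\<bar> \<le> 1" for i
        using y r by (simp add: mem_cube_iff abs_mult pos_divide_le_eq)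
      from abs_pol_le[OF order_refl this ccb[OF b]] show ?thesis
        unfolding cc[OF b] K_def by (simp add: mult_ac)
    qed
    have ab: "\<bar>a \<beta>\<bar> \<le> K * C1 * r powr (- (d / 2)) * I" if b: "\<beta> \<in> ?I" for \<beta>
    proof -
      have "\<bar>a \<beta>\<bar> \<le> (LINT y:cube w r|N. \<bar>g y * B \<beta> y\<bar>)"
        unfolding a_def using set_integral_norm_bound[OF gB_int[OF b]] by simp
      also have "\<dots> \<le> (LINT y:cube w r|N. (K * C1 * r powr (- (d / 2))) * \<bar>g y\<bar>)"
        using gB_int[OF b] g_int Bb[OF b]
        by (intro set_integral_mono set_integrable_abs set_integrable_mult_right)
          (auto simp: abs_mult mult.commute[of _ "\<bar>g _\<bar>"] intro!: mult_left_mono)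
      also have "\<dots> = K * C1 * r powr (- (d / 2)) * I" by (simp add: I_def)
      finally show ?thesis .
    qed
    define c where "c \<gamma> = (\<Sum>\<beta>\<in>?I. a \<beta> * cc \<beta> \<gamma>)" for \<gamma>
    have eq: "poly_proj N (cube w r) (int m) f y - P y = pol (int m) c ((1 / r) *\<^sub>R (y - w))" for y
    proof -
      obtain p where p: "P = (\<lambda>x. \<Sum>\<beta>\<in>?I. p \<beta> * B \<beta> x)" using B(2)[OF P] by blast
      have pB: "(LINT y:cube w r|N. P y * B \<beta> y) = p \<beta>" if b: "\<beta> \<in> ?I" for \<beta>
      proof -
        have "(LINT y:cube w r|N. P y * B \<beta> y) = (LINT y:cube w r|N. (\<Sum>\<gamma>\<in>?I. p \<gamma> * (B \<gamma> y * B \<beta> y)))"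
          by (subst p) (simp add: sum_distrib_right mult.assoc)
        also have "\<dots> = (\<Sum>\<gamma>\<in>?I. (LINT y:cube w r|N. p \<gamma> * (B \<gamma> y * B \<beta> y)))"
          unfolding set_lebesgue_integral_def scaleR_sum_right
        proof (rule Bochner_Integration.integral_sum)
          fix \<gamma> assume g: "\<gamma> \<in> ?I"
          have "set_integrable N (cube w r) (\<lambda>y. p \<gamma> * (B \<gamma> y * B \<beta> y))"
            using set_integrable_poly[OF polys_mult[OF B(1)[OF g] B(1)[OF b]] r(2)]
            by (intro set_integrable_mult_right) auto
          then show "integrable N (\<lambda>y. indicator (cube w r) y *\<^sub>R (p \<gamma> * (B \<gamma> y * B \<beta> y)))"
            by (simp add: set_integrable_def)
        qed
        also have "\<dots> = (\<Sum>\<gamma>\<in>?I. if \<gamma> = \<beta> then p \<beta> else 0)"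
          using B(3) b by (intro sum.cong) auto
        finally show ?thesis using b by simp
      qed
      have "a \<beta> = (LINT y:cube w r|N. f y * B \<beta> y) - p \<beta>" if b: "\<beta> \<in> ?I" for \<beta>
        unfolding a_def g_def left_diff_distrib
        using set_integral_diff(2)[OF f_int[OF b] P_int[OF b]] pB[OF b] by simp
      then have "poly_proj N (cube w r) (int m) f y - P y = (\<Sum>\<beta>\<in>?I. a \<beta> * B \<beta> y)"
        unfolding poly_proj_def Let_def B_def[symmetric]
        by (subst p) (simp add: sum_subtractf[symmetric] left_diff_distrib[symmetric])
      also have "\<dots> = (\<Sum>\<beta>\<in>?I. \<Sum>\<gamma>\<in>?I. a \<beta> * cc \<beta> \<gamma> * pmon \<gamma> ((1 / r) *\<^sub>R (y - w)))"
        by (intro sum.cong refl) (simp add: cc pol_def sum_distrib_left mult.assoc)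
      also have "\<dots> = pol (int m) c ((1 / r) *\<^sub>R (y - w))"
        by (subst sum.swap) (simp add: pol_def c_def sum_distrib_right)
      finally show ?thesis .
    qed
    have cb: "\<bar>c \<gamma>\<bar> \<le> K * K * C1 * C1 * r powr - d * I" if g: "\<gamma> \<in> ?I" for \<gamma>
    proof -
      have "\<bar>c \<gamma>\<bar> \<le> (\<Sum>\<beta>\<in>?I. \<bar>a \<beta> * cc \<beta> \<gamma>\<bar>)" unfolding c_def by (rule sum_abs)
      also have "\<dots> \<le> (\<Sum>\<beta>\<in>?I. (K * C1 * r powr (- (d / 2)) * I) * (C1 * r powr (- (d / 2))))"
        unfolding abs_mult using ab ccb g K C1 I0 by (intro sum_mono mult_mono) auto
      also have "\<dots> = K * K * C1 * C1 * (r powr (- (d / 2)) * r powr (- (d / 2))) * I"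
        by (simp add: K_def mult_ac)
      also have "r powr (- (d / 2)) * r powr (- (d / 2)) = r powr - d" by (simp add: powr_add[symmetric])
      finally show ?thesis .
    qed
    show "\<exists>c I. 0 \<le> I \<and> ennreal I = (\<integral>\<^sup>+y\<in>cube w r. ennreal \<bar>f y - P y\<bar> \<partial>N) \<and>
      (\<forall>y. poly_proj N (cube w r) (int m) f y - P y = pol (int m) c ((1 / r) *\<^sub>R (y - w))) \<and>
      (\<forall>\<beta>\<in>multi_indices (int m). \<bar>c \<beta>\<bar> \<le> K * K * C1 * C1 * r powr - d * I)"
      using I0 I eq cb by (intro exI[of _ c] exI[of _ I]) (auto simp: g_def)
  qed
qed

end

section \<open>Discretization on a grid\<close>

definition grid_cell :: "real \<Rightarrow> real ^ 'n \<Rightarrow> 'n::finite \<Rightarrow> int" where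
  "grid_cell \<rho> x = (\<lambda>i. \<lfloor>x $ i / \<rho>\<rfloor>)"

lemma grid_cell_dist: "0 < \<rho> \<Longrightarrow> grid_cell \<rho> x = m \<Longrightarrow> \<bar>x $ i - \<rho> * of_int (m i)\<bar> \<le> \<rho>"
proof -
  assume \<rho>: "0 < \<rho>" and m: "grid_cell \<rho> x = m"
  have "\<lfloor>x $ i / \<rho>\<rfloor> = m i" using m by (auto simp: grid_cell_def)
  then have "\<bar>x $ i / \<rho> - of_int (m i)\<bar> \<le> 1" by linarith
  then have "\<bar>\<rho> * (x $ i / \<rho> - of_int (m i))\<bar> \<le> \<rho>" using \<rho> by (simp add: abs_mult)
  also have "\<rho> * (x $ i / \<rho> - of_int (m i)) = x $ i - \<rho> * of_int (m i)" using \<rho> by (simp add: field_simps)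
  finally show ?thesis .
qed

lemma grid_cell_measurable [measurable]: "grid_cell \<rho> \<in> measurable borel (count_space UNIV)"
proof (subst measurable_count_space_eq2_countable, safe)
  fix m :: "'n::finite \<Rightarrow> int"
  have "grid_cell \<rho> -` {m} \<inter> space borel = {x. \<forall>i. \<lfloor>x $ i / \<rho>\<rfloor> = m i}"
    by (auto simp: grid_cell_def fun_eq_iff)
  also have "\<dots> \<in> sets borel" by measurable
  finally show "grid_cell \<rho> -` {m} \<inter> space borel \<in> sets borel" .
qed auto

lemma emeasure_grid_cell:
  assumes "0 < \<rho>"
  shows "emeasure lebesgue {x :: real ^ 'n. grid_cell \<rho> x = m} \<le> ennreal ((2 * \<rho>) ^ CARD('n))"
proof -
  have "{x :: real ^ 'n. grid_cell \<rho> x = m} \<subseteq> cube (\<chi> i. \<rho> * of_int (m i)) \<rho>"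
    by (auto simp: mem_cube_iff intro: grid_cell_dist[OF assms])
  then have "emeasure lebesgue {x :: real ^ 'n. grid_cell \<rho> x = m} \<le>
      emeasure lebesgue (cube (\<chi> i. \<rho> * of_int (m i) :: real ^ 'n) \<rho>)"
    by (intro emeasure_mono) auto
  then show ?thesis using emeasure_cube[of \<rho> "(\<chi> i. \<rho> * of_int (m i)) :: real ^ 'n"] assms by simp
qed

lemma nn_integral_grid_le:
  fixes \<gamma> :: "('n::finite \<Rightarrow> int) \<Rightarrow> ennreal"
  assumes "0 < \<rho>"
  shows "(\<integral>\<^sup>+x. \<gamma> (grid_cell \<rho> x) \<partial>lebesgue) \<le>
    ennreal ((2 * \<rho>) ^ CARD('n)) * (\<integral>\<^sup>+m. \<gamma> m \<partial>count_space UNIV)"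
proof -
  have [measurable]: "{x :: real ^ 'n. grid_cell \<rho> x = m} \<in> sets borel" for m by measurable
  have "\<gamma> (grid_cell \<rho> x) = (\<integral>\<^sup>+m. \<gamma> m * indicator {x. grid_cell \<rho> x = m} x \<partial>count_space UNIV)"
    for x :: "real ^ 'n"
    by (subst nn_integral_count_space'[of "{grid_cell \<rho> x}"]) auto
  then have "(\<integral>\<^sup>+x. \<gamma> (grid_cell \<rho> x) \<partial>lebesgue) =
      (\<integral>\<^sup>+x. \<integral>\<^sup>+m. \<gamma> m * indicator {x. grid_cell \<rho> x = m} x \<partial>count_space UNIV \<partial>(lebesgue :: (real ^ 'n) measure))"
    by simp
  also have "\<dots> = (\<integral>\<^sup>+m. \<integral>\<^sup>+x. \<gamma> m * indicator {x. grid_cell \<rho> x = m} x \<partial>(lebesgue :: (real ^ 'n) measure) \<partial>count_space UNIV)"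
    by (intro nn_integral_count_space_nn_integral) (auto intro!: measurable_completion borel_measurable_times_ennreal)
  also have "\<dots> = (\<integral>\<^sup>+m. \<gamma> m * emeasure lebesgue {x :: real ^ 'n. grid_cell \<rho> x = m} \<partial>count_space UNIV)"
    by (intro nn_integral_cong nn_integral_cmult_indicator) auto
  also have "\<dots> \<le> (\<integral>\<^sup>+m. ennreal ((2 * \<rho>) ^ CARD('n)) * \<gamma> m \<partial>count_space UNIV)"
    using mult_left_mono[OF emeasure_grid_cell[OF assms]] by (intro nn_integral_mono) (simp add: mult.commute)
  finally show ?thesis by (simp add: nn_integral_cmult)
qed

context regular_set begin

text \<open>\<open>G\<close> is on each grid cell the supremum of \<open>g\<close>, hence measurable
  for arbitrary \<open>g\<close>; \<open>h\<close> enters only through monotonicity. A cell with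
  nonzero supremum is charged to a cube of radius \<open>\<rho>\<close> around a nearby point
  \<open>s m\<close> of S. Cell volume divided by the measure of this cube gives the gain
  \<open>\<rho> powr (n - d)\<close>.\<close>

theorem discretize:
  fixes g h :: "real ^ 'n \<Rightarrow> ennreal"
  assumes \<rho>: "0 < \<rho>" "\<rho> \<le> R"
    and gh: "\<And>x y. y \<in> S \<Longrightarrow> infnorm (x - y) \<le> 4 * \<rho> \<Longrightarrow> g x \<le> h y"
    and g0: "\<And>x. g x \<noteq> 0 \<Longrightarrow> \<exists>s\<in>S. infnorm (x - s) \<le> 2 * \<rho>"
  shows "\<exists>G\<in>borel_measurable borel. (\<forall>x. g x \<le> G x) \<and>
    (\<integral>\<^sup>+x. G x \<partial>lebesgue) \<le> ennreal (18 ^ CARD('n) / c1 * \<rho> powr (real CARD('n) - d)) * (\<integral>\<^sup>+y. h y \<partial>N)"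
proof -
  \<comment> \<open>Bounds the overlap of the cubes around the points \<open>s m\<close>: a point y
    of such a cube determines each coordinate of \<open>m\<close> up to an error 4, which leaves 2 *
    4 + 1 = 9 values.\<close>
  define K where "K = (9 :: real) ^ CARD('n)"
  have K: "0 < K" by (simp add: K_def)
  define C where "C = 18 ^ CARD('n) / c1"
  have C_eq: "C = 2 ^ CARD('n) * K / c1" by (simp add: C_def K_def power_mult_distrib[symmetric])
  have C: "0 < C" using c1 by (simp add: C_def)
  define \<gamma> where "\<gamma> m = (SUP x\<in>{x. grid_cell \<rho> x = m}. g x)" for m
  have "\<exists>x s. \<gamma> m \<noteq> 0 \<longrightarrow> grid_cell \<rho> x = m \<and> s \<in> S \<and> infnorm (x - s) \<le> 2 * \<rho>" for m
  proof (cases "\<gamma> m = 0")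
    case False
    have "\<exists>x. grid_cell \<rho> x = m \<and> g x \<noteq> 0"
    proof (rule ccontr)
      assume "\<nexists>x. grid_cell \<rho> x = m \<and> g x \<noteq> 0"
      then have "\<gamma> m \<le> 0" unfolding \<gamma>_def by (intro SUP_least) auto
      then show False using False by simp
    qed
    then show ?thesis using g0 by blast
  qed auto
  then obtain X s where Xs: "\<And>m. \<gamma> m \<noteq> 0 \<Longrightarrow> grid_cell \<rho> (X m) = m \<and> s m \<in> S \<and> infnorm (X m - s m) \<le> 2 * \<rho>"
    by metis
  have \<gamma>h: "\<gamma> m \<le> h y" if "\<gamma> m \<noteq> 0" "y \<in> S" "y \<in> cube (s m) \<rho>" for m y
    unfolding \<gamma>_def
  proof (rule SUP_least)
    fix x assume x: "x \<in> {x. grid_cell \<rho> x = m}"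
    have "\<bar>x $ i - X m $ i\<bar> \<le> \<rho>" for i
    proof -
      have "\<lfloor>x $ i / \<rho>\<rfloor> = \<lfloor>X m $ i / \<rho>\<rfloor>"
        using x Xs[OF that(1)] by (auto simp: grid_cell_def fun_eq_iff)
      then have "\<bar>x $ i / \<rho> - X m $ i / \<rho>\<bar> \<le> 1" by linarith
      then show ?thesis using \<rho> by (simp add: diff_divide_distrib[symmetric] abs_divide pos_divide_le_eq)
    qed
    then have "infnorm (x - X m) \<le> \<rho>" by (simp add: infnorm_le_iff)
    moreover have "infnorm (X m - s m) \<le> 2 * \<rho>" using Xs[OF that(1)] by blast
    moreover have "infnorm (s m - y) \<le> \<rho>" using that(3) by (simp add: mem_cube_infnorm)
    \<comment> \<open>\<open>\<rho>\<close> inside the cell, \<open>2 * \<rho>\<close> from the cell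
      to S and \<open>\<rho>\<close> inside the cube: this is the 4 in hypothesis
      \<open>gh\<close>.\<close>
    ultimately have "infnorm (x - y) \<le> 4 * \<rho>"
      using infnorm_triangle3[of x y "X m"] infnorm_triangle3[of "X m" y "s m"] by linarith
    then show "g x \<le> h y" by (rule gh[OF that(2)])
  qed
  have count: "finite {m. \<gamma> m \<noteq> 0 \<and> y \<in> cube (s m) \<rho>}" "real (card {m. \<gamma> m \<noteq> 0 \<and> y \<in> cube (s m) \<rho>}) \<le> K" for y
  proof -
    have sub: "{m. \<gamma> m \<noteq> 0 \<and> y \<in> cube (s m) \<rho>} \<subseteq> {m. \<forall>i. \<bar>of_int (m i) - y $ i / \<rho>\<bar> \<le> 4}"
    proof (intro subsetI CollectI allI)
      fix m i assume "m \<in> {m. \<gamma> m \<noteq> 0 \<and> y \<in> cube (s m) \<rho>}"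
      then have m: "\<gamma> m \<noteq> 0" "y \<in> cube (s m) \<rho>" by auto
      then have X: "grid_cell \<rho> (X m) = m" "infnorm (X m - s m) \<le> 2 * \<rho>" using Xs[of m] by auto
      have "\<bar>X m $ i - \<rho> * of_int (m i)\<bar> \<le> \<rho>" by (rule grid_cell_dist[OF \<rho>(1) X(1)])
      moreover have "\<bar>X m $ i - s m $ i\<bar> \<le> 2 * \<rho>" using X(2) by (simp add: infnorm_le_iff)
      moreover have "\<bar>y $ i - s m $ i\<bar> \<le> \<rho>" using m(2) by (simp add: mem_cube_iff)
      ultimately have "\<bar>\<rho> * of_int (m i) - y $ i\<bar> \<le> 4 * \<rho>" by linarith
      also have "\<rho> * of_int (m i) - y $ i = \<rho> * (of_int (m i) - y $ i / \<rho>)" using \<rho> by (simp add: field_simps)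
      finally show "\<bar>of_int (m i) - y $ i / \<rho>\<bar> \<le> 4" using \<rho> by (simp add: abs_mult)
    qed
    show "finite {m. \<gamma> m \<noteq> 0 \<and> y \<in> cube (s m) \<rho>}"
      by (rule finite_subset[OF sub card_int_box(1)]) auto
    have "real (card {m. \<gamma> m \<noteq> 0 \<and> y \<in> cube (s m) \<rho>}) \<le> real (card {m :: 'n \<Rightarrow> int. \<forall>i. \<bar>of_int (m i) - y $ i / \<rho>\<bar> \<le> 4})"
      by (intro of_nat_mono card_mono sub card_int_box(1)) auto
    also have "\<dots> \<le> (\<Prod>i\<in>(UNIV :: 'n set). 2 * 4 + 1)" by (rule card_int_box(2)) auto
    finally show "real (card {m. \<gamma> m \<noteq> 0 \<and> y \<in> cube (s m) \<rho>}) \<le> K" by (simp add: K_def)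
  qed
  \<comment> \<open>The measure of the charged cube shared among the at most \<open>K\<close> cubes
    through a point.\<close>
  define \<kappa> where "\<kappa> = c1 * \<rho> powr d / K"
  have \<kappa>: "0 < \<kappa>" using c1 \<rho> K by (simp add: \<kappa>_def)
  have "ennreal \<kappa> * (\<integral>\<^sup>+m. \<gamma> m \<partial>count_space UNIV) = (\<integral>\<^sup>+m. ennreal \<kappa> * \<gamma> m \<partial>count_space UNIV)"
    by (simp add: nn_integral_cmult)
  also have "\<dots> \<le> (\<integral>\<^sup>+m. \<integral>\<^sup>+y. (\<gamma> m * ennreal (1 / K)) * indicator (cube (s m) \<rho>) y \<partial>N \<partial>count_space UNIV)"
  proof (intro nn_integral_mono)
    fix m
    show "ennreal \<kappa> * \<gamma> m \<le> (\<integral>\<^sup>+y. (\<gamma> m * ennreal (1 / K)) * indicator (cube (s m) \<rho>) y \<partial>N)"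
    proof (cases "\<gamma> m = 0")
      case False
      then have "s m \<in> S" using Xs by blast
      then have "ennreal (1 / K) * ennreal (c1 * \<rho> powr d) \<le> ennreal (1 / K) * emeasure N (cube (s m) \<rho> \<inter> S)"
        using \<rho> by (intro mult_left_mono lower) auto
      moreover have "ennreal (1 / K) * ennreal (c1 * \<rho> powr d) = ennreal \<kappa>"
        using K c1 by (simp add: ennreal_mult[symmetric] \<kappa>_def)
      ultimately have "\<gamma> m * ennreal \<kappa> \<le> \<gamma> m * (ennreal (1 / K) * emeasure N (cube (s m) \<rho> \<inter> S))"
        by (intro mult_left_mono) auto
      also have "\<dots> = (\<gamma> m * ennreal (1 / K)) * (\<integral>\<^sup>+y. indicator (cube (s m) \<rho>) y \<partial>N)"
        by (simp add: nn_integral_indicator_cube mult.assoc)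
      also have "\<dots> = (\<integral>\<^sup>+y. (\<gamma> m * ennreal (1 / K)) * indicator (cube (s m) \<rho>) y \<partial>N)"
        by (rule nn_integral_cmult[symmetric]) (rule indicator_cube_measurable)
      finally show ?thesis by (simp add: mult.commute)
    qed auto
  qed
  also have "\<dots> = (\<integral>\<^sup>+y. \<integral>\<^sup>+m. (\<gamma> m * ennreal (1 / K)) * indicator (cube (s m) \<rho>) y \<partial>count_space UNIV \<partial>N)"
    by (intro nn_integral_count_space_nn_integral[symmetric] borel_measurable_times_ennreal indicator_cube_measurable) auto
  also have "\<dots> \<le> (\<integral>\<^sup>+y. h y \<partial>N)"
  proof (intro nn_integral_mono)
    fix y assume "y \<in> space N"
    then have y: "y \<in> S" by (simp add: space_N)
    let ?M = "{m. \<gamma> m \<noteq> 0 \<and> y \<in> cube (s m) \<rho>}"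
    have "(\<integral>\<^sup>+m. (\<gamma> m * ennreal (1 / K)) * indicator (cube (s m) \<rho>) y \<partial>count_space UNIV) =
        (\<Sum>m\<in>?M. (\<gamma> m * ennreal (1 / K)) * indicator (cube (s m) \<rho>) y)"
      by (intro nn_integral_count_space' count) (auto simp: indicator_def)
    also have "\<dots> \<le> (\<Sum>m\<in>?M. h y * ennreal (1 / K))"
    proof (intro sum_mono)
      fix m assume "m \<in> ?M"
      then have "\<gamma> m \<le> h y" using \<gamma>h y by blast
      then show "\<gamma> m * ennreal (1 / K) * indicator (cube (s m) \<rho>) y \<le> h y * ennreal (1 / K)"
        by (auto simp: indicator_def intro: mult_right_mono)
    qed
    also have "\<dots> = h y * (ennreal (real (card ?M)) * ennreal (1 / K))"
      by (simp add: ennreal_of_nat_eq_real_of_nat mult_ac)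
    also have "\<dots> = h y * ennreal (real (card ?M) / K)"
      using K by (simp add: ennreal_mult[symmetric])
    also have "\<dots> \<le> h y * ennreal 1" using count(2)[of y] K by (intro mult_left_mono ennreal_leI) auto
    finally show "(\<integral>\<^sup>+m. (\<gamma> m * ennreal (1 / K)) * indicator (cube (s m) \<rho>) y \<partial>count_space UNIV) \<le> h y"
      by simp
  qed
  finally have *: "ennreal \<kappa> * (\<integral>\<^sup>+m. \<gamma> m \<partial>count_space UNIV) \<le> (\<integral>\<^sup>+y. h y \<partial>N)" .
  show ?thesis
  proof (intro bexI conjI allI)
    show "(\<lambda>x. \<gamma> (grid_cell \<rho> x)) \<in> borel_measurable borel" by measurable
    show "g x \<le> \<gamma> (grid_cell \<rho> x)" for x unfolding \<gamma>_def by (intro SUP_upper) auto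
    have eq: "(2 * \<rho>) ^ CARD('n) = C * \<rho> powr (real CARD('n) - d) * \<kappa>"
      using \<rho> c1 K by (simp add: C_eq \<kappa>_def powr_diff powr_realpow power_mult_distrib)
    have "(\<integral>\<^sup>+x. \<gamma> (grid_cell \<rho> x) \<partial>lebesgue) \<le>
        ennreal ((2 * \<rho>) ^ CARD('n)) * (\<integral>\<^sup>+m. \<gamma> m \<partial>count_space UNIV)"
      by (rule nn_integral_grid_le[OF \<rho>(1)])
    also have "\<dots> = ennreal (C * \<rho> powr (real CARD('n) - d)) * (ennreal \<kappa> * (\<integral>\<^sup>+m. \<gamma> m \<partial>count_space UNIV))"
      unfolding eq using C \<kappa> by (simp add: ennreal_mult' mult_ac)
    also have "\<dots> \<le> ennreal (C * \<rho> powr (real CARD('n) - d)) * (\<integral>\<^sup>+y. h y \<partial>N)"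
      by (intro mult_left_mono *) auto
    finally show "(\<integral>\<^sup>+x. \<gamma> (grid_cell \<rho> x) \<partial>lebesgue) \<le>
        ennreal (18 ^ CARD('n) / c1 * \<rho> powr (real CARD('n) - d)) * (\<integral>\<^sup>+y. h y \<partial>N)"
      by (simp add: C_def)
  qed
qed

text \<open>The counterpart at unit scale for terms controlled by the global norm. Enlarging the
  radius by 1 makes the local integral depend on the grid cell only.\<close>

theorem discretize_local_integral:
  fixes g h :: "real ^ 'n \<Rightarrow> ennreal"
  assumes K: "0 \<le> K" and h [measurable]: "h \<in> borel_measurable N"
    and gh: "\<And>x. g x \<le> (\<integral>\<^sup>+y\<in>cube x K. h y \<partial>N)"
  shows "\<exists>G\<in>borel_measurable borel. (\<forall>x. g x \<le> G x) \<and>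
    (\<integral>\<^sup>+x. G x \<partial>lebesgue) \<le> ennreal (2 ^ CARD('n) * (2 * K + 3) ^ CARD('n)) * (\<integral>\<^sup>+y. h y \<partial>N)"
proof -
  define L where "L = (2 * K + 3) ^ CARD('n)"
  have L: "0 < L" using K by (simp add: L_def)
  define v where "v m = (\<chi> i. real_of_int (m i))" for m :: "'n \<Rightarrow> int"
  define \<gamma> where "\<gamma> m = (\<integral>\<^sup>+y\<in>cube (v m) (K + 1). h y \<partial>N)" for m
  have "(\<integral>\<^sup>+m. \<gamma> m \<partial>count_space UNIV) =
      (\<integral>\<^sup>+y. \<integral>\<^sup>+m. h y * indicator (cube (v m) (K + 1)) y \<partial>count_space UNIV \<partial>N)"
    unfolding \<gamma>_def
    by (intro nn_integral_count_space_nn_integral[symmetric] borel_measurable_times_ennreal indicator_cube_measurable h) auto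
  also have "\<dots> \<le> (\<integral>\<^sup>+y. ennreal L * h y \<partial>N)"
  proof (intro nn_integral_mono)
    fix y
    let ?M = "{m :: 'n \<Rightarrow> int. \<forall>i. \<bar>of_int (m i) - y $ i\<bar> \<le> K + 1}"
    have M: "finite ?M" "real (card ?M) \<le> L"
      using card_int_box[of "\<lambda>_. K + 1" "\<lambda>i. y $ i"] K by (auto simp: L_def algebra_simps)
    have "(\<integral>\<^sup>+m. h y * indicator (cube (v m) (K + 1)) y \<partial>count_space UNIV) =
        (\<Sum>m\<in>?M. h y * indicator (cube (v m) (K + 1)) y)"
      by (intro nn_integral_count_space' M) (auto simp: indicator_def mem_cube_iff v_def abs_minus_commute)
    also have "\<dots> \<le> (\<Sum>m\<in>?M. h y)" by (intro sum_mono) (auto simp: indicator_def)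
    also have "\<dots> = ennreal (real (card ?M)) * h y" by (simp add: ennreal_of_nat_eq_real_of_nat)
    also have "\<dots> \<le> ennreal L * h y" using M(2) by (intro mult_right_mono ennreal_leI) auto
    finally show "(\<integral>\<^sup>+m. h y * indicator (cube (v m) (K + 1)) y \<partial>count_space UNIV) \<le> ennreal L * h y" .
  qed
  also have "\<dots> = ennreal L * (\<integral>\<^sup>+y. h y \<partial>N)" by (rule nn_integral_cmult[OF h])
  finally have *: "(\<integral>\<^sup>+m. \<gamma> m \<partial>count_space UNIV) \<le> ennreal L * (\<integral>\<^sup>+y. h y \<partial>N)" .
  show ?thesis
  proof (intro bexI conjI allI)
    show "(\<lambda>x. \<gamma> (grid_cell 1 x)) \<in> borel_measurable borel" by measurable
    show "g x \<le> \<gamma> (grid_cell 1 x)" for x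
    proof -
      have "infnorm (v (grid_cell 1 x) - x) \<le> 1"
        using grid_cell_dist[of 1 x "grid_cell 1 x"] by (simp add: infnorm_le_iff v_def abs_minus_commute)
      then have "cube x K \<subseteq> cube (v (grid_cell 1 x)) (K + 1)" by (intro cube_mono) auto
      then have "(\<integral>\<^sup>+y\<in>cube x K. h y \<partial>N) \<le> \<gamma> (grid_cell 1 x)"
        unfolding \<gamma>_def by (intro nn_integral_mono mult_left_mono) (auto simp: indicator_def)
      then show ?thesis using gh[of x] by (rule order_trans[rotated])
    qed
    have "(\<integral>\<^sup>+x. \<gamma> (grid_cell 1 x) \<partial>lebesgue) \<le>
        ennreal ((2 * 1) ^ CARD('n)) * (\<integral>\<^sup>+m. \<gamma> m \<partial>count_space UNIV)"
      by (rule nn_integral_grid_le) auto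
    also have "\<dots> \<le> ennreal ((2 * 1) ^ CARD('n)) * (ennreal L * (\<integral>\<^sup>+y. h y \<partial>N))"
      by (intro mult_left_mono *) auto
    also have "\<dots> = ennreal (2 ^ CARD('n) * L) * (\<integral>\<^sup>+y. h y \<partial>N)"
      using L by (simp add: ennreal_mult mult_ac)
    finally show "(\<integral>\<^sup>+x. \<gamma> (grid_cell 1 x) \<partial>lebesgue) \<le> ennreal (2 ^ CARD('n) * (2 * K + 3) ^ CARD('n)) * (\<integral>\<^sup>+y. h y \<partial>N)"
      by (simp add: L_def)
  qed
qed

section \<open>The regular set is Lebesgue null\<close>

lemma S_borel [measurable]: "S \<in> sets borel"
  using closed_S by (rule borel_closed)

text \<open>\<open>discretize\<close> applied to the indicator itself bounds the volume by a
  multiple of \<open>\<rho> powr (n - d)\<close> for every small \<open>\<rho>\<close>, and d <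
  n.\<close>

lemma emeasure_S_cube: "emeasure lebesgue (S \<inter> cube w 1) = 0"
proof -
  define C where "C = 18 ^ CARD('n) / c1"
  have C: "0 < C" using c1 by (simp add: C_def)
  define A where "A = C * (c2 * 2 powr d)"
  have A: "0 < A" using C c2 by (simp add: A_def)
  have le: "emeasure lebesgue (S \<inter> cube w 1) \<le> ennreal \<theta>" if \<theta>: "0 < \<theta>" for \<theta>
  proof -
    obtain \<rho> where \<rho>: "0 < \<rho>" "\<rho> \<le> 1 / 4" "A * \<rho> powr (real CARD('n) - d) \<le> \<theta>"
      using exists_small_power[of "real CARD('n) - d" \<theta> "1 / 4" A] d_less \<theta> A by auto
    have "\<exists>G\<in>borel_measurable borel. (\<forall>x. indicator (S \<inter> cube w 1) x \<le> G x) \<and>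
      (\<integral>\<^sup>+x. G x \<partial>lebesgue) \<le> ennreal (C * \<rho> powr (real CARD('n) - d)) * (\<integral>\<^sup>+y. indicator (cube w 2) y \<partial>N)"
      unfolding C_def
    proof (rule discretize)
      fix x y assume "y \<in> S" "infnorm (x - y) \<le> 4 * \<rho>"
      then show "indicator (S \<inter> cube w 1) x \<le> (indicator (cube w 2) y :: ennreal)"
        using infnorm_triangle3[of w y x] \<rho> by (auto simp: indicator_def mem_cube_infnorm)
    next
      fix x assume "indicator (S \<inter> cube w 1) x \<noteq> (0 :: ennreal)"
      then show "\<exists>s\<in>S. infnorm (x - s) \<le> 2 * \<rho>"
        using \<rho> by (intro bexI[of _ x]) (auto simp: indicator_def infnorm_0 split: if_splits)
    qed (use \<rho> R in auto)
    then obtain G where G: "\<And>x. indicator (S \<inter> cube w 1) x \<le> G x"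
      "(\<integral>\<^sup>+x. G x \<partial>lebesgue) \<le> ennreal (C * \<rho> powr (real CARD('n) - d)) * (\<integral>\<^sup>+y. indicator (cube w 2) y \<partial>N)"
      by auto
    have "emeasure lebesgue (S \<inter> cube w 1) = (\<integral>\<^sup>+x. indicator (S \<inter> cube w 1) x \<partial>lebesgue)"
      by (intro nn_integral_indicator[symmetric]) (auto intro!: sets.Int)
    also have "\<dots> \<le> (\<integral>\<^sup>+x. G x \<partial>lebesgue)" using G(1) by (intro nn_integral_mono)
    also have "\<dots> \<le> ennreal (C * \<rho> powr (real CARD('n) - d)) * emeasure N (cube w 2 \<inter> S)"
      using G(2) by (simp add: nn_integral_indicator_cube)
    also have "\<dots> \<le> ennreal (C * \<rho> powr (real CARD('n) - d)) * ennreal (c2 * 2 powr d)"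
      using R by (intro mult_left_mono upper) auto
    also have "\<dots> = ennreal (A * \<rho> powr (real CARD('n) - d))"
      using C c2 by (simp add: A_def ennreal_mult[symmetric] mult_ac)
    also have "\<dots> \<le> ennreal \<theta>" by (intro ennreal_leI \<rho>)
    finally show ?thesis .
  qed
  have "emeasure lebesgue (S \<inter> cube w 1) \<le> 0"
  proof (rule ennreal_le_epsilon)
    fix e :: real assume "0 < e"
    then show "emeasure lebesgue (S \<inter> cube w 1) \<le> 0 + ennreal e" using le[of e] by (simp only: add_0)
  qed
  then show ?thesis by simp
qed

lemma AE_not_in_S: "AE x in lebesgue. x \<notin> S"
proof -
  have sub: "S \<subseteq> (\<Union>m :: 'n \<Rightarrow> int. S \<inter> cube (\<chi> i. real_of_int (m i)) 1)"
  proof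
    fix x assume "x \<in> S"
    then have "x \<in> S \<inter> cube (\<chi> i. real_of_int (grid_cell 1 x i)) 1"
      using grid_cell_dist[of 1 x "grid_cell 1 x"] by (simp add: mem_cube_iff)
    then show "x \<in> (\<Union>m :: 'n \<Rightarrow> int. S \<inter> cube (\<chi> i. real_of_int (m i)) 1)" by blast
  qed
  have null: "(\<Union>m :: 'n \<Rightarrow> int. S \<inter> cube (\<chi> i. real_of_int (m i)) 1) \<in> null_sets lebesgue"
    using emeasure_S_cube by (intro null_sets_UN) (auto simp: null_sets_def intro!: sets.Int)
  show ?thesis by (rule AE_I'[OF null]) (use sub in blast)
qed

end

section \<open>Whitney decompositions\<close>

definition sdist :: "(real ^ 'n) set \<Rightarrow> real ^ 'n::finite \<Rightarrow> real" where
  "sdist S x = (INF s\<in>S. infnorm (x - s))"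

lemma sdist_le: "s \<in> S \<Longrightarrow> sdist S x \<le> infnorm (x - s)"
  unfolding sdist_def by (rule cINF_lower) (auto intro!: bdd_belowI[of _ 0] infnorm_pos_le)

lemma sdist_less: "S \<noteq> {} \<Longrightarrow> sdist S x < r \<Longrightarrow> \<exists>s\<in>S. infnorm (x - s) < r"
  unfolding sdist_def by (subst (asm) cINF_less_iff) (auto intro!: bdd_belowI[of _ 0] infnorm_pos_le)

lemma sdist_ge: "S \<noteq> {} \<Longrightarrow> (\<And>s. s \<in> S \<Longrightarrow> b \<le> infnorm (x - s)) \<Longrightarrow> b \<le> sdist S x"
  unfolding sdist_def by (rule cINF_greatest)

lemma sdist_triangle:
  assumes "S \<noteq> {}" shows "sdist S x \<le> infnorm (x - y) + sdist S y"
proof -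
  have "sdist S x - infnorm (x - y) \<le> sdist S y"
  proof (rule sdist_ge[OF assms])
    fix s assume "s \<in> S"
    then show "sdist S x - infnorm (x - y) \<le> infnorm (y - s)"
      using sdist_le[of s S x] infnorm_triangle3[of x s y] by linarith
  qed
  then show ?thesis by linarith
qed

lemma sup_diam_cube:
  fixes x :: "real ^ 'n"
  assumes "0 \<le> r" shows "sup_diam (cube x r) = 2 * r"
proof -
  let ?a = "x + (\<chi> i. r)" and ?b = "x - (\<chi> i. r)"
  have ab: "?a \<in> cube x r" "?b \<in> cube x r" using assms by (auto simp: mem_cube_iff)
  have "infnorm (?a - ?b) = 2 * r"
  proof (rule antisym)
    show "infnorm (?a - ?b) \<le> 2 * r" using assms by (simp add: infnorm_le_iff)
    show "2 * r \<le> infnorm (?a - ?b)"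
      using component_le_infnorm_cart[of "?a - ?b" undefined] assms by simp
  qed
  then have 1: "ennreal (2 * r) \<le> sup_ediam (cube x r)"
    unfolding sup_ediam_def using ab by (intro SUP_upper2[of ?a] SUP_upper2[of ?b]) auto
  have "sup_ediam (cube x r) \<le> ennreal (2 * r)"
    unfolding sup_ediam_def
  proof (intro SUP_least ennreal_leI)
    fix y z assume "y \<in> cube x r" "z \<in> cube x r"
    then show "infnorm (y - z) \<le> 2 * r"
      using infnorm_triangle3[of y z x] by (simp add: mem_cube_infnorm infnorm_sub)
  qed
  with 1 have "sup_ediam (cube x r) = ennreal (2 * r)" by (rule antisym[rotated])
  then show ?thesis using assms by (simp add: sup_diam_def)
qed

lemma dyadic_pos: assumes "dyadic Q" shows "0 < snd Q"
proof -
  obtain j :: int where "snd Q = 2 powi (- j) / 2" using assms unfolding dyadic_def by blast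
  then show ?thesis by (simp only: zero_less_divide_iff zero_less_power_int zero_less_numeral simp_thms)
qed

definition dyadic_qube :: "int \<Rightarrow> ('n \<Rightarrow> int) \<Rightarrow> 'n::finite qube" where
  "dyadic_qube j m = ((\<chi> i. 2 powi (- j) * (of_int (m i) + 1 / 2)), 2 powi (- j) / 2)"

lemma dyadic_iff: "dyadic Q \<longleftrightarrow> (\<exists>j m. Q = dyadic_qube j m)"
  unfolding dyadic_def dyadic_qube_def by (auto simp: prod_eq_iff vec_eq_iff)

lemma countable_dyadic: "countable {Q :: 'n::finite qube. dyadic Q}"
proof -
  have "{Q :: 'n qube. dyadic Q} = range (\<lambda>(j, m). dyadic_qube j m)"
    by (force simp: dyadic_iff)
  then show ?thesis by simp
qed

lemma power_int_two_less: "2 powi a < (2 powi b :: real) \<Longrightarrow> a < b"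
  using power_int_increasing[of b a "2::real"] by (meson linorder_not_le one_le_numeral)

text \<open>Since 24 is below 2^5, the exponents stay within 5 of that of any one member, which
  allows 11 generations. Within a generation \<open>\<rho> \<le> 12 * 2 powi (- j)\<close> turns the
  distance 11 \<rho> into 132 grid units, that is 2 * 132 + 1 = 265 indices per coordinate.\<close>

lemma finite_dyadic_near:
  fixes x :: "real ^ 'n"
  assumes \<rho>: "0 < \<rho>"
  defines "A \<equiv> {Q :: 'n qube. dyadic Q \<and> \<rho> / 24 \<le> snd Q \<and> snd Q \<le> \<rho> \<and> infnorm (fst Q - x) \<le> 11 * \<rho>}"
  shows "finite A" and "card A \<le> 11 * 265 ^ CARD('n)"
proof -
  have "finite A \<and> card A \<le> 11 * 265 ^ CARD('n)"
  proof (cases "A = {}")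
    case False
    then obtain Q0 where Q0: "Q0 \<in> A" by blast
    then obtain j0 m0 where "Q0 = dyadic_qube j0 m0" unfolding A_def dyadic_iff by blast
    with Q0 have 0: "dyadic_qube j0 m0 \<in> A" by simp
    define M where "M j = {m :: 'n \<Rightarrow> int. \<forall>i. \<bar>of_int (m i) - (x $ i * 2 powi j - 1 / 2)\<bar> \<le> 132}" for j :: int
    have M: "finite (M j)" "card (M j) \<le> 265 ^ CARD('n)" for j
    proof -
      show "finite (M j)" unfolding M_def by (rule card_int_box(1)) auto
      have "real (card (M j)) \<le> (\<Prod>i\<in>(UNIV :: 'n set). 2 * 132 + 1)"
        unfolding M_def by (rule card_int_box(2)) auto
      then have "real (card (M j)) \<le> real (265 ^ CARD('n))" by simp
      then show "card (M j) \<le> 265 ^ CARD('n)" by (simp only: of_nat_le_iff)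
    qed
    have "A \<subseteq> (\<lambda>(j, m). dyadic_qube j m) ` (SIGMA j:{j0 - 5..j0 + 5}. M j)"
    proof
      fix Q assume Q: "Q \<in> A"
      then obtain j m where jm: "Q = dyadic_qube j m" unfolding A_def dyadic_iff by blast
      have b: "\<rho> / 24 \<le> 2 powi (- j) / 2" "2 powi (- j) / 2 \<le> \<rho>"
        using Q by (auto simp: A_def jm dyadic_qube_def)
      have b0: "\<rho> / 24 \<le> 2 powi (- j0) / 2" "2 powi (- j0) / 2 \<le> \<rho>"
        using 0 by (auto simp: A_def dyadic_qube_def)
      have p: "(0::real) < 2 powi (- j)" "(0::real) < 2 powi (- j0)" by auto
      have e: "2 powi (- i + 5) = 2 powi (- i) * (32 :: real)" for i :: int
        by (subst power_int_add) auto
      have "2 powi (- j) < (2 powi (- j0 + 5) :: real)"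
        unfolding e using b b0 p by linarith
      then have "- j < - j0 + 5" by (rule power_int_two_less)
      moreover have "2 powi (- j0) < (2 powi (- j + 5) :: real)"
        unfolding e using b b0 p by linarith
      then have "- j0 < - j + 5" by (rule power_int_two_less)
      ultimately have j: "j \<in> {j0 - 5..j0 + 5}" by auto
      have "m \<in> M j"
        unfolding M_def
      proof (intro CollectI allI)
        fix i
        have "\<bar>2 powi (- j) * (of_int (m i) + 1 / 2) - x $ i\<bar> \<le> 11 * \<rho>"
          using Q by (simp add: A_def jm dyadic_qube_def infnorm_le_iff)
        also have "\<dots> \<le> 132 * 2 powi (- j)" using b by simp
        finally have "\<bar>2 powi (- j) * (of_int (m i) + 1 / 2) - x $ i\<bar> * 2 powi j \<le> 132 * 2 powi (- j) * 2 powi j"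
          by (intro mult_right_mono) auto
        also have "132 * 2 powi (- j) * 2 powi j = (132 :: real)" by (simp add: power_int_minus)
        also have "\<bar>2 powi (- j) * (of_int (m i) + 1 / 2) - x $ i\<bar> * 2 powi j =
            \<bar>(2 powi (- j) * (of_int (m i) + 1 / 2) - x $ i) * 2 powi j\<bar>" by (simp add: abs_mult)
        also have "(2 powi (- j) * (of_int (m i) + 1 / 2) - x $ i) * 2 powi j =
            of_int (m i) - (x $ i * 2 powi j - 1 / 2)"
          by (simp add: power_int_minus field_simps)
        finally show "\<bar>of_int (m i) - (x $ i * 2 powi j - 1 / 2)\<bar> \<le> 132" .
      qed
      with j show "Q \<in> (\<lambda>(j, m). dyadic_qube j m) ` (SIGMA j:{j0 - 5..j0 + 5}. M j)"
        by (auto simp: jm)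
    qed
    moreover have fin: "finite (SIGMA j:{j0 - 5..j0 + 5}. M j)" using M by auto
    ultimately have "finite A" "card A \<le> card (SIGMA j:{j0 - 5..j0 + 5}. M j)"
      by (auto intro: finite_surj surj_card_le)
    moreover have "card (SIGMA j:{j0 - 5..j0 + 5}. M j) \<le> (\<Sum>j\<in>{j0 - 5..j0 + 5}. 265 ^ CARD('n))"
    proof -
      have "card (SIGMA j:{j0 - 5..j0 + 5}. M j) = (\<Sum>j\<in>{j0 - 5..j0 + 5}. card (M j))"
        using M by (intro card_SigmaI) auto
      also have "\<dots> \<le> (\<Sum>j\<in>{j0 - 5..j0 + 5}. 265 ^ CARD('n))" by (intro sum_mono M)
      finally show ?thesis .
    qed
    ultimately show ?thesis by auto
  qed auto
  then show "finite A" "card A \<le> 11 * 265 ^ CARD('n)" by auto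
qed

locale whitney =
  fixes S :: "(real ^ 'n::finite) set" and W :: "'n qube set" and a :: "'n qube \<Rightarrow> real ^ 'n"
  assumes S_ne: "S \<noteq> {}" and wd: "whitney_decomposition S W" and np: "nearest_points S W a"
begin

lemma W_dyadic: "Q \<in> W \<Longrightarrow> dyadic Q"
  using wd by (auto simp: whitney_decomposition_def)

lemma W_pos: "Q \<in> W \<Longrightarrow> 0 < snd Q"
  using W_dyadic dyadic_pos by blast

text \<open>Licenses the exchange of sums over Whitney cubes with integrals.\<close>

lemma countable_W: "countable W"
  by (rule countable_subset[OF _ countable_dyadic]) (auto dest: W_dyadic)

lemma a_in_S: "Q \<in> W \<Longrightarrow> a Q \<in> S"
  using np by (auto simp: nearest_points_def)

lemma bdd_dists: "bdd_below ((\<lambda>(x, y). infnorm (x - y)) ` A)"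
  by (auto intro!: bdd_belowI[of _ 0] infnorm_pos_le)

lemma W_far:
  assumes Q: "Q \<in> W" and y: "y \<in> cube_of Q" and s: "s \<in> S"
  shows "2 * snd Q \<le> infnorm (y - s)"
proof -
  have "2 * snd Q \<le> sup_dist (cube_of Q) S"
    using wd Q W_pos[OF Q] sup_diam_cube[of "snd Q" "fst Q"] by (auto simp: whitney_decomposition_def)
  also have "\<dots> \<le> (case (y, s) of (x, y) \<Rightarrow> infnorm (x - y))"
    unfolding sup_dist_def using y s by (intro cINF_lower bdd_dists) auto
  finally show ?thesis by simp
qed

lemma center_in_cube: "Q \<in> W \<Longrightarrow> fst Q \<in> cube_of Q"
  using W_pos[of Q] by (simp add: mem_cube_iff)

text \<open>Four diameters are \<open>8 * snd Q\<close>; 9 leaves room for choosing points that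
  nearly realise the infimum, and the last unit leads from the chosen point of the cube to its
  centre.\<close>

lemma W_near:
  assumes Q: "Q \<in> W" shows "infnorm (fst Q - a Q) \<le> 10 * snd Q"
proof -
  have ne: "cube_of Q \<times> S \<noteq> {}" using center_in_cube[OF Q] S_ne by auto
  have "sup_dist (cube_of Q) S \<le> 8 * snd Q"
    using wd Q W_pos[OF Q] sup_diam_cube[of "snd Q" "fst Q"] by (auto simp: whitney_decomposition_def)
  then have "sup_dist (cube_of Q) S < 9 * snd Q" using W_pos[OF Q] by linarith
  then have "\<exists>p\<in>cube_of Q \<times> S. (case p of (x, y) \<Rightarrow> infnorm (x - y)) < 9 * snd Q"
    unfolding sup_dist_def by (subst (asm) cINF_less_iff[OF ne bdd_dists])
  then obtain y s where ys: "y \<in> cube_of Q" "s \<in> S" "infnorm (y - s) < 9 * snd Q" by auto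
  have "infnorm (fst Q - a Q) = sup_dist {fst Q} S" using np Q by (auto simp: nearest_points_def)
  also have "\<dots> \<le> (case (fst Q, s) of (x, y) \<Rightarrow> infnorm (x - y))"
    unfolding sup_dist_def using ys by (intro cINF_lower bdd_dists) auto
  also have "\<dots> \<le> infnorm (fst Q - y) + infnorm (y - s)" using infnorm_triangle3[of "fst Q" s y] by simp
  also have "\<dots> \<le> 10 * snd Q" using ys by (simp add: mem_cube_infnorm)
  finally show ?thesis .
qed

text \<open>Contraction by 8/9 towards the centre moves a point of 9/8 Q into Q at a cost of at most
  \<open>snd Q / 8\<close>. Then 2 - 1/8 = 15/8 and 10 + 9/8 \<le> 12.\<close>

lemma expanded_cube:
  assumes Q: "Q \<in> W" and y: "y \<in> cube (fst Q) (9 / 8 * snd Q)"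
  shows "15 / 8 * snd Q \<le> sdist S y" and "infnorm (y - a Q) \<le> 12 * snd Q" and "sdist S y \<le> 12 * snd Q"
proof -
  have r: "0 < snd Q" by (rule W_pos[OF Q])
  define z where "z = fst Q + (8 / 9) *\<^sub>R (y - fst Q)"
  have yz: "infnorm (y - z) \<le> snd Q / 8"
  proof -
    have "y - z = (1 / 9) *\<^sub>R (y - fst Q)" by (simp add: z_def vec_eq_iff field_simps)
    then show ?thesis using y by (simp add: infnorm_mul mem_cube_infnorm infnorm_sub)
  qed
  have z: "z \<in> cube_of Q"
  proof -
    have "z - fst Q = (8 / 9) *\<^sub>R (y - fst Q)" by (simp add: z_def)
    then have "infnorm (z - fst Q) \<le> snd Q" using y by (simp add: infnorm_mul mem_cube_infnorm infnorm_sub)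
    then show ?thesis by (simp add: mem_cube_infnorm infnorm_sub)
  qed
  show "15 / 8 * snd Q \<le> sdist S y"
  proof (rule sdist_ge[OF S_ne])
    fix s assume s: "s \<in> S"
    have "2 * snd Q \<le> infnorm (z - s)" by (rule W_far[OF Q z s])
    also have "\<dots> \<le> infnorm (y - z) + infnorm (y - s)"
      using infnorm_triangle3[of z s y] by (simp add: infnorm_sub)
    finally show "15 / 8 * snd Q \<le> infnorm (y - s)" using yz by linarith
  qed
  show a: "infnorm (y - a Q) \<le> 12 * snd Q"
    using infnorm_triangle3[of y "a Q" "fst Q"] W_near[OF Q] y r
    by (simp add: mem_cube_infnorm infnorm_sub)
  show "sdist S y \<le> 12 * snd Q" using sdist_le[OF a_in_S[OF Q], of y] a by linarith
qed

text \<open>A finite family, for y off S, that contains every cube with nonzero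
  \<open>\<phi> Q y\<close>; the infinite sums over \<open>W\<close> reduce to it.\<close>

definition touching :: "real ^ 'n \<Rightarrow> 'n qube set" where
  "touching y = {Q \<in> W. y \<in> cube (fst Q) (9 / 8 * snd Q)}"

lemma in_W_cube: "y \<notin> S \<Longrightarrow> \<exists>Q\<in>W. y \<in> cube_of Q"
  using wd by (auto simp: whitney_decomposition_def)

lemma sdist_pos:
  assumes "y \<notin> S" shows "0 < sdist S y"
proof -
  obtain Q where Q: "Q \<in> W" "y \<in> cube_of Q" using in_W_cube[OF assms] by blast
  have "2 * snd Q \<le> sdist S y" by (rule sdist_ge[OF S_ne]) (rule W_far[OF Q])
  then show ?thesis using W_pos[OF Q(1)] by linarith
qed

lemma finite_touching:
  assumes "y \<notin> S" shows "finite (touching y)"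
proof (rule finite_subset)
  show "finite {Q :: 'n qube. dyadic Q \<and> sdist S y / 24 \<le> snd Q \<and> snd Q \<le> sdist S y \<and>
      infnorm (fst Q - y) \<le> 11 * sdist S y}"
    by (rule finite_dyadic_near[OF sdist_pos[OF assms]])
  show "touching y \<subseteq> {Q :: 'n qube. dyadic Q \<and> sdist S y / 24 \<le> snd Q \<and> snd Q \<le> sdist S y \<and>
      infnorm (fst Q - y) \<le> 11 * sdist S y}"
  proof
    fix Q assume "Q \<in> touching y"
    then have Q: "Q \<in> W" "y \<in> cube (fst Q) (9 / 8 * snd Q)" by (auto simp: touching_def)
    have "infnorm (fst Q - y) \<le> 9 / 8 * snd Q" using Q(2) by (simp add: mem_cube_infnorm)
    then show "Q \<in> {Q. dyadic Q \<and> sdist S y / 24 \<le> snd Q \<and> snd Q \<le> sdist S y \<and>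
      infnorm (fst Q - y) \<le> 11 * sdist S y}"
      using expanded_cube[OF Q] W_dyadic[OF Q(1)] W_pos[OF Q(1)] by auto
  qed
qed

lemma phi_eq_0:
  assumes wp: "whitney_partition C S W \<phi>" and Q: "Q \<in> W - touching y"
  shows "\<phi> Q y = 0"
proof (rule ccontr)
  assume "\<phi> Q y \<noteq> 0"
  then have "y \<in> closure {x. \<phi> Q x \<noteq> 0}" using closure_subset[of "{x. \<phi> Q x \<noteq> 0}"] by auto
  then show False using wp Q by (auto simp: whitney_partition_def touching_def)
qed

lemma partition_sum:
  assumes wp: "whitney_partition C S W \<phi>" and y: "y \<notin> S"
  shows "(\<Sum>\<^sub>\<infinity>Q\<in>W. \<phi> Q y * g Q) = (\<Sum>Q\<in>touching y. \<phi> Q y * g Q)"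
    and "(\<Sum>Q\<in>touching y. \<phi> Q y) = 1"
proof -
  have 0: "\<phi> Q y = 0" if "Q \<in> W - touching y" for Q using phi_eq_0[OF wp that] .
  have sub: "touching y \<subseteq> W" by (auto simp: touching_def)
  have "(\<Sum>\<^sub>\<infinity>Q\<in>W. \<phi> Q y * g Q) = (\<Sum>\<^sub>\<infinity>Q\<in>touching y. \<phi> Q y * g Q)"
    using 0 sub by (intro infsum_cong_neutral) auto
  then show "(\<Sum>\<^sub>\<infinity>Q\<in>W. \<phi> Q y * g Q) = (\<Sum>Q\<in>touching y. \<phi> Q y * g Q)"
    using finite_touching[OF y] by simp
  have "((\<lambda>Q. \<phi> Q y) has_sum indicator (- S) y) W" using wp by (auto simp: whitney_partition_def)
  then have "((\<lambda>Q. \<phi> Q y) has_sum 1) W" using y by simp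
  moreover have "((\<lambda>Q. \<phi> Q y) has_sum 1) W \<longleftrightarrow> ((\<lambda>Q. \<phi> Q y) has_sum 1) (touching y)"
    by (rule has_sum_cong_neutral) (use 0 sub in auto)
  ultimately have "((\<lambda>Q. \<phi> Q y) has_sum 1) (touching y)" by blast
  then show "(\<Sum>Q\<in>touching y. \<phi> Q y) = 1"
    using finite_touching[OF y] by (simp add: has_sum_finite_iff)
qed

end

section \<open>The extension near the set\<close>

text \<open>The graph of t^v lies above its tangent at l, obtained from Young's inequality with
  weights 1/v and 1 - 1/v. No difference occurs in this form, so it can be integrated in
  \<open>ennreal\<close>.\<close>

lemma powr_tangent:
  fixes t l v :: real
  assumes "0 \<le> t" "0 < l" "1 \<le> v"
  shows "v * l powr (v - 1) * t \<le> t powr v + (v - 1) * l powr v"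
proof (cases "t = 0")
  case False
  have "(t powr v) powr (1 / v) * (l powr v) powr (1 - 1 / v) \<le> 1 / v * t powr v + (1 - 1 / v) * l powr v"
    using assms False by (intro Youngs_inequality_0) auto
  then have "v * ((t powr v) powr (1 / v) * (l powr v) powr (1 - 1 / v)) \<le> v * (1 / v * t powr v + (1 - 1 / v) * l powr v)"
    using assms by (intro mult_left_mono) auto
  moreover have "v * (1 - 1 / v) = v - 1" using assms by (simp add: field_simps)
  moreover have "(t powr v) powr (1 / v) = t" using assms False by (simp add: powr_powr)
  moreover have "(l powr v) powr (1 - 1 / v) = l powr (v - 1)"
    unfolding powr_powr \<open>v * (1 - 1 / v) = v - 1\<close> ..
  ultimately show ?thesis using assms
    by (simp add: distrib_left mult.assoc[symmetric]) (simp add: mult_ac)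
qed (use assms in auto)

text \<open>Integrates the tangent inequality at l = a / V. An upper bound \<open>V\<close> for the
  measure suffices because the constant term (v - 1) l^v is nonnegative; this common finite term is
  then cancelled.\<close>

lemma nn_integral_powr_jensen:
  fixes g :: "'a \<Rightarrow> real"
  assumes g [measurable]: "g \<in> borel_measurable M" and g0: "\<And>x. 0 \<le> g x"
    and A: "(indicator A :: 'a \<Rightarrow> ennreal) \<in> borel_measurable M"
    and V: "0 < V" "(\<integral>\<^sup>+x. indicator A x \<partial>M) \<le> ennreal V"
    and a: "0 \<le> a" "ennreal a = (\<integral>\<^sup>+x\<in>A. ennreal (g x) \<partial>M)" and v: "1 \<le> v"
  shows "ennreal ((a / V) powr v) \<le> ennreal (1 / V) * (\<integral>\<^sup>+x\<in>A. ennreal (g x powr v) \<partial>M)"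
proof (cases "a = 0")
  case False
  let ?l = "a / V"
  have l: "0 < ?l" using a V False by auto
  have "ennreal (v * ?l powr (v - 1)) * ennreal a =
      (\<integral>\<^sup>+x. ennreal (v * ?l powr (v - 1)) * (ennreal (g x) * indicator A x) \<partial>M)"
    unfolding a by (rule nn_integral_cmult[symmetric]) (use A in measurable)
  also have "\<dots> \<le> (\<integral>\<^sup>+x. ennreal (g x powr v) * indicator A x + ennreal ((v - 1) * ?l powr v) * indicator A x \<partial>M)"
  proof (intro nn_integral_mono)
    fix x
    have "ennreal (v * ?l powr (v - 1)) * ennreal (g x) \<le> ennreal (g x powr v) + ennreal ((v - 1) * ?l powr v)"
      using powr_tangent[OF g0[of x] l v] g0[of x] v
      by (simp add: ennreal_mult[symmetric] ennreal_plus[symmetric] del: ennreal_plus)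
    then show "ennreal (v * ?l powr (v - 1)) * (ennreal (g x) * indicator A x) \<le>
        ennreal (g x powr v) * indicator A x + ennreal ((v - 1) * ?l powr v) * indicator A x"
      by (auto simp: indicator_def)
  qed
  also have "\<dots> = (\<integral>\<^sup>+x\<in>A. ennreal (g x powr v) \<partial>M) +
      ennreal ((v - 1) * ?l powr v) * (\<integral>\<^sup>+x. indicator A x \<partial>M)"
    using A by (subst nn_integral_add) (auto simp: nn_integral_cmult)
  also have "\<dots> \<le> (\<integral>\<^sup>+x\<in>A. ennreal (g x powr v) \<partial>M) + ennreal ((v - 1) * ?l powr v) * ennreal V"
    by (intro add_left_mono mult_left_mono V) auto
  also have "ennreal ((v - 1) * ?l powr v) * ennreal V = ennreal ((v - 1) * ?l powr v * V)"
    using v V by (simp add: ennreal_mult[symmetric])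
  also have "ennreal (v * ?l powr (v - 1)) * ennreal a = ennreal (?l powr v * V) + ennreal ((v - 1) * ?l powr v * V)"
  proof -
    have "v * ?l powr (v - 1) * a = v * (?l powr (v - 1) * ?l) * V" using V by simp
    also have "?l powr (v - 1) * ?l = ?l powr v" using l a(1) V(1) powr_add[of ?l "v - 1" 1] by simp
    finally have "v * ?l powr (v - 1) * a = ?l powr v * V + (v - 1) * ?l powr v * V" by (simp add: algebra_simps)
    then show ?thesis using v V(1) a(1) by (simp add: ennreal_mult[symmetric] ennreal_plus[symmetric] del: ennreal_plus)
  qed
  finally have *: "ennreal (?l powr v * V) \<le> (\<integral>\<^sup>+x\<in>A. ennreal (g x powr v) \<partial>M)"
    by (simp add: add.commute[of _ "ennreal ((v - 1) * (a / V) powr v * V)"] ennreal_add_left_cancel_le)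
  have "ennreal (?l powr v) = ennreal (1 / V) * ennreal (?l powr v * V)"
    using V by (simp add: ennreal_mult[symmetric])
  also have "\<dots> \<le> ennreal (1 / V) * (\<integral>\<^sup>+x\<in>A. ennreal (g x powr v) \<partial>M)"
    by (intro mult_left_mono *) auto
  finally show ?thesis .
qed auto

lemma dyadic_shell:
  fixes \<rho> r :: real
  assumes "0 < r" "r \<le> \<rho>"
  shows "\<exists>i::nat. \<rho> * (1 / 2) ^ Suc i < r \<and> r \<le> \<rho> * (1 / 2) ^ i"
proof -
  have "\<exists>i. (1 / 2) ^ i < r / \<rho>" using assms by (intro real_arch_pow_inv) auto
  then obtain i0 where "(1 / 2 :: real) ^ i0 < r / \<rho>" by blast
  then have ex: "\<rho> * (1 / 2) ^ Suc i0 < r" using assms by (simp add: field_simps)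
  define i where "i = (LEAST i. \<rho> * (1 / 2) ^ Suc i < r)"
  have i: "\<rho> * (1 / 2) ^ Suc i < r" unfolding i_def using ex by (rule LeastI)
  have "r \<le> \<rho> * (1 / 2) ^ i"
  proof (cases i)
    case (Suc j)
    then have "\<not> \<rho> * (1 / 2) ^ Suc j < r" unfolding i_def by (intro not_less_Least) auto
    then show ?thesis using Suc by simp
  qed (use assms in auto)
  with i show ?thesis by blast
qed

context whitney begin

text \<open>If z lies in the cube around \<open>a Q\<close>, then Q is centred within 10 + 1/2 \<le>
  11 of its sizes from z, so each generation contributes boundedly many cubes. The sizes decrease
  geometrically between generations, and s > 0 makes the sum converge.\<close>

lemma overlap:
  fixes s \<rho> :: real
  assumes s: "0 < s" and \<rho>: "0 < \<rho>"
  shows "(\<integral>\<^sup>+Q. ennreal (snd Q powr s) * indicator (cube (a Q) (snd Q / 2)) z \<partial>count_space {Q\<in>W. snd Q \<le> \<rho>})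
    \<le> ennreal (11 * 265 ^ CARD('n) / (1 - (1 / 2) powr s) * \<rho> powr s)"
proof -
  let ?W = "{Q\<in>W. snd Q \<le> \<rho>}"
  let ?K = "11 * 265 ^ CARD('n) :: nat"
  define \<rho>' where "\<rho>' i = \<rho> * (1 / 2) ^ i" for i :: nat
  have \<rho>': "0 < \<rho>' i" "\<rho>' (Suc i) = \<rho>' i / 2" for i using \<rho> by (auto simp: \<rho>'_def)
  define B where "B i = {Q\<in>?W. \<rho>' (Suc i) < snd Q \<and> snd Q \<le> \<rho>' i \<and> z \<in> cube (a Q) (snd Q / 2)}" for i
  have B: "finite (B i)" "card (B i) \<le> ?K" for i
  proof -
    let ?D = "{Q :: 'n qube. dyadic Q \<and> \<rho>' i / 24 \<le> snd Q \<and> snd Q \<le> \<rho>' i \<and> infnorm (fst Q - z) \<le> 11 * \<rho>' i}"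
    have sub: "B i \<subseteq> ?D"
    proof
      fix Q assume "Q \<in> B i"
      then have Q: "Q \<in> W" "\<rho>' (Suc i) < snd Q" "snd Q \<le> \<rho>' i" "infnorm (a Q - z) \<le> snd Q / 2"
        by (auto simp: B_def mem_cube_infnorm)
      have "infnorm (fst Q - z) \<le> 11 * \<rho>' i"
        using infnorm_triangle3[of "fst Q" z "a Q"] W_near[OF Q(1)] Q W_pos[OF Q(1)] by linarith
      then show "Q \<in> ?D" using Q W_dyadic[OF Q(1)] \<rho>'[of i] by auto
    qed
    show "finite (B i)" using sub finite_dyadic_near(1)[OF \<rho>'(1)] by (rule finite_subset)
    have "card (B i) \<le> card ?D" by (intro card_mono finite_dyadic_near(1)[OF \<rho>'(1)] sub)
    also have "\<dots> \<le> ?K" by (rule finite_dyadic_near(2)[OF \<rho>'(1)])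
    finally show "card (B i) \<le> ?K" .
  qed
  have "(\<integral>\<^sup>+Q. ennreal (snd Q powr s) * indicator (cube (a Q) (snd Q / 2)) z \<partial>count_space ?W) \<le>
      (\<integral>\<^sup>+Q. (\<Sum>i. ennreal (\<rho>' i powr s) * indicator (B i) Q) \<partial>count_space ?W)"
  proof (intro nn_integral_mono)
    fix Q assume "Q \<in> space (count_space ?W)"
    then have Q: "Q \<in> W" "snd Q \<le> \<rho>" by auto
    show "ennreal (snd Q powr s) * indicator (cube (a Q) (snd Q / 2)) z \<le>
        (\<Sum>i. ennreal (\<rho>' i powr s) * indicator (B i) Q)"
    proof (cases "z \<in> cube (a Q) (snd Q / 2)")
      case True
      obtain i where i: "\<rho>' (Suc i) < snd Q" "snd Q \<le> \<rho>' i"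
        using dyadic_shell[OF W_pos[OF Q(1)] Q(2)] unfolding \<rho>'_def by blast
      have "Q \<in> B i" using True Q i by (auto simp: B_def)
      then have "ennreal (snd Q powr s) * indicator (cube (a Q) (snd Q / 2)) z \<le>
          (\<Sum>i\<in>{i}. ennreal (\<rho>' i powr s) * indicator (B i) Q)"
        using True s i W_pos[OF Q(1)] by (auto intro!: ennreal_leI powr_mono2)
      also have "\<dots> \<le> (\<Sum>i. ennreal (\<rho>' i powr s) * indicator (B i) Q)"
        by (rule sum_le_suminf) (auto intro: summableI)
      finally show ?thesis .
    qed auto
  qed
  also have "\<dots> = (\<Sum>i. \<integral>\<^sup>+Q. ennreal (\<rho>' i powr s) * indicator (B i) Q \<partial>count_space ?W)"
    by (intro nn_integral_suminf) auto
  also have "\<dots> \<le> (\<Sum>i. ennreal (real ?K * \<rho> powr s * ((1 / 2) powr s) ^ i))"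
  proof (intro suminf_le summableI)
    fix i
    have "(\<integral>\<^sup>+Q. ennreal (\<rho>' i powr s) * indicator (B i) Q \<partial>count_space ?W) =
        (\<Sum>Q\<in>B i. ennreal (\<rho>' i powr s) * indicator (B i) Q)"
      by (intro nn_integral_count_space' B) (auto simp: B_def)
    also have "\<dots> = ennreal (real (card (B i)) * \<rho>' i powr s)"
      by (simp add: ennreal_mult ennreal_of_nat_eq_real_of_nat)
    also have "\<dots> \<le> ennreal (real ?K * \<rho>' i powr s)"
      using B(2)[of i] by (intro ennreal_leI mult_right_mono) (auto simp only: of_nat_le_iff powr_ge_zero)
    also have "\<dots> = ennreal (real ?K * \<rho> powr s * ((1 / 2) powr s) ^ i)"
    proof -
      have "((1 / 2 :: real) ^ i) powr s = ((1 / 2) powr s) ^ i"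
        by (simp add: powr_realpow[symmetric] powr_powr mult.commute)
      then have "\<rho>' i powr s = \<rho> powr s * ((1 / 2) powr s) ^ i" using \<rho> by (simp add: \<rho>'_def powr_mult)
      then show ?thesis by (simp only: mult.assoc)
    qed
    finally show "(\<integral>\<^sup>+Q. ennreal (\<rho>' i powr s) * indicator (B i) Q \<partial>count_space ?W) \<le>
        ennreal (real ?K * \<rho> powr s * ((1 / 2) powr s) ^ i)" .
  qed
  also have "\<dots> = ennreal (real ?K * \<rho> powr s * (1 / (1 - (1 / 2) powr s)))"
  proof (rule suminf_ennreal_eq)
    have "(1 / 2) powr s < (1 / 2 :: real) powr 0" using s by (intro powr_less_mono') auto
    then have "(\<lambda>i. ((1 / 2) powr s) ^ i) sums (1 / (1 - (1 / 2) powr s))" by (intro geometric_sums) auto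
    then show "(\<lambda>i. real ?K * \<rho> powr s * ((1 / 2) powr s) ^ i) sums (real ?K * \<rho> powr s * (1 / (1 - (1 / 2) powr s)))"
      by (rule sums_mult)
  qed auto
  finally show ?thesis by (simp add: mult_ac)
qed

end

text \<open>Pointwise \<bar>f\<bar>^u is at most 1 + \<bar>f\<bar>^p, and cubes of radius at most
  \<open>R\<close> have finite measure.\<close>

lemma (in regular_set) local_integral_finite:
  fixes f :: "real ^ 'n \<Rightarrow> real"
  assumes "0 < u" "u \<le> p" and f: "f \<in> borel_measurable N"
    and fin: "(\<integral>\<^sup>+y. ennreal (\<bar>f y\<bar> powr p) \<partial>N) < \<infinity>" and r: "r \<le> R"
  shows "(\<integral>\<^sup>+y\<in>cube x r. ennreal (\<bar>f y\<bar> powr u) \<partial>N) < \<infinity>"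
proof -
  have "(\<integral>\<^sup>+y\<in>cube x r. ennreal (\<bar>f y\<bar> powr u) \<partial>N) \<le>
      (\<integral>\<^sup>+y. indicator (cube x r) y + ennreal (\<bar>f y\<bar> powr p) \<partial>N)"
  proof (intro nn_integral_mono)
    fix y
    have "\<bar>f y\<bar> powr u \<le> 1 + \<bar>f y\<bar> powr p"
    proof (cases "\<bar>f y\<bar> \<le> 1")
      case True
      then have "\<bar>f y\<bar> powr u \<le> 1 powr u" using assms by (intro powr_mono2) auto
      then show ?thesis by (simp add: add_increasing2)
    next
      case False
      then have "\<bar>f y\<bar> powr u \<le> \<bar>f y\<bar> powr p" using assms by (intro powr_mono) auto
      then show ?thesis by simp
    qed
    then have "ennreal (\<bar>f y\<bar> powr u) \<le> ennreal 1 + ennreal (\<bar>f y\<bar> powr p)"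
      by (metis ennreal_leI ennreal_plus powr_ge_zero zero_le_one)
    then show "ennreal (\<bar>f y\<bar> powr u) * indicator (cube x r) y \<le>
        indicator (cube x r) y + ennreal (\<bar>f y\<bar> powr p)"
      by (auto simp: indicator_def)
  qed
  also have "\<dots> = emeasure N (cube x r \<inter> S) + (\<integral>\<^sup>+y. ennreal (\<bar>f y\<bar> powr p) \<partial>N)"
    using f by (subst nn_integral_add) (auto simp: nn_integral_indicator_cube)
  also have "\<dots> < \<infinity>" using fin emeasure_cube_finite[OF r, of x] by (simp add: less_top)
  finally show ?thesis .
qed

text \<open>Fixes the constant \<open>Cp\<close> of the projections ahead of the Whitney data and of
  the function, so that what is built from it is uniform in both.\<close>

locale proj_bound = regular_set N S d R c1 c2
  for N :: "(real ^ 'n::finite) measure" and S d R c1 c2 +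
  fixes k :: nat and Cp :: real
  assumes k: "0 < k" and Cp: "0 < Cp"
    and proj: "\<And>w r f P. w \<in> S \<Longrightarrow> 0 < r \<Longrightarrow> r \<le> R \<Longrightarrow> f \<in> borel_measurable N \<Longrightarrow>
      (\<integral>\<^sup>+y\<in>cube w r. ennreal \<bar>f y\<bar> \<partial>N) < \<infinity> \<Longrightarrow> P \<in> polys (int k - 1) \<Longrightarrow>
      \<exists>c I. 0 \<le> I \<and> ennreal I = (\<integral>\<^sup>+y\<in>cube w r. ennreal \<bar>f y - P y\<bar> \<partial>N) \<and>
        (\<forall>y. poly_proj N (cube w r) (int k - 1) f y - P y = pol (int k - 1) c ((1 / r) *\<^sub>R (y - w))) \<and>
        (\<forall>\<beta>\<in>multi_indices (int k - 1). \<bar>c \<beta>\<bar> \<le> Cp * r powr - d * I)"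
begin

text \<open>A point of 9/8 Q has distance at most \<open>12 * snd Q\<close> from \<open>a Q\<close>,
  which is 24 in units of the radius \<open>snd Q / 2\<close>.\<close>

definition sup_const :: real where
  "sup_const = real (card (multi_indices (int k - 1) :: ('n \<Rightarrow> nat) set)) * 24 ^ k * Cp"

text \<open>\<open>9 ^ CARD('n)\<close> absorbs (9/4)^n from the volume of 9/8 Q and 2^d from the
  radius \<open>snd Q / 2\<close>; the last factor is the one of \<open>overlap\<close> with s = n -
  d.\<close>

definition near_const :: "real \<Rightarrow> real" where
  "near_const v = (sup_const * c2) powr v * 9 ^ CARD('n) / c2 *
     (11 * 265 ^ CARD('n) / (1 - (1 / 2) powr (real CARD('n) - d)))"

lemma sup_const_pos: "0 < sup_const"
proof -
  have "(multi_indices (int k - 1) :: ('n \<Rightarrow> nat) set) \<noteq> {}"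
    using zero_mem_multi_indices[of "int k - 1"] k by auto
  then show ?thesis using Cp by (simp add: sup_const_def card_gt_0_iff)
qed

lemma half_powr_less_one: "(1 / 2) powr (real CARD('n) - d) < 1"
proof -
  have "(1 / 2) powr (real CARD('n) - d) < (1 / 2 :: real) powr 0" using d_less by (intro powr_less_mono') auto
  then show ?thesis by simp
qed

lemma near_const_pos: "0 < near_const v"
  unfolding near_const_def using sup_const_pos c2 half_powr_less_one by auto

end

locale whitney_extension = proj_bound N S d R c1 c2 k Cp + whitney S W a
  for N :: "(real ^ 'n::finite) measure" and S d R c1 c2 k Cp W a +
  fixes \<phi> :: "'n qube \<Rightarrow> real ^ 'n \<Rightarrow> real" and C :: "('n \<Rightarrow> nat) \<Rightarrow> real" and f :: "real ^ 'n \<Rightarrow> real"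
  assumes wp: "whitney_partition C S W \<phi>" and f: "f \<in> borel_measurable N"
    and f_loc: "\<And>w r. r \<le> R \<Longrightarrow> (\<integral>\<^sup>+y\<in>cube w r. ennreal \<bar>f y\<bar> \<partial>N) < \<infinity>"
begin

text \<open>The parameter 16000 bounds the diameter of Q, which is twice
  \<open>snd Q\<close>.\<close>

definition local_poly :: "'n qube \<Rightarrow> real ^ 'n \<Rightarrow> real" where
  "local_poly Q = (if snd Q \<le> 8000 then poly_proj N (cube (a Q) (snd Q / 2)) (int k - 1) f else (\<lambda>x. 0))"

definition ext :: "real ^ 'n \<Rightarrow> real" where
  "ext y = (if y \<in> S then f y else \<Sum>Q\<in>touching y. \<phi> Q y * local_poly Q y)"

lemma phi_bounds: "Q \<in> W \<Longrightarrow> 0 \<le> \<phi> Q x" "Q \<in> W \<Longrightarrow> \<phi> Q x \<le> 1"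
  using wp by (auto simp: whitney_partition_def)

lemma ext_diff:
  assumes "y \<notin> S"
  shows "ext y - P = (\<Sum>Q\<in>touching y. \<phi> Q y * (local_poly Q y - P))"
proof -
  have "(\<Sum>Q\<in>touching y. \<phi> Q y * (local_poly Q y - P)) =
      (\<Sum>Q\<in>touching y. \<phi> Q y * local_poly Q y) - (\<Sum>Q\<in>touching y. \<phi> Q y) * P"
    by (simp add: right_diff_distrib sum_subtractf sum_distrib_right)
  then show ?thesis using partition_sum(2)[OF wp assms] assms by (simp add: ext_def)
qed

lemma local_poly_error:
  assumes Q: "Q \<in> W" "snd Q \<le> 8000" and P: "P \<in> polys (int k - 1)"
  shows "\<exists>c I. 0 \<le> I \<and> ennreal I = (\<integral>\<^sup>+y\<in>cube (a Q) (snd Q / 2). ennreal \<bar>f y - P y\<bar> \<partial>N) \<and>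
    (\<forall>y. local_poly Q y - P y = pol (int k - 1) c ((1 / (snd Q / 2)) *\<^sub>R (y - a Q))) \<and>
    (\<forall>\<beta>\<in>multi_indices (int k - 1). \<bar>c \<beta>\<bar> \<le> Cp * (snd Q / 2) powr - d * I)"
proof -
  have r: "0 < snd Q / 2" "snd Q / 2 \<le> R" using W_pos[OF Q(1)] Q(2) R by auto
  from proj[OF a_in_S[OF Q(1)] r f f_loc[OF r(2)] P] show ?thesis
    using Q(2) by (simp only: local_poly_def if_True)
qed

definition err :: "real \<Rightarrow> (real ^ 'n \<Rightarrow> real) \<Rightarrow> (real ^ 'n) set \<Rightarrow> ennreal" where
  "err v P A = (\<integral>\<^sup>+y\<in>A. ennreal (\<bar>f y - P y\<bar> powr v) \<partial>N)"

lemma diff_measurable: "P \<in> polys m \<Longrightarrow> (\<lambda>y. f y - P y) \<in> borel_measurable N"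
  using f measurable_N[OF polys_borel] by (intro borel_measurable_diff)

lemma powr_measurable: "P \<in> polys m \<Longrightarrow> (\<lambda>y. ennreal (\<bar>f y - P y\<bar> powr v)) \<in> borel_measurable N"
  using diff_measurable by measurable

text \<open>The coefficients control the supremum on 9/8 Q by the mean of \<bar>f - P\<bar> over the
  cube around \<open>a Q\<close>; Jensen's inequality then raises the mean to the power v.\<close>

lemma local_bound:
  assumes Q: "Q \<in> W" "snd Q \<le> 8000" and P: "P \<in> polys (int k - 1)"
    and y: "y \<in> cube (fst Q) (9 / 8 * snd Q)" and v: "1 \<le> v"
  shows "ennreal (\<bar>local_poly Q y - P y\<bar> powr v) \<le>
    ennreal ((sup_const * c2) powr v * 2 powr d / c2 * snd Q powr - d) * err v P (cube (a Q) (snd Q / 2))"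
proof -
  let ?r = "snd Q / 2"
  have r: "0 < ?r" "?r \<le> R" using W_pos[OF Q(1)] Q(2) R by auto
  from local_poly_error[OF Q P] obtain c I where I: "0 \<le> I"
    "ennreal I = (\<integral>\<^sup>+y. ennreal \<bar>f y - P y\<bar> * indicator (cube (a Q) ?r) y \<partial>N)"
    and c1: "\<forall>y. local_poly Q y - P y = pol (int k - 1) c ((1 / ?r) *\<^sub>R (y - a Q))"
    and c2': "\<forall>\<beta>\<in>multi_indices (int k - 1). \<bar>c \<beta>\<bar> \<le> Cp * ?r powr - d * I" by blast
  note c = c1[rule_format] c2'[rule_format]
  have co: "\<bar>((1 / ?r) *\<^sub>R (y - a Q)) $ i\<bar> \<le> 24" for i
  proof -
    have "\<bar>(y - a Q) $ i\<bar> \<le> 12 * snd Q" using expanded_cube(2)[OF Q(1) y] component_le_infnorm_cart order_trans by blast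
    then show ?thesis using r by (simp add: abs_mult field_simps)
  qed
  have "\<bar>local_poly Q y - P y\<bar> \<le> real (card (multi_indices (int k - 1) :: ('n \<Rightarrow> nat) set)) * 24 ^ nat (int k - 1) * (Cp * ?r powr - d * I)"
    unfolding c(1) by (intro abs_pol_le co c(2)) auto
  also have "\<dots> \<le> real (card (multi_indices (int k - 1) :: ('n \<Rightarrow> nat) set)) * 24 ^ k * (Cp * ?r powr - d * I)"
    using Cp I by (intro mult_right_mono mult_left_mono power_increasing) auto
  also have "\<dots> = sup_const * ?r powr - d * I" by (simp add: sup_const_def mult_ac)
  also have "\<dots> = (sup_const * c2) * (I / (c2 * ?r powr d))"
    using c2 by (simp add: powr_minus divide_simps)
  finally have le: "\<bar>local_poly Q y - P y\<bar> \<le> (sup_const * c2) * (I / (c2 * ?r powr d))" .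
  have "ennreal (\<bar>local_poly Q y - P y\<bar> powr v) \<le> ennreal (((sup_const * c2) * (I / (c2 * ?r powr d))) powr v)"
    using le v by (intro ennreal_leI powr_mono2) auto
  also have "\<dots> = ennreal ((sup_const * c2) powr v) * ennreal ((I / (c2 * ?r powr d)) powr v)"
    using sup_const_pos c2 I by (subst powr_mult) (auto simp: ennreal_mult)
  also have "\<dots> \<le> ennreal ((sup_const * c2) powr v) * (ennreal (1 / (c2 * ?r powr d)) * err v P (cube (a Q) ?r))"
    unfolding err_def
  proof (intro mult_left_mono nn_integral_powr_jensen)
    show "(\<integral>\<^sup>+x. indicator (cube (a Q) ?r) x \<partial>N) \<le> ennreal (c2 * ?r powr d)"
      unfolding nn_integral_indicator_cube by (rule upper[OF r])
    show "(\<lambda>y. \<bar>f y - P y\<bar>) \<in> borel_measurable N" using diff_measurable[OF P] by measurable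
  qed (use c2 r I v indicator_cube_measurable in auto)
  also have "\<dots> = ennreal ((sup_const * c2) powr v * (1 / (c2 * ?r powr d))) * err v P (cube (a Q) ?r)"
    using c2 by (subst ennreal_mult) (simp_all add: mult.assoc)
  also have "(sup_const * c2) powr v * (1 / (c2 * ?r powr d)) = (sup_const * c2) powr v * 2 powr d / c2 * snd Q powr - d"
    using r by (simp add: powr_divide powr_minus field_simps)
  finally show ?thesis .
qed

text \<open>\<open>ext y - P\<close> is a convex combination of the differences over the touching
  cubes, so the largest of them dominates it. Powers can then be taken without a further
  constant.\<close>

lemma ext_dominated_by_local_poly:
  assumes y: "y \<notin> S"
  obtains Q where "Q \<in> touching y" "\<bar>ext y - P\<bar> \<le> \<bar>local_poly Q y - P\<bar>"
proof -
  have fin: "finite (touching y)" by (rule finite_touching[OF y])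
  have ne: "touching y \<noteq> {}" using partition_sum(2)[OF wp y] by auto
  define M where "M = Max ((\<lambda>Q. \<bar>local_poly Q y - P\<bar>) ` touching y)"
  have "M \<in> (\<lambda>Q. \<bar>local_poly Q y - P\<bar>) ` touching y" unfolding M_def using fin ne by (intro Max_in) auto
  then obtain Q where Q: "Q \<in> touching y" "M = \<bar>local_poly Q y - P\<bar>" by auto
  have \<phi>0: "0 \<le> \<phi> Q y" if "Q \<in> touching y" for Q using that phi_bounds(1) by (auto simp: touching_def)
  have "\<bar>ext y - P\<bar> \<le> (\<Sum>Q\<in>touching y. \<bar>\<phi> Q y * (local_poly Q y - P)\<bar>)"
    unfolding ext_diff[OF y] by (rule sum_abs)
  also have "\<dots> \<le> (\<Sum>Q\<in>touching y. \<phi> Q y * M)"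
    using \<phi>0 fin by (intro sum_mono) (auto simp: abs_mult M_def intro!: mult_left_mono Max_ge)
  also have "\<dots> = M" using partition_sum(2)[OF wp y] by (simp add: sum_distrib_right[symmetric])
  finally show ?thesis using Q that by auto
qed

text \<open>The sets \<open>A\<close> and \<open>A'\<close> are left open so that the result serves
  both a cube near S and the whole space. On a truncated cube the local polynomial is zero, which is
  exact for P = 0 only; hence \<open>large\<close>. Each remaining Q contributes its volume times
  snd Q^(-d), that is snd Q^(n-d), times the error near \<open>a Q\<close>, and
  \<open>overlap\<close> sums these contributions.\<close>

theorem ext_near:
  assumes P: "P \<in> polys (int k - 1)" and v: "1 \<le> v" and \<rho>: "0 < \<rho>" and A: "A \<in> sets borel" and A': "A' \<in> sets borel"
    and small: "\<And>Q y. Q \<in> W \<Longrightarrow> y \<in> A \<Longrightarrow> y \<in> cube (fst Q) (9 / 8 * snd Q) \<Longrightarrow> snd Q \<le> 8000 \<Longrightarrow>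
      snd Q \<le> \<rho> \<and> cube (a Q) (snd Q / 2) \<subseteq> A'"
    and large: "\<And>Q y. Q \<in> W \<Longrightarrow> y \<in> A \<Longrightarrow> y \<in> cube (fst Q) (9 / 8 * snd Q) \<Longrightarrow> 8000 < snd Q \<Longrightarrow> P = (\<lambda>x. 0)"
  shows "(\<integral>\<^sup>+y\<in>A. ennreal (\<bar>ext y - P y\<bar> powr v) \<partial>lebesgue) \<le>
    ennreal (near_const v * \<rho> powr (real CARD('n) - d)) * err v P A'"
proof -
  define D where "D = (sup_const * c2) powr v * 2 powr d / c2"
  have D: "0 < D" using sup_const_pos c2 by (simp add: D_def)
  define V where "V = {Q\<in>W. snd Q \<le> \<rho> \<and> snd Q \<le> 8000 \<and> cube (a Q) (snd Q / 2) \<subseteq> A'}"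
  have cV: "countable V" by (rule countable_subset[OF _ countable_W]) (auto simp: V_def)
  define F where "F Q = err v P (cube (a Q) (snd Q / 2))" for Q
  have "(\<integral>\<^sup>+y\<in>A. ennreal (\<bar>ext y - P y\<bar> powr v) \<partial>lebesgue) \<le>
      (\<integral>\<^sup>+y. \<integral>\<^sup>+Q. (ennreal (D * snd Q powr - d) * F Q) * indicator (cube (fst Q) (9 / 8 * snd Q)) y \<partial>count_space V \<partial>lebesgue)"
  proof (rule nn_integral_mono_AE)
    show "AE y in lebesgue. ennreal (\<bar>ext y - P y\<bar> powr v) * indicator A y \<le>
      (\<integral>\<^sup>+Q. (ennreal (D * snd Q powr - d) * F Q) * indicator (cube (fst Q) (9 / 8 * snd Q)) y \<partial>count_space V)"
      \<comment> \<open>On S the extension is f itself, which the local polynomials do not control;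
        S is a null set.\<close>
      using AE_not_in_S
    proof (rule AE_mp, intro AE_I2 impI)
      fix y assume y: "y \<notin> S"
      show "ennreal (\<bar>ext y - P y\<bar> powr v) * indicator A y \<le>
        (\<integral>\<^sup>+Q. (ennreal (D * snd Q powr - d) * F Q) * indicator (cube (fst Q) (9 / 8 * snd Q)) y \<partial>count_space V)"
      proof (cases "y \<in> A")
        case True
        obtain Q where Q: "Q \<in> touching y" "\<bar>ext y - P y\<bar> \<le> \<bar>local_poly Q y - P y\<bar>"
          by (rule ext_dominated_by_local_poly[OF y])
        have QW: "Q \<in> W" "y \<in> cube (fst Q) (9 / 8 * snd Q)" using Q(1) by (auto simp: touching_def)
        show ?thesis
        proof (cases "snd Q \<le> 8000")
          case True2: True
          have QV: "Q \<in> V" using small[OF QW(1) True QW(2) True2] QW True2 by (auto simp: V_def)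
          have "ennreal (\<bar>ext y - P y\<bar> powr v) * indicator A y \<le> ennreal (\<bar>local_poly Q y - P y\<bar> powr v)"
            using Q(2) v True by (auto intro!: ennreal_leI powr_mono2)
          also have "\<dots> \<le> ennreal (D * snd Q powr - d) * F Q"
            unfolding D_def F_def by (rule local_bound[OF QW(1) True2 P QW(2) v])
          also have "\<dots> = (ennreal (D * snd Q powr - d) * F Q) * indicator (cube (fst Q) (9 / 8 * snd Q)) y"
            using QW(2) by simp
          also have "\<dots> \<le> (\<integral>\<^sup>+Q. (ennreal (D * snd Q powr - d) * F Q) * indicator (cube (fst Q) (9 / 8 * snd Q)) y \<partial>count_space V)"
            using QV by (rule nn_integral_ge_point)
          finally show ?thesis .
        next
          case False
          then have "P = (\<lambda>x. 0)" using large[OF QW(1) True QW(2)] by simp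
          then have "\<bar>ext y - P y\<bar> = 0" using Q(2) False by (simp add: local_poly_def)
          then show ?thesis using v by simp
        qed
      qed auto
    qed
  qed
  also have "\<dots> = (\<integral>\<^sup>+Q. (\<integral>\<^sup>+y\<in>cube (fst Q) (9 / 8 * snd Q). (ennreal (D * snd Q powr - d) * F Q) \<partial>lebesgue) \<partial>count_space V)"
    by (intro nn_integral_count_space_nn_integral cV borel_measurable_times_ennreal
        borel_measurable_const borel_measurable_indicator) auto
  also have "\<dots> = (\<integral>\<^sup>+Q. ennreal (D * (9 / 4) ^ CARD('n) * snd Q powr (real CARD('n) - d)) * F Q \<partial>count_space V)"
  proof (intro nn_integral_cong)
    fix Q assume "Q \<in> space (count_space V)"
    then have r: "0 < snd Q" using W_pos by (auto simp: V_def)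
    have "(\<integral>\<^sup>+y\<in>cube (fst Q) (9 / 8 * snd Q). (ennreal (D * snd Q powr - d) * F Q) \<partial>lebesgue) =
        (ennreal (D * snd Q powr - d) * F Q) * ennreal ((2 * (9 / 8 * snd Q)) ^ CARD('n))"
    proof -
      have "emeasure lebesgue (cube (fst Q) (9 / 8 * snd Q)) = ennreal ((2 * (9 / 8 * snd Q)) ^ CARD('n))"
        using r by (intro emeasure_cube) auto
      moreover have "(\<integral>\<^sup>+y\<in>cube (fst Q) (9 / 8 * snd Q). (ennreal (D * snd Q powr - d) * F Q) \<partial>lebesgue) =
          (ennreal (D * snd Q powr - d) * F Q) * emeasure lebesgue (cube (fst Q) (9 / 8 * snd Q))"
        by (intro nn_integral_cmult_indicator) auto
      ultimately show ?thesis by (simp only:)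
    qed
    also have "\<dots> = ennreal (D * snd Q powr - d * (2 * (9 / 8 * snd Q)) ^ CARD('n)) * F Q"
      using D r by (simp add: ennreal_mult mult_ac)
    also have "D * snd Q powr - d * (2 * (9 / 8 * snd Q)) ^ CARD('n) = D * (9 / 4) ^ CARD('n) * snd Q powr (real CARD('n) - d)"
      using r by (simp add: powr_diff powr_minus powr_realpow power_mult_distrib power_divide field_simps)
    finally show "(\<integral>\<^sup>+y\<in>cube (fst Q) (9 / 8 * snd Q). (ennreal (D * snd Q powr - d) * F Q) \<partial>lebesgue) =
      ennreal (D * (9 / 4) ^ CARD('n) * snd Q powr (real CARD('n) - d)) * F Q" .
  qed
  also have "\<dots> = (\<integral>\<^sup>+Q. \<integral>\<^sup>+y. (ennreal (D * (9 / 4) ^ CARD('n) * snd Q powr (real CARD('n) - d)) *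
      (ennreal (\<bar>f y - P y\<bar> powr v) * indicator (cube (a Q) (snd Q / 2)) y)) \<partial>N \<partial>count_space V)"
    unfolding F_def err_def
    by (intro nn_integral_cong nn_integral_cmult[symmetric] borel_measurable_times_ennreal powr_measurable[OF P] indicator_cube_measurable)
  also have "\<dots> = (\<integral>\<^sup>+y. \<integral>\<^sup>+Q. (ennreal (D * (9 / 4) ^ CARD('n) * snd Q powr (real CARD('n) - d)) *
      (ennreal (\<bar>f y - P y\<bar> powr v) * indicator (cube (a Q) (snd Q / 2)) y)) \<partial>count_space V \<partial>N)"
    by (intro nn_integral_count_space_nn_integral[symmetric] cV borel_measurable_times_ennreal powr_measurable[OF P] indicator_cube_measurable) auto
  also have "\<dots> \<le> (\<integral>\<^sup>+y. ennreal (near_const v * \<rho> powr (real CARD('n) - d)) *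
      (ennreal (\<bar>f y - P y\<bar> powr v) * indicator A' y) \<partial>N)"
  proof (intro nn_integral_mono)
    fix y
    let ?O = "11 * 265 ^ CARD('n) / (1 - (1 / 2) powr (real CARD('n) - d))"
    have n_d: "0 < real CARD('n) - d" using d_less by simp
    have O: "0 \<le> ?O" using half_powr_less_one by simp
    have "(\<integral>\<^sup>+Q. (ennreal (D * (9 / 4) ^ CARD('n) * snd Q powr (real CARD('n) - d)) *
        (ennreal (\<bar>f y - P y\<bar> powr v) * indicator (cube (a Q) (snd Q / 2)) y)) \<partial>count_space V) \<le>
      (\<integral>\<^sup>+Q. (ennreal (D * (9 / 4) ^ CARD('n)) * (ennreal (\<bar>f y - P y\<bar> powr v) * indicator A' y)) *
        (ennreal (snd Q powr (real CARD('n) - d)) * indicator (cube (a Q) (snd Q / 2)) y) \<partial>count_space V)"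
      using D by (intro nn_integral_mono) (auto simp: V_def indicator_def ennreal_mult mult_ac)
    also have "\<dots> = (ennreal (D * (9 / 4) ^ CARD('n)) * (ennreal (\<bar>f y - P y\<bar> powr v) * indicator A' y)) *
      (\<integral>\<^sup>+Q. (ennreal (snd Q powr (real CARD('n) - d)) * indicator (cube (a Q) (snd Q / 2)) y) \<partial>count_space V)"
      by (rule nn_integral_cmult) auto
    also have "\<dots> \<le> (ennreal (D * (9 / 4) ^ CARD('n)) * (ennreal (\<bar>f y - P y\<bar> powr v) * indicator A' y)) *
      ennreal (?O * \<rho> powr (real CARD('n) - d))"
    proof (intro mult_left_mono)
      have "(\<integral>\<^sup>+Q. (ennreal (snd Q powr (real CARD('n) - d)) * indicator (cube (a Q) (snd Q / 2)) y) \<partial>count_space V)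
        \<le> (\<integral>\<^sup>+Q. (ennreal (snd Q powr (real CARD('n) - d)) * indicator (cube (a Q) (snd Q / 2)) y) \<partial>count_space {Q\<in>W. snd Q \<le> \<rho>})"
        by (subst (1 2) nn_integral_count_space_indicator) (auto simp: V_def indicator_def intro!: nn_integral_mono)
      also have "\<dots> \<le> ennreal (?O * \<rho> powr (real CARD('n) - d))" by (rule overlap[OF n_d \<rho>])
      finally show "(\<integral>\<^sup>+Q. (ennreal (snd Q powr (real CARD('n) - d)) * indicator (cube (a Q) (snd Q / 2)) y) \<partial>count_space V)
        \<le> ennreal (?O * \<rho> powr (real CARD('n) - d))" .
    qed auto
    also have "\<dots> = ennreal (D * (9 / 4) ^ CARD('n) * (?O * \<rho> powr (real CARD('n) - d))) *
        (ennreal (\<bar>f y - P y\<bar> powr v) * indicator A' y)"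
      using D by (subst ennreal_mult'[of "D * (9 / 4) ^ CARD('n)"]) (simp, simp only: mult_ac)
    also have "\<dots> \<le> ennreal (near_const v * \<rho> powr (real CARD('n) - d)) *
        (ennreal (\<bar>f y - P y\<bar> powr v) * indicator A' y)"
    proof (intro mult_right_mono ennreal_leI)
      have "(2 :: real) powr d \<le> 2 powr real CARD('n)" using d_less by (intro powr_mono) auto
      then have "2 powr d * (9 / 4) ^ CARD('n) \<le> (2 :: real) ^ CARD('n) * (9 / 4) ^ CARD('n)"
        by (intro mult_right_mono) (auto simp: powr_realpow)
      also have "\<dots> = (9 / 2) ^ CARD('n)" by (simp add: power_mult_distrib[symmetric])
      also have "\<dots> \<le> 9 ^ CARD('n)" by (intro power_mono) auto
      finally have *: "2 powr d * (9 / 4) ^ CARD('n) \<le> (9 :: real) ^ CARD('n)" .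
      have "D * (9 / 4) ^ CARD('n) * (?O * \<rho> powr (real CARD('n) - d)) =
        ((sup_const * c2) powr v / c2) * (2 powr d * (9 / 4) ^ CARD('n)) * (?O * \<rho> powr (real CARD('n) - d))"
        by (simp add: D_def)
      also have "\<dots> \<le> ((sup_const * c2) powr v / c2) * 9 ^ CARD('n) * (?O * \<rho> powr (real CARD('n) - d))"
        using c2 by (intro mult_right_mono mult_left_mono * mult_nonneg_nonneg[OF O]) auto
      also have "\<dots> = near_const v * \<rho> powr (real CARD('n) - d)" by (simp add: near_const_def)
      finally show "D * (9 / 4) ^ CARD('n) * (?O * \<rho> powr (real CARD('n) - d)) \<le> near_const v * \<rho> powr (real CARD('n) - d)" .
    qed auto
    finally show "(\<integral>\<^sup>+Q. (ennreal (D * (9 / 4) ^ CARD('n) * snd Q powr (real CARD('n) - d)) *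
        (ennreal (\<bar>f y - P y\<bar> powr v) * indicator (cube (a Q) (snd Q / 2)) y)) \<partial>count_space V) \<le>
      ennreal (near_const v * \<rho> powr (real CARD('n) - d)) * (ennreal (\<bar>f y - P y\<bar> powr v) * indicator A' y)" .
  qed
  also have "\<dots> = ennreal (near_const v * \<rho> powr (real CARD('n) - d)) * err v P A'"
    unfolding err_def using A'
    by (intro nn_integral_cmult borel_measurable_times_ennreal powr_measurable[OF P] measurable_N borel_measurable_indicator)
  finally show ?thesis .
qed

end

section \<open>The extension away from the set\<close>

text \<open>All orders up to k are carried together, because an affine factor combines the orders l
  and l - 1. For l = 0 the only competitor is zero, so the condition is a supremum bound.\<close>

definition approximable :: "nat \<Rightarrow> real ^ 'n::finite \<Rightarrow> real \<Rightarrow> real \<Rightarrow> real \<Rightarrow> (real ^ 'n \<Rightarrow> real) \<Rightarrow> bool" where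
  "approximable k x t \<tau> A g \<longleftrightarrow>
     (\<forall>l\<le>k. \<exists>T\<in>polys (int l - 1). \<forall>y\<in>cube x t. \<bar>g y - T y\<bar> \<le> A * \<tau> ^ l)"

lemma polys_neg: "P \<in> polys m \<Longrightarrow> m < 0 \<Longrightarrow> P = (\<lambda>x. 0)"
  by (auto simp: polys_def multi_indices_neg)

lemma approximable_mono: "approximable k x t \<tau> A g \<Longrightarrow> A \<le> A' \<Longrightarrow> 0 \<le> \<tau> \<Longrightarrow> approximable k x t \<tau> A' g"
  unfolding approximable_def by (meson mult_right_mono order_trans zero_le_power)

text \<open>With T of order l and U of order l - 1, the error splits as b (g - T) + e (y_i - x_i) (g
  - U). The small linear factor is at most \<open>B * \<tau>\<close> and restores the power of
  \<open>\<tau>\<close> missing in the second term.\<close>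

lemma approximable_mult_affine:
  fixes x :: "real ^ 'n::finite"
  assumes g: "approximable k x t \<tau> A g" and \<tau>: "0 \<le> \<tau>" "\<tau> \<le> 1" and A: "0 \<le> A"
    and b: "\<bar>b\<bar> \<le> B" and e: "\<bar>e\<bar> * t \<le> B * \<tau>"
  shows "approximable k x t \<tau> (2 * B * A) (\<lambda>y. g y * (b + e * (y $ i - x $ i)))"
  unfolding approximable_def
proof (intro allI impI)
  fix l assume l: "l \<le> k"
  have B: "0 \<le> B" using b by linarith
  have e': "\<bar>e * (y $ i - x $ i)\<bar> \<le> B * \<tau>" if "y \<in> cube x t" for y
  proof -
    have "\<bar>e\<bar> * \<bar>y $ i - x $ i\<bar> \<le> \<bar>e\<bar> * t" using that by (intro mult_left_mono) (auto simp: mem_cube_iff)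
    then show ?thesis using e by (simp add: abs_mult)
  qed
  show "\<exists>T\<in>polys (int l - 1). \<forall>y\<in>cube x t. \<bar>g y * (b + e * (y $ i - x $ i)) - T y\<bar> \<le> 2 * B * A * \<tau> ^ l"
  proof (cases l)
    case 0
    obtain T where T: "T \<in> polys (int 0 - 1)" "\<forall>y\<in>cube x t. \<bar>g y - T y\<bar> \<le> A * \<tau> ^ 0"
      using g l unfolding approximable_def by blast
    have "T = (\<lambda>y. 0)" using polys_neg[OF T(1)] by simp
    have "\<bar>g y * (b + e * (y $ i - x $ i))\<bar> \<le> 2 * B * A" if y: "y \<in> cube x t" for y
    proof -
      have "\<bar>g y\<bar> \<le> A" using T(2) y \<open>T = _\<close> by simp
      moreover have "\<bar>b + e * (y $ i - x $ i)\<bar> \<le> 2 * B"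
        using e'[OF y] b mult_left_mono[OF \<tau>(2) B] by linarith
      ultimately have "\<bar>g y\<bar> * \<bar>b + e * (y $ i - x $ i)\<bar> \<le> A * (2 * B)" using A by (intro mult_mono) auto
      then show ?thesis by (simp add: abs_mult mult_ac)
    qed
    then show ?thesis using 0 by (intro bexI[of _ "\<lambda>y. 0"]) (auto intro: polys_zero)
  next
    case (Suc l')
    obtain T where T: "T \<in> polys (int l - 1)" "\<forall>y\<in>cube x t. \<bar>g y - T y\<bar> \<le> A * \<tau> ^ l"
      using g l unfolding approximable_def by blast
    obtain U where U: "U \<in> polys (int l' - 1)" "\<forall>y\<in>cube x t. \<bar>g y - U y\<bar> \<le> A * \<tau> ^ l'"
      using g l Suc unfolding approximable_def by (meson Suc_leD)
    have "(\<lambda>y. U y * ((- e * x $ i) + e * y $ i)) \<in> polys (int l' - 1 + 1)"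
      by (intro polys_mult U polys_affine_coord)
    then have mem: "(\<lambda>y. b * T y + U y * ((- e * x $ i) + e * y $ i)) \<in> polys (int l - 1)"
      using Suc by (intro polys_add polys_scale T) simp
    have "\<bar>g y * (b + e * (y $ i - x $ i)) - (b * T y + U y * ((- e * x $ i) + e * y $ i))\<bar> \<le> 2 * B * A * \<tau> ^ l"
      if y: "y \<in> cube x t" for y
    proof -
      have "g y * (b + e * (y $ i - x $ i)) - (b * T y + U y * ((- e * x $ i) + e * y $ i)) =
          b * (g y - T y) + (e * (y $ i - x $ i)) * (g y - U y)" by (simp add: algebra_simps)
      also have "\<bar>\<dots>\<bar> \<le> \<bar>b\<bar> * \<bar>g y - T y\<bar> + \<bar>e * (y $ i - x $ i)\<bar> * \<bar>g y - U y\<bar>"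
        by (metis abs_mult abs_triangle_ineq)
      also have "\<dots> \<le> B * (A * \<tau> ^ l) + (B * \<tau>) * (A * \<tau> ^ l')"
        using b e'[OF y] T(2) U(2) y B \<tau> by (intro add_mono mult_mono) auto
      also have "\<dots> = 2 * B * A * \<tau> ^ l" using Suc by (simp add: mult_ac)
      finally show ?thesis .
    qed
    then show ?thesis by (intro bexI[OF _ mem] ballI)
  qed
qed

lemma approximable_mult_power:
  fixes x :: "real ^ 'n::finite"
  assumes "approximable k x t \<tau> A g" and \<tau>: "0 \<le> \<tau>" "\<tau> \<le> 1" and "0 \<le> A"
    and b: "\<bar>b\<bar> \<le> B" and e: "\<bar>e\<bar> * t \<le> B * \<tau>"
  shows "approximable k x t \<tau> ((2 * B) ^ j * A) (\<lambda>y. g y * (b + e * (y $ i - x $ i)) ^ j)"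
proof (induction j)
  case (Suc j)
  have "0 \<le> B" using b by linarith
  then show ?case
    using approximable_mult_affine[OF Suc \<tau> _ b e, of i] assms(4) by (simp add: mult_ac)
qed (use assms in simp)

lemma approximable_mult_prod:
  fixes x :: "real ^ 'n::finite"
  assumes "finite F" and g: "approximable k x t \<tau> A g" and \<tau>: "0 \<le> \<tau>" "\<tau> \<le> 1" and A: "0 \<le> A"
    and b: "\<And>i. \<bar>b i\<bar> \<le> B" and e: "\<bar>e\<bar> * t \<le> B * \<tau>"
  shows "approximable k x t \<tau> ((2 * B) ^ (\<Sum>i\<in>F. \<beta> i) * A) (\<lambda>y. g y * (\<Prod>i\<in>F. (b i + e * (y $ i - x $ i)) ^ \<beta> i))"
  using \<open>finite F\<close>
proof (induction F rule: finite_induct)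
  case (insert i F)
  have "0 \<le> B" using b[of i] by linarith
  then show ?case
    using approximable_mult_power[OF insert.IH \<tau> _ b e, where i = i and j = "\<beta> i"] insert.hyps A
    by (simp add: mult_ac power_add)
qed (use g in simp)

lemma approximable_sum:
  assumes "finite F" "\<And>Q. Q \<in> F \<Longrightarrow> approximable k x t \<tau> (A Q) (g Q)"
  shows "approximable k x t \<tau> (\<Sum>Q\<in>F. A Q) (\<lambda>y. \<Sum>Q\<in>F. g Q y)"
  using assms
proof (induction F rule: finite_induct)
  case empty
  then show ?case by (auto simp: approximable_def intro!: bexI[of _ "\<lambda>y. 0"] polys_zero)
next
  case (insert Q F)
  show ?case
    unfolding approximable_def
  proof (intro allI impI)
    fix l assume l: "l \<le> k"
    obtain T where T: "T \<in> polys (int l - 1)" "\<forall>y\<in>cube x t. \<bar>g Q y - T y\<bar> \<le> A Q * \<tau> ^ l"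
      using insert.prems[of Q] l unfolding approximable_def by blast
    obtain U where U: "U \<in> polys (int l - 1)" "\<forall>y\<in>cube x t. \<bar>(\<Sum>Q\<in>F. g Q y) - U y\<bar> \<le> (\<Sum>Q\<in>F. A Q) * \<tau> ^ l"
      using insert.IH insert.prems l unfolding approximable_def by blast
    have "\<bar>(\<Sum>Q\<in>insert Q F. g Q y) - (T y + U y)\<bar> \<le> (\<Sum>Q\<in>insert Q F. A Q) * \<tau> ^ l" if "y \<in> cube x t" for y
      using insert.hyps T(2)[rule_format, OF that] U(2)[rule_format, OF that] by (simp add: distrib_right)
    then show "\<exists>T\<in>polys (int l - 1). \<forall>y\<in>cube x t. \<bar>(\<Sum>Q\<in>insert Q F. g Q y) - T y\<bar> \<le> (\<Sum>Q\<in>insert Q F. A Q) * \<tau> ^ l"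
      by (intro bexI[OF _ polys_add[OF T(1) U(1)]] ballI)
  qed
qed

lemma approximable_scale:
  assumes "approximable k x t \<tau> A g" shows "approximable k x t \<tau> (\<bar>c\<bar> * A) (\<lambda>y. c * g y)"
  unfolding approximable_def
proof (intro allI impI)
  fix l assume "l \<le> k"
  then obtain T where T: "T \<in> polys (int l - 1)" "\<forall>y\<in>cube x t. \<bar>g y - T y\<bar> \<le> A * \<tau> ^ l"
    using assms unfolding approximable_def by blast
  have "\<bar>c * g y - c * T y\<bar> \<le> \<bar>c\<bar> * A * \<tau> ^ l" if "y \<in> cube x t" for y
  proof -
    have "\<bar>c * g y - c * T y\<bar> = \<bar>c\<bar> * \<bar>g y - T y\<bar>" 
      by (simp only: right_diff_distrib[symmetric] abs_mult)
    also have "\<dots> \<le> \<bar>c\<bar> * (A * \<tau> ^ l)" using T(2) that by (intro mult_left_mono) auto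
    finally show ?thesis by (simp add: mult.assoc)
  qed
  then show "\<exists>T\<in>polys (int l - 1). \<forall>y\<in>cube x t. \<bar>c * g y - T y\<bar> \<le> \<bar>c\<bar> * A * \<tau> ^ l"
    by (intro bexI[OF _ polys_scale[OF T(1), of c]] ballI)
qed

text \<open>Writing s (y - a) = s (x - a) + s (y - x) in each coordinate turns every monomial into a
  product of affine factors of the form treated above.\<close>

lemma approximable_mult_pol:
  fixes x a :: "real ^ 'n::finite"
  assumes g: "approximable k x t \<tau> A g" and \<tau>: "0 \<le> \<tau>" "\<tau> \<le> 1" and A: "0 \<le> A"
    and b: "\<And>i. \<bar>s * (x $ i - a $ i)\<bar> \<le> B" and e: "\<bar>s\<bar> * t \<le> B * \<tau>" and B: "1 \<le> B"
    and c: "\<And>\<beta>. \<beta> \<in> multi_indices m \<Longrightarrow> \<bar>c \<beta>\<bar> \<le> L"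
  shows "approximable k x t \<tau> (real (card (multi_indices m :: ('n \<Rightarrow> nat) set)) * (L * ((2 * B) ^ nat m * A)))
    (\<lambda>y. g y * pol m c (s *\<^sub>R (y - a)))"
proof -
  have "approximable k x t \<tau> (\<Sum>\<beta>\<in>(multi_indices m :: ('n \<Rightarrow> nat) set). L * ((2 * B) ^ nat m * A))
    (\<lambda>y. \<Sum>\<beta>\<in>multi_indices m. c \<beta> * (g y * (\<Prod>i\<in>UNIV. (s * (x $ i - a $ i) + s * (y $ i - x $ i)) ^ \<beta> i)))"
  proof (intro approximable_sum finite_multi_indices)
    fix \<beta> :: "'n \<Rightarrow> nat" assume \<beta>: "\<beta> \<in> multi_indices m"
    have 1: "approximable k x t \<tau> (\<bar>c \<beta>\<bar> * ((2 * B) ^ (\<Sum>i\<in>UNIV. \<beta> i) * A))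
        (\<lambda>y. c \<beta> * (g y * (\<Prod>i\<in>UNIV. (s * (x $ i - a $ i) + s * (y $ i - x $ i)) ^ \<beta> i)))"
      by (rule approximable_scale[OF approximable_mult_prod[OF finite_class.finite_UNIV g \<tau> A b e]])
    have "\<bar>c \<beta>\<bar> * ((2 * B) ^ (\<Sum>i\<in>UNIV. \<beta> i) * A) \<le> L * ((2 * B) ^ nat m * A)"
      using c[OF \<beta>] B A multi_indices_sum_le[OF \<beta>]
      by (intro mult_mono power_increasing) auto
    from approximable_mono[OF 1 this \<tau>(1)]
    show "approximable k x t \<tau> (L * ((2 * B) ^ nat m * A))
        (\<lambda>y. c \<beta> * (g y * (\<Prod>i\<in>UNIV. (s * (x $ i - a $ i) + s * (y $ i - x $ i)) ^ \<beta> i)))" .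
  qed
  moreover have "(\<Sum>\<beta>\<in>multi_indices m. c \<beta> * (g y * (\<Prod>i\<in>UNIV. (s * (x $ i - a $ i) + s * (y $ i - x $ i)) ^ \<beta> i)))
      = g y * pol m c (s *\<^sub>R (y - a))" for y
    by (simp add: pol_def pmon_def sum_distrib_left algebra_simps)
  ultimately show ?thesis by simp
qed

section \<open>Taylor expansion on a cube\<close>

lemma prod_list_diff_mem_polys:
  "(\<lambda>y. prod_list (map (\<lambda>i. y $ i - x $ i) is)) \<in> polys (int (length is))"
proof (induction "is")
  case Nil
  then show ?case by (simp add: polys_const)
next
  case (Cons i "is")
  have "(\<lambda>y. - x $ i + 1 * y $ i) \<in> polys 1" by (rule polys_affine_coord)
  from polys_mult[OF this Cons] show ?case by (simp add: algebra_simps)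
qed

lemma finite_lists_of_length: "finite {is :: 'n::finite list. length is = l}"
  using finite_lists_length_eq[of "UNIV :: 'n set" l] by simp

lemma card_lists_of_length: "card {is :: 'n::finite list. length is = l} = CARD('n) ^ l"
  using card_lists_length_eq[of "UNIV :: 'n set" l] by simp

lemma lists_of_length_Suc: "{is :: 'n list. length is = Suc l} = (\<lambda>(i, is). i # is) ` (UNIV \<times> {is. length is = l})"
  by (auto simp: length_Suc_conv image_iff)

lemma sum_lists_of_length_Suc:
  "(\<Sum>is | length is = Suc l. g is) = (\<Sum>is | length is = l. \<Sum>i\<in>UNIV. g (i # is))" for g :: "'n::finite list \<Rightarrow> real"
proof -
  have "(\<Sum>is | length is = Suc l. g is) = (\<Sum>(i, is)\<in>UNIV \<times> {is. length is = l}. g (i # is))"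
    unfolding lists_of_length_Suc by (subst sum.reindex) (auto simp: inj_on_def case_prod_unfold)
  also have "\<dots> = (\<Sum>i\<in>UNIV. \<Sum>is | length is = l. g (i # is))" by (simp add: sum.cartesian_product)
  finally show ?thesis by (subst (asm) sum.swap)
qed

lemma has_real_derivative_along_line:
  fixes F :: "real ^ 'n::finite \<Rightarrow> real"
  assumes "F differentiable (at (x + s *\<^sub>R v))"
  shows "((\<lambda>s. F (x + s *\<^sub>R v)) has_real_derivative (\<Sum>i\<in>UNIV. v $ i * partial_deriv i F (x + s *\<^sub>R v))) (at s)"
proof -
  let ?D = "frechet_derivative F (at (x + s *\<^sub>R v))"
  have D: "(F has_derivative ?D) (at (x + s *\<^sub>R v))" using assms frechet_derivative_works by blast
  have line: "((\<lambda>s. x + s *\<^sub>R v) has_derivative (\<lambda>h. h *\<^sub>R v)) (at s)"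
    by (auto intro!: derivative_eq_intros)
  have "((\<lambda>s. F (x + s *\<^sub>R v)) has_derivative (\<lambda>h. ?D (h *\<^sub>R v))) (at s)"
    using diff_chain_at[OF line D] by (simp add: o_def)
  moreover have lin: "linear ?D" using D has_derivative_linear by blast
  have "?D (h *\<^sub>R v) = (\<Sum>i\<in>UNIV. v $ i * partial_deriv i F (x + s *\<^sub>R v)) * h" for h
  proof -
    have "v = (\<Sum>i\<in>UNIV. v $ i *\<^sub>R axis i 1)" using basis_expansion[of v] by (simp add: scalar_mult_eq_scaleR)
    then have "?D v = ?D (\<Sum>i\<in>UNIV. v $ i *\<^sub>R axis i 1)" by simp
    also have "\<dots> = (\<Sum>i\<in>UNIV. v $ i * ?D (axis i 1))"
      using linear_sum[OF lin, of "\<lambda>i. v $ i *\<^sub>R axis i 1"] linear_scale[OF lin] by simp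
    finally show ?thesis using linear_scale[OF lin, of h v] by (simp add: partial_deriv_def)
  qed
  ultimately show ?thesis unfolding has_field_derivative_def by (simp add: mult_commute_abs)
qed

text \<open>The m-th derivative along the segment from x to y is a sum over direction lists of
  length m, each weighted by the product of the components of y - x. This matches
  \<open>partial_derivs\<close> and needs only one-variable Taylor; the n^l lists give the constant,
  and the factorial in the remainder is dropped.\<close>

lemma taylor_cube:
  fixes \<phi> :: "real ^ 'n::finite \<Rightarrow> real"
  assumes \<phi>: "C_infinity \<phi>" and M: "\<And>is y. length is = l \<Longrightarrow> \<bar>partial_derivs is \<phi> y\<bar> \<le> M" and t: "0 \<le> t"
  shows "\<exists>T\<in>polys (int l - 1). \<forall>y\<in>cube x t. \<bar>\<phi> y - T y\<bar> \<le> real CARD('n) ^ l * M * t ^ l"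
proof -
  define T where "T = (\<lambda>y. \<Sum>m<l. \<Sum>is | length is = m.
    (partial_derivs is \<phi> x / fact m) * prod_list (map (\<lambda>i. y $ i - x $ i) is))"
  have mem: "T \<in> polys (int l - 1)"
    unfolding T_def
  proof (intro polys_sum polys_scale)
    fix m and "is" :: "'n list" assume "m \<in> {..<l}" "is \<in> {is. length is = m}"
    then show "(\<lambda>y. prod_list (map (\<lambda>i. y $ i - x $ i) is)) \<in> polys (int l - 1)"
      by (intro polys_mono[OF _ prod_list_diff_mem_polys]) auto
  qed
  have "\<bar>\<phi> y - T y\<bar> \<le> real CARD('n) ^ l * M * t ^ l" if y: "y \<in> cube x t" for y
  proof -
    define v where "v = y - x"
    define D where "D m s = (\<Sum>is | length is = m. prod_list (map (\<lambda>i. v $ i) is) * partial_derivs is \<phi> (x + s *\<^sub>R v))"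
      for m s
    have der: "DERIV (D m) s :> D (Suc m) s" for m s
    proof -
      have "DERIV (D m) s :> (\<Sum>is | length is = m. prod_list (map (\<lambda>i. v $ i) is) *
          (\<Sum>i\<in>UNIV. v $ i * partial_deriv i (partial_derivs is \<phi>) (x + s *\<^sub>R v)))"
        unfolding D_def
        using \<phi> by (intro DERIV_sum DERIV_cmult has_real_derivative_along_line) (auto simp: C_infinity_def)
      also have "(\<Sum>is | length is = m. prod_list (map (\<lambda>i. v $ i) is) *
          (\<Sum>i\<in>UNIV. v $ i * partial_deriv i (partial_derivs is \<phi>) (x + s *\<^sub>R v))) = D (Suc m) s"
        unfolding D_def sum_lists_of_length_Suc
        by (simp add: partial_derivs_def sum_distrib_left mult_ac)
      finally show ?thesis .
    qed
    have D0: "D 0 = (\<lambda>s. \<phi> (x + s *\<^sub>R v))" by (simp add: D_def partial_derivs_def fun_eq_iff)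
    obtain \<xi> where \<xi>: "\<phi> (x + 1 *\<^sub>R v) = (\<Sum>m<l. D m 0 / fact m * 1 ^ m) + D l \<xi> / fact l * 1 ^ l"
      using Maclaurin2[of 1 D "\<lambda>s. \<phi> (x + s *\<^sub>R v)" l] D0 der by auto
    have "(\<Sum>m<l. D m 0 / fact m) = T y"
      by (simp add: D_def T_def v_def sum_divide_distrib mult_ac)
    then have "\<phi> y - T y = D l \<xi> / fact l" using \<xi> by (simp add: v_def)
    moreover have "\<bar>D l \<xi>\<bar> \<le> (\<Sum>is\<in>{is :: 'n list. length is = l}. t ^ l * M)" for \<xi>
    proof -
      have pl: "\<bar>prod_list (map (\<lambda>i. v $ i) is)\<bar> \<le> t ^ length is" for "is"
      proof (induction "is")
        case (Cons i "is")
        have "\<bar>v $ i\<bar> \<le> t" using y by (simp add: v_def mem_cube_iff)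
        then have "\<bar>v $ i\<bar> * \<bar>prod_list (map (\<lambda>i. v $ i) is)\<bar> \<le> t * t ^ length is"
          using Cons t by (intro mult_mono) auto
        then show ?case by (simp add: abs_mult)
      qed simp
      have "\<bar>D l \<xi>\<bar> \<le> (\<Sum>is | length is = l. \<bar>prod_list (map (\<lambda>i. v $ i) is) * partial_derivs is \<phi> (x + \<xi> *\<^sub>R v)\<bar>)"
        unfolding D_def by (rule sum_abs)
      also have "\<dots> \<le> (\<Sum>is\<in>{is :: 'n list. length is = l}. t ^ l * M)"
      proof (intro sum_mono)
        fix "is" :: "'n list" assume "is \<in> {is. length is = l}"
        then show "\<bar>prod_list (map (\<lambda>i. v $ i) is) * partial_derivs is \<phi> (x + \<xi> *\<^sub>R v)\<bar> \<le> t ^ l * M"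
          unfolding abs_mult using pl[of "is"] M[of "is"] t by (intro mult_mono) auto
      qed
      finally show ?thesis .
    qed
    then have "\<bar>D l \<xi>\<bar> \<le> real CARD('n) ^ l * M * t ^ l" by (simp add: card_lists_of_length mult_ac)
    moreover have "\<bar>D l \<xi> / fact l\<bar> \<le> \<bar>D l \<xi>\<bar>"
      using fact_ge_1[of l, where 'a = real] by (simp add: abs_divide divide_le_eq mult_le_cancel_left1)
    ultimately show ?thesis by linarith
  qed
  then show ?thesis by (intro bexI[OF _ mem] ballI)
qed

text \<open>A sum in place of a maximum over the finitely many orders up to k; the summand 1 makes
  it at least 1, which covers the bound on \<open>\<phi> Q\<close> itself.\<close>

definition deriv_const :: "nat \<Rightarrow> (('n::finite \<Rightarrow> nat) \<Rightarrow> real) \<Rightarrow> real" where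
  "deriv_const k C = 1 + (\<Sum>l\<le>k. \<Sum>is | length is = l. \<bar>C (count_list is)\<bar>)"

lemma deriv_const_ge_1: "1 \<le> deriv_const k C"
  by (simp add: deriv_const_def sum_nonneg)

lemma deriv_const_ge: "length is \<le> k \<Longrightarrow> \<bar>C (count_list is)\<bar> \<le> deriv_const k C"
proof -
  assume l: "length is \<le> k"
  have "\<bar>C (count_list is)\<bar> \<le> (\<Sum>is' | length is' = length is. \<bar>C (count_list is')\<bar>)"
    by (rule member_le_sum[of "is" _ "\<lambda>is'. \<bar>C (count_list is')\<bar>"]) (auto simp: finite_lists_of_length)
  also have "\<dots> \<le> (\<Sum>l\<le>k. \<Sum>is' | length is' = l. \<bar>C (count_list is')\<bar>)"
    using l by (intro member_le_sum[of "length is" _ "\<lambda>l. \<Sum>is' | length is' = l. \<bar>C (count_list is')\<bar>"])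
      (auto intro: sum_nonneg)
  finally show ?thesis by (simp add: deriv_const_def)
qed

text \<open>A size of at least \<delta>/24 turns the factor (diam Q)^(-l) of the derivative bound
  into at most (12/\<delta>)^l, and Taylor's remainder supplies t^l.\<close>

lemma (in whitney) approximable_partition:
  assumes wp: "whitney_partition C S W \<phi>" and Q: "Q \<in> W" and \<delta>: "0 < \<delta>" "\<delta> / 24 \<le> snd Q" and t: "0 < t" "t \<le> \<delta>"
  shows "approximable k x t (t / \<delta>) ((12 * real CARD('n)) ^ k * deriv_const k C) (\<phi> Q)"
  unfolding approximable_def
proof (intro allI impI)
  fix l assume l: "l \<le> k"
  have r: "0 < snd Q" by (rule W_pos[OF Q])
  have n1: "1 \<le> real CARD('n)" by (simp add: Suc_le_eq)
  have A1: "1 \<le> (12 * real CARD('n)) ^ k * deriv_const k C"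
    using mult_mono[OF one_le_power[of "12 * real CARD('n)" k] deriv_const_ge_1[of k C]] n1 by simp
  show "\<exists>T\<in>polys (int l - 1). \<forall>y\<in>cube x t. \<bar>\<phi> Q y - T y\<bar> \<le> (12 * real CARD('n)) ^ k * deriv_const k C * (t / \<delta>) ^ l"
  proof (cases "l = 0")
    case True
    have "\<bar>\<phi> Q y\<bar> \<le> 1" for y using wp Q by (auto simp: whitney_partition_def)
    then have "\<bar>\<phi> Q y\<bar> \<le> (12 * real CARD('n)) ^ k * deriv_const k C" for y using A1 order_trans by blast
    then show ?thesis using True by (intro bexI[of _ "\<lambda>y. 0"]) (auto intro: polys_zero)
  next
    case False
    have smooth: "C_infinity (\<phi> Q)" using wp Q by (auto simp: whitney_partition_def)
    have bound: "\<bar>partial_derivs is (\<phi> Q) y\<bar> \<le> deriv_const k C * (12 / \<delta>) ^ l" if "length is = l" for "is" y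
    proof -
      have "\<bar>partial_derivs is (\<phi> Q) y\<bar> \<le> C (count_list is) / sup_diam (cube_of Q) ^ length is"
        using wp Q by (auto simp: whitney_partition_def)
      also have "\<dots> = C (count_list is) * (1 / (2 * snd Q)) ^ l"
        using r that by (simp add: sup_diam_cube power_divide)
      also have "\<dots> \<le> deriv_const k C * (12 / \<delta>) ^ l"
      proof (intro mult_mono power_mono)
        show "C (count_list is) \<le> deriv_const k C" using deriv_const_ge[of "is" k C] that l by auto
        show "1 / (2 * snd Q) \<le> 12 / \<delta>" using \<delta> r by (simp add: field_simps)
      qed (use r deriv_const_ge_1[of k C] in auto)
      finally show ?thesis .
    qed
    obtain T where T: "T \<in> polys (int l - 1)"
      "\<forall>y\<in>cube x t. \<bar>\<phi> Q y - T y\<bar> \<le> real CARD('n) ^ l * (deriv_const k C * (12 / \<delta>) ^ l) * t ^ l"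
      using taylor_cube[OF smooth bound, of l t x] t by auto
    have "real CARD('n) ^ l * (deriv_const k C * (12 / \<delta>) ^ l) * t ^ l =
        (12 * real CARD('n)) ^ l * deriv_const k C * (t / \<delta>) ^ l"
      by (simp add: power_mult_distrib power_divide mult_ac)
    also have "\<dots> \<le> (12 * real CARD('n)) ^ k * deriv_const k C * (t / \<delta>) ^ l"
      using n1 l t \<delta> deriv_const_ge_1[of k C] by (intro mult_right_mono power_increasing) (simp, linarith, auto)
    finally have "\<forall>y\<in>cube x t. \<bar>\<phi> Q y - T y\<bar> \<le> (12 * real CARD('n)) ^ k * deriv_const k C * (t / \<delta>) ^ l"
      using T(2) by force
    then show ?thesis by (intro bexI[OF _ T(1)])
  qed
qed

section \<open>The extension on a cube that keeps its distance from the set\<close>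

context whitney_extension begin

text \<open>The first factor counts the cubes involved, \<open>48 powr d\<close> comes from radii of
  at least \<delta>/48, and 96 is \<open>2 * B\<close> of \<open>approximable_mult_pol\<close> for B
  = 48.\<close>

definition far_const :: real where
  "far_const = 11 * 265 ^ CARD('n) * (real (card (multi_indices (int k - 1) :: ('n \<Rightarrow> nat) set)) *
     (Cp * 48 powr d * (96 ^ k * ((12 * real CARD('n)) ^ k * deriv_const k C))))"

lemma far_const_pos: "0 < far_const"
proof -
  have "(multi_indices (int k - 1) :: ('n \<Rightarrow> nat) set) \<noteq> {}"
    using zero_mem_multi_indices[of "int k - 1"] k by auto
  then have "0 < card (multi_indices (int k - 1) :: ('n \<Rightarrow> nat) set)" by (simp add: card_gt_0_iff)
  moreover have "0 < deriv_const k C" using deriv_const_ge_1[of k C] by linarith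
  ultimately show ?thesis unfolding far_const_def using Cp by (intro mult_pos_pos) auto
qed

text \<open>One finite family \<open>F\<close> of Whitney cubes of size comparable to
  \<open>\<delta>\<close> serves all points of \<open>cube x t\<close>. So \<open>ext - P\<close> is
  a single finite sum of cutoffs times polynomials with small coefficients. By \<open>P0\<close>,
  either P is zero, and truncated cubes contribute zero, or all cubes in \<open>F\<close> are too
  small to be truncated.\<close>

theorem ext_far:
  assumes P: "P \<in> polys (int k - 1)" and \<delta>: "\<delta> = sdist S x" and t: "0 < t" "t \<le> \<delta> / 2"
    and P0: "P = (\<lambda>x. 0) \<or> \<delta> \<le> 1000"
  shows "\<exists>T\<in>polys (int k - 1). \<forall>y\<in>cube x t. ennreal \<bar>ext y - T y\<bar> \<le>
    ennreal (far_const * (t / \<delta>) ^ k * \<delta> powr - d) * err 1 P (cube x (27 * \<delta>))"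
proof (cases "err 1 P (cube x (27 * \<delta>)) = \<infinity>")
  case True
  have "0 < far_const * (t / \<delta>) ^ k * \<delta> powr - d" using far_const_pos t by auto
  then have "ennreal (far_const * (t / \<delta>) ^ k * \<delta> powr - d) * \<infinity> = \<infinity>"
  proof -
    assume "0 < far_const * (t / \<delta>) ^ k * \<delta> powr - d"
    then have "ennreal (far_const * (t / \<delta>) ^ k * \<delta> powr - d) \<noteq> 0" by (simp only: ennreal_eq_0_iff not_le)
    then show ?thesis by (simp only: ennreal_mult_eq_top_iff infinity_ennreal_def) blast
  qed
  then show ?thesis using True by (intro bexI[of _ "\<lambda>x. 0"] polys_zero) auto
next
  case False
  then obtain E where E: "0 \<le> E" "err 1 P (cube x (27 * \<delta>)) = ennreal E" by (metis ennreal_cases infinity_ennreal_def)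
  define \<tau> where "\<tau> = t / \<delta>"
  have \<delta>0: "0 < \<delta>" using t by linarith
  have \<tau>: "0 \<le> \<tau>" "\<tau> \<le> 1" using t \<delta>0 by (auto simp: \<tau>_def)
  define F where "F = {Q\<in>W. \<exists>y\<in>cube x t. Q \<in> touching y}"
  \<comment> \<open>Points of \<open>cube x t\<close> have distance between \<delta>/2 and
    3\<delta>/2 from S. So 15/8 \<open>snd Q\<close> is at most 3\<delta>/2, and \<delta>/2 is at
    most 12 \<open>snd Q\<close>; in particular t \<le> 12 \<open>snd Q\<close>, which doubles 12 to
    24 in the last bound.\<close>
  have F: "Q \<in> W" "\<delta> / 24 \<le> snd Q" "snd Q \<le> \<delta>" "infnorm (fst Q - x) \<le> 11 * \<delta>" "infnorm (x - a Q) \<le> 24 * snd Q"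
    if QF: "Q \<in> F" for Q
  proof -
    obtain y where y: "infnorm (x - y) \<le> t" "y \<in> cube (fst Q) (9 / 8 * snd Q)" and Q: "Q \<in> W"
      using QF by (auto simp: F_def touching_def mem_cube_infnorm)
    note ex = expanded_cube[OF Q y(2)]
    have 1: "sdist S y \<le> \<delta> + t"
      using sdist_triangle[OF S_ne, of y x] y(1) by (simp add: \<delta> infnorm_sub)
    have 2: "\<delta> \<le> sdist S y + t" using sdist_triangle[OF S_ne, of x y] y(1) by (simp add: \<delta>)
    show "Q \<in> W" by (rule Q)
    show r1: "\<delta> / 24 \<le> snd Q" using ex(3) 2 t by linarith
    show r2: "snd Q \<le> \<delta>" using ex(1) 1 t by linarith
    show "infnorm (fst Q - x) \<le> 11 * \<delta>"
      using infnorm_triangle3[of "fst Q" x y] y r2 t by (simp add: mem_cube_infnorm infnorm_sub)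
    show "infnorm (x - a Q) \<le> 24 * snd Q"
      using infnorm_triangle3[of x "a Q" y] y(1) ex(2) r1 t by linarith
  qed
  let ?D = "{Q :: 'n qube. dyadic Q \<and> \<delta> / 24 \<le> snd Q \<and> snd Q \<le> \<delta> \<and> infnorm (fst Q - x) \<le> 11 * \<delta>}"
  have FD: "F \<subseteq> ?D" using F W_dyadic by auto
  have finF: "finite F" using FD finite_dyadic_near(1)[OF \<delta>0] by (rule finite_subset)
  have cardF: "real (card F) \<le> 11 * 265 ^ CARD('n)"
  proof -
    have "card F \<le> 11 * 265 ^ CARD('n)"
      using card_mono[OF finite_dyadic_near(1)[OF \<delta>0] FD] finite_dyadic_near(2)[OF \<delta>0, of x] by linarith
    then have "real (card F) \<le> real (11 * 265 ^ CARD('n))" by (simp only: of_nat_le_iff)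
    then show ?thesis by simp
  qed
  have eq: "ext y - P y = (\<Sum>Q\<in>F. \<phi> Q y * (local_poly Q y - P y))" if y: "y \<in> cube x t" for y
  proof -
    have "sdist S x \<le> sdist S y + t" using sdist_triangle[OF S_ne, of x y] y by (simp add: mem_cube_infnorm)
    then have "0 < sdist S y" using t \<delta> by linarith
    then have "y \<notin> S" using sdist_le[of y S y] by (auto simp: infnorm_0)
    have "(\<Sum>Q\<in>touching y. \<phi> Q y * (local_poly Q y - P y)) = (\<Sum>Q\<in>F. \<phi> Q y * (local_poly Q y - P y))"
      using y finF phi_eq_0[OF wp]
      by (intro sum.mono_neutral_left) (auto simp: F_def touching_def)
    then show ?thesis using ext_diff[OF \<open>y \<notin> S\<close>] by simp
  qed
  define A where "A = (12 * real CARD('n)) ^ k * deriv_const k C"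
  have A: "0 \<le> A" using deriv_const_ge_1[of k C] by (simp add: A_def)
  define B where "B = real (card (multi_indices (int k - 1) :: ('n \<Rightarrow> nat) set)) *
     (Cp * 48 powr d * (96 ^ k * A)) * \<delta> powr - d * E"
  have B: "0 \<le> B" using Cp A E by (simp add: B_def)
  have each: "approximable k x t \<tau> B (\<lambda>y. \<phi> Q y * (local_poly Q y - P y))" if QF: "Q \<in> F" for Q
  proof (cases "snd Q \<le> 8000")
    case True
    note FQ = F[OF QF]
    have r: "0 < snd Q" by (rule W_pos[OF FQ(1)])
    from local_poly_error[OF FQ(1) True P] obtain c I where I: "0 \<le> I"
      "ennreal I = (\<integral>\<^sup>+y\<in>cube (a Q) (snd Q / 2). ennreal \<bar>f y - P y\<bar> \<partial>N)"
      and c1: "\<forall>y. local_poly Q y - P y = pol (int k - 1) c ((1 / (snd Q / 2)) *\<^sub>R (y - a Q))"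
      and c2': "\<forall>\<beta>\<in>multi_indices (int k - 1). \<bar>c \<beta>\<bar> \<le> Cp * (snd Q / 2) powr - d * I" by blast
    \<comment> \<open>The centre is within 24 \<delta> and the radius is at most \<delta>/2.\<close>
    have "cube (a Q) (snd Q / 2) \<subseteq> cube x (27 * \<delta>)" using FQ by (intro cube_mono) auto
    then have "ennreal I \<le> ennreal E"
      unfolding I E(2)[symmetric] err_def
      by (intro nn_integral_mono mult_mono ennreal_leI) (auto simp: indicator_def)
    then have IE: "I \<le> E" using E(1) by simp
    have rd: "(snd Q / 2) powr - d \<le> 48 powr d * \<delta> powr - d"
    proof -
      have "(snd Q / 2) powr - d \<le> (\<delta> / 48) powr - d"
        using FQ \<delta>0 d_nonneg by (intro powr_mono2') auto
      also have "\<dots> = 48 powr d * \<delta> powr - d" using \<delta>0 by (simp add: powr_divide powr_minus field_simps)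
      finally show ?thesis .
    qed
    have "approximable k x t \<tau> (real (card (multi_indices (int k - 1) :: ('n \<Rightarrow> nat) set)) *
        ((Cp * (48 powr d * \<delta> powr - d) * E) * ((2 * 48) ^ nat (int k - 1) * A)))
      (\<lambda>y. \<phi> Q y * pol (int k - 1) c ((1 / (snd Q / 2)) *\<^sub>R (y - a Q)))"
    proof (rule approximable_mult_pol[OF _ \<tau> A])
      show "approximable k x t \<tau> A (\<phi> Q)"
        unfolding \<tau>_def A_def using FQ t \<delta>0 by (intro approximable_partition[OF wp]) auto
      fix i
      have "\<bar>x $ i - a Q $ i\<bar> \<le> 24 * snd Q"
        using component_le_infnorm_cart[of "x - a Q" i] FQ(5) by simp
      then show "\<bar>1 / (snd Q / 2) * (x $ i - a Q $ i)\<bar> \<le> 48" using r by (simp add: abs_mult field_simps)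
    next
      have "t * \<delta> \<le> t * (24 * snd Q)" using FQ(2) t by (intro mult_left_mono) auto
      then show "\<bar>1 / (snd Q / 2)\<bar> * t \<le> 48 * \<tau>" using r \<delta>0 by (simp add: \<tau>_def field_simps)
    next
      fix \<beta> :: "'n \<Rightarrow> nat" assume "\<beta> \<in> multi_indices (int k - 1)"
      then have "\<bar>c \<beta>\<bar> \<le> Cp * (snd Q / 2) powr - d * I" using c2' by blast
      also have "\<dots> \<le> Cp * (48 powr d * \<delta> powr - d) * E"
        using Cp I IE rd by (intro mult_mono) auto
      finally show "\<bar>c \<beta>\<bar> \<le> Cp * (48 powr d * \<delta> powr - d) * E" .
    qed auto
    then have "approximable k x t \<tau> B (\<lambda>y. \<phi> Q y * pol (int k - 1) c ((1 / (snd Q / 2)) *\<^sub>R (y - a Q)))"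
    proof (rule approximable_mono)
      have "(2 * 48 :: real) ^ nat (int k - 1) \<le> 96 ^ k" by (simp add: power_increasing)
      then have "real (card (multi_indices (int k - 1) :: ('n \<Rightarrow> nat) set)) *
          ((Cp * (48 powr d * \<delta> powr - d) * E) * ((2 * 48) ^ nat (int k - 1) * A)) \<le>
        real (card (multi_indices (int k - 1) :: ('n \<Rightarrow> nat) set)) *
          ((Cp * (48 powr d * \<delta> powr - d) * E) * (96 ^ k * A))"
        using Cp E A by (intro mult_left_mono mult_right_mono) auto
      then show "real (card (multi_indices (int k - 1) :: ('n \<Rightarrow> nat) set)) *
          ((Cp * (48 powr d * \<delta> powr - d) * E) * ((2 * 48) ^ nat (int k - 1) * A)) \<le> B"
        by (simp add: B_def mult_ac)
    qed (rule \<tau>)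
    then show ?thesis using c1 by simp
  next
    case False
    then have "P = (\<lambda>x. 0)" using P0 F(3)[OF QF] by auto
    then have "local_poly Q y - P y = 0" for y using False by (simp add: local_poly_def)
    then show ?thesis using B \<tau>
      by (auto simp: approximable_def intro!: bexI[of _ "\<lambda>y. 0"] polys_zero)
  qed
  have "approximable k x t \<tau> (\<Sum>Q\<in>F. B) (\<lambda>y. \<Sum>Q\<in>F. \<phi> Q y * (local_poly Q y - P y))"
    by (rule approximable_sum[OF finF each])
  then obtain T where T: "T \<in> polys (int k - 1)"
    "\<forall>y\<in>cube x t. \<bar>(\<Sum>Q\<in>F. \<phi> Q y * (local_poly Q y - P y)) - T y\<bar> \<le> (\<Sum>Q\<in>F. B) * \<tau> ^ k"
    unfolding approximable_def by blast
  \<comment> \<open>\<open>T\<close> approximates the difference \<open>ext - P\<close>, so the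
    competitor for the extension itself is \<open>P + T\<close>.\<close>
  have mem: "(\<lambda>y. P y + T y) \<in> polys (int k - 1)" by (rule polys_add[OF P T(1)])
  have "ennreal \<bar>ext y - (P y + T y)\<bar> \<le>
    ennreal (far_const * (t / \<delta>) ^ k * \<delta> powr - d) * err 1 P (cube x (27 * \<delta>))" if y: "y \<in> cube x t" for y
  proof -
    have "\<bar>ext y - (P y + T y)\<bar> = \<bar>(\<Sum>Q\<in>F. \<phi> Q y * (local_poly Q y - P y)) - T y\<bar>"
      using eq[OF y] by (simp add: algebra_simps)
    also have "\<dots> \<le> real (card F) * B * \<tau> ^ k" using T(2) y by simp
    also have "\<dots> \<le> (11 * 265 ^ CARD('n)) * B * \<tau> ^ k"
      using cardF B \<tau> by (intro mult_right_mono) auto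
    also have "\<dots> = (far_const * (t / \<delta>) ^ k * \<delta> powr - d) * E"
      by (simp add: B_def far_const_def A_def \<tau>_def mult_ac)
    finally show ?thesis
      using E far_const_pos t by (subst E(2), subst ennreal_mult[symmetric]) (auto intro!: ennreal_leI)
  qed
  then show ?thesis by (intro bexI[OF _ mem] ballI)
qed

end

section \<open>Pointwise bounds for the local approximation\<close>

lemma epowr_ennreal: "0 \<le> x \<Longrightarrow> epowr (ennreal x) a = ennreal (x powr a)"
  by (simp add: epowr_def)

lemma epowr_top [simp]: "epowr \<infinity> a = \<infinity>" "epowr top a = top"
  by (simp_all add: epowr_def)

lemma epowr_0 [simp]: "epowr 0 a = 0"
  by (simp add: epowr_def)

lemma epowr_1 [simp]: "epowr X 1 = X"
  by (cases X) (simp_all add: epowr_ennreal)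

lemma epowr_epowr: "0 < a \<Longrightarrow> 0 < b \<Longrightarrow> epowr (epowr X a) b = epowr X (a * b)"
  by (cases X) (simp_all add: epowr_ennreal powr_powr)

lemma epowr_cmult:
  assumes "0 < c" "0 < a" shows "epowr (ennreal c * X) a = ennreal (c powr a) * epowr X a"
proof (cases X)
  case (real x)
  then show ?thesis using assms by (simp add: ennreal_mult[symmetric] epowr_ennreal powr_mult)
next
  case top
  have "ennreal (c powr a) \<noteq> 0" "ennreal c \<noteq> 0" using assms by (auto simp: ennreal_eq_0_iff)
  then show ?thesis by (simp add: top ennreal_mult_top)
qed

lemma ennreal_mult_mult: "0 \<le> a \<Longrightarrow> ennreal a * (ennreal b * X) = ennreal (a * b) * X"
  by (simp add: ennreal_mult' mult.assoc)

lemma powr_cancel: "0 < x \<Longrightarrow> 0 < u \<Longrightarrow> (x powr u) powr (1 / u) = (x :: real)"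
  by (simp add: powr_powr)

text \<open>Transfers an estimate proved for each competitor polynomial on S to the infimum; a
  positive constant can be divided out and put back.\<close>

lemma le_mult_INF:
  fixes L :: ennreal
  assumes c: "0 < c" and le: "\<And>P. P \<in> A \<Longrightarrow> L \<le> ennreal c * F P"
  shows "L \<le> ennreal c * (INF P\<in>A. F P)"
proof -
  have inv: "ennreal (1 / c) * (ennreal c * X) = X" "ennreal c * (ennreal (1 / c) * X) = X" for X
    using c by (simp_all add: mult.assoc[symmetric] ennreal_mult[symmetric])
  have "ennreal (1 / c) * L \<le> (INF P\<in>A. F P)"
  proof (rule INF_greatest)
    fix P assume "P \<in> A"
    then have "ennreal (1 / c) * L \<le> ennreal (1 / c) * (ennreal c * F P)" by (intro mult_left_mono le) auto
    then show "ennreal (1 / c) * L \<le> F P" by (simp only: inv)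
  qed
  then have "ennreal c * (ennreal (1 / c) * L) \<le> ennreal c * (INF P\<in>A. F P)" by (intro mult_left_mono) auto
  then show ?thesis by (simp only: inv)
qed

lemma divide_cube_measure:
  assumes t: "0 < t" and le: "I \<le> ennreal c * Y" and c: "0 \<le> c"
  shows "I / emeasure lebesgue (cube (x :: real ^ 'n) t) \<le> ennreal (c / (2 * t) ^ CARD('n)) * Y"
proof -
  have "I / emeasure lebesgue (cube x t) \<le> (ennreal c * Y) / ennreal ((2 * t) ^ CARD('n))"
    using t unfolding emeasure_cube[OF less_imp_le[OF t]] by (intro divide_right_mono_ennreal le)
  also have "\<dots> = (ennreal c / ennreal ((2 * t) ^ CARD('n))) * Y"
    by (simp add: divide_ennreal_def mult_ac)
  also have "ennreal c / ennreal ((2 * t) ^ CARD('n)) = ennreal (c / (2 * t) ^ CARD('n))"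
    using t c by (intro divide_ennreal) auto
  finally show ?thesis .
qed

lemma best_approx_le:
  fixes g :: "real ^ 'n \<Rightarrow> real"
  assumes P: "P \<in> polys (int k - 1)" and t: "0 < t" and u: "0 < u" and c: "0 \<le> c"
    and le: "(\<integral>\<^sup>+y\<in>cube x t. ennreal (\<bar>g y - P y\<bar> powr u) \<partial>lebesgue) \<le> ennreal c * Y"
  shows "best_approx lebesgue k u g (cube x t) \<le> epowr (ennreal (c / (2 * t) ^ CARD('n)) * Y) (1 / u)"
  unfolding best_approx_def
  by (rule INF_lower2[OF P]) (use u in \<open>intro epowr_mono divide_cube_measure[OF t le c], simp\<close>)

lemma best_approx_le_sup:
  fixes g :: "real ^ 'n \<Rightarrow> real"
  assumes T: "T \<in> polys (int k - 1)" and t: "0 < t" and u: "0 < u"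
    and le: "\<And>y. y \<in> cube x t \<Longrightarrow> ennreal \<bar>g y - T y\<bar> \<le> Y"
  shows "best_approx lebesgue k u g (cube x t) \<le> Y"
proof (cases Y)
  case (real s)
  have "(\<integral>\<^sup>+y\<in>cube x t. ennreal (\<bar>g y - T y\<bar> powr u) \<partial>lebesgue) \<le>
      (\<integral>\<^sup>+y. ennreal (s powr u) * indicator (cube x t) y \<partial>lebesgue)"
  proof (intro nn_integral_mono)
    fix y
    have "y \<in> cube x t \<Longrightarrow> \<bar>g y - T y\<bar> \<le> s" using le[of y] real by simp
    then show "ennreal (\<bar>g y - T y\<bar> powr u) * indicator (cube x t) y \<le> ennreal (s powr u) * indicator (cube x t) y"
      using u by (auto simp: indicator_def intro!: ennreal_leI powr_mono2)
  qed
  also have "\<dots> = ennreal (s powr u) * emeasure lebesgue (cube x t)" by (rule nn_integral_cmult_indicator) simp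
  also have "\<dots> = ennreal ((2 * t) ^ CARD('n)) * ennreal (s powr u)"
    using t by (subst emeasure_cube) (simp_all add: mult.commute)
  finally have "best_approx lebesgue k u g (cube x t) \<le>
      epowr (ennreal ((2 * t) ^ CARD('n) / (2 * t) ^ CARD('n)) * ennreal (s powr u)) (1 / u)"
    using t by (intro best_approx_le[OF T t u]) auto
  also have "\<dots> = Y" using t u real by (simp add: epowr_ennreal powr_powr)
  finally show ?thesis .
qed auto

lemma sdist_nonpos: "y \<in> S \<Longrightarrow> sdist S y \<le> 0"
  using sdist_le[of y S y] by (simp add: infnorm_0)

context whitney_extension begin

text \<open>This is \<open>best_approx\<close> on S written with the restricted measure, so that the
  infimum runs over the same \<open>err\<close> terms that the extension estimates produce.\<close>

definition S_approx :: "real \<Rightarrow> real ^ 'n \<Rightarrow> real \<Rightarrow> ennreal" where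
  "S_approx u y r = (INF P\<in>polys (int k - 1). epowr (err u P (cube y r) / emeasure N (cube y r \<inter> S)) (1 / u))"

lemma err_mono: "A \<subseteq> B \<Longrightarrow> err v P A \<le> err v P B"
  unfolding err_def by (intro nn_integral_mono mult_left_mono) (auto simp: indicator_def)

text \<open>Multiplying and dividing by the measure of the cube is legitimate in
  \<open>ennreal\<close> because lower regularity makes it nonzero and upper regularity
  finite.\<close>

lemma err_le_average:
  assumes y: "y \<in> S" and r: "0 < r" "r \<le> R"
  shows "err v P (cube y r) \<le> ennreal (c2 * r powr d) * (err v P (cube y r) / emeasure N (cube y r \<inter> S))"
proof -
  let ?m = "emeasure N (cube y r \<inter> S)"
  have "0 < ennreal (c1 * r powr d)" using c1 r by (simp add: ennreal_less_zero_iff)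
  then have m: "?m \<noteq> 0" "?m \<noteq> top"
    using lower[OF y r] emeasure_cube_finite[OF r(2), of y] by (auto simp: less_top)
  have "err v P (cube y r) = ?m * (err v P (cube y r) / ?m)"
    using m by (simp add: ennreal_times_divide mult_divide_eq_ennreal mult.commute[of ?m])
  also have "\<dots> \<le> ennreal (c2 * r powr d) * (err v P (cube y r) / ?m)"
    by (intro mult_right_mono upper r) auto
  finally show ?thesis .
qed

text \<open>Every point of the cube is within 3t of S, so 15/8 \<open>snd Q\<close> \<le> 3t and
  \<open>snd Q\<close> \<le> 8t/5. The cube around \<open>a Q\<close> is then reached within t + 12
  * 8t/5 + 4t/5 = 21t \<le> 27t. For t \<le> 1000 no such Q is truncated.\<close>

lemma ext_near_ball:
  assumes P: "P \<in> polys (int k - 1)" and v: "1 \<le> v" and t: "0 < t" and x: "sdist S x \<le> 2 * t"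
    and P0: "P = (\<lambda>x. 0) \<or> t \<le> 1000"
  shows "(\<integral>\<^sup>+y\<in>cube x t. ennreal (\<bar>ext y - P y\<bar> powr v) \<partial>lebesgue) \<le>
    ennreal (near_const v * (2 * t) powr (real CARD('n) - d)) * err v P (cube x (27 * t))"
proof (rule ext_near[OF P v])
  fix Q y assume Q: "Q \<in> W" and y: "y \<in> cube x t" "y \<in> cube (fst Q) (9 / 8 * snd Q)"
  have xy: "infnorm (x - y) \<le> t" using y(1) by (simp add: mem_cube_infnorm)
  have "sdist S y \<le> 3 * t" using sdist_triangle[OF S_ne, of y x] xy x by (simp add: infnorm_sub)
  then have r: "15 / 8 * snd Q \<le> 3 * t" using expanded_cube(1)[OF Q y(2)] by linarith
  show "snd Q \<le> 2 * t \<and> cube (a Q) (snd Q / 2) \<subseteq> cube x (27 * t)"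
  proof
    show "snd Q \<le> 2 * t" using r t by linarith
    show "cube (a Q) (snd Q / 2) \<subseteq> cube x (27 * t)"
      using infnorm_triangle3[of x "a Q" y] xy expanded_cube(2)[OF Q y(2)] r t by (intro cube_mono) linarith
  qed
  show "P = (\<lambda>x. 0)" if "8000 < snd Q" using that r P0 by auto
qed (use t in auto)

text \<open>The cube of radius 27t around x lies within 4t + 27t of y; the radius 64t is shared with
  the far case. The powers of t cancel: (2t)^(n-d) from the extension and t^d from the measure on S
  match the volume (2t)^n.\<close>

lemma approx_near:
  assumes t: "0 < t" "t \<le> 1000" and u: "1 \<le> u" and x: "sdist S x \<le> 2 * t"
    and y: "y \<in> S" "infnorm (x - y) \<le> 4 * t"
  shows "best_approx lebesgue k u ext (cube x t) \<le>
    ennreal ((near_const u * c2 * 32 powr d) powr (1 / u)) * S_approx u y (64 * t)"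
  unfolding S_approx_def
proof (rule le_mult_INF)
  show "0 < (near_const u * c2 * 32 powr d) powr (1 / u)" using near_const_pos[of u] c2 by simp
  fix P :: "real ^ 'n \<Rightarrow> real" assume P: "P \<in> polys (int k - 1)"
  let ?X = "err u P (cube y (64 * t)) / emeasure N (cube y (64 * t) \<inter> S)"
  have nc: "0 \<le> near_const u * (2 * t) powr (real CARD('n) - d)" using near_const_pos[of u] by simp
  have "(\<integral>\<^sup>+y\<in>cube x t. ennreal (\<bar>ext y - P y\<bar> powr u) \<partial>lebesgue) \<le>
      ennreal (near_const u * (2 * t) powr (real CARD('n) - d)) * err u P (cube x (27 * t))"
    by (rule ext_near_ball[OF P u t(1) x]) (use t in auto)
  also have "\<dots> \<le> ennreal (near_const u * (2 * t) powr (real CARD('n) - d)) * err u P (cube y (64 * t))"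
    using y t by (intro mult_left_mono err_mono cube_mono) (auto simp: infnorm_sub)
  also have "\<dots> \<le> ennreal (near_const u * (2 * t) powr (real CARD('n) - d)) * (ennreal (c2 * (64 * t) powr d) * ?X)"
    using t R by (intro mult_left_mono err_le_average y) auto
  also have "\<dots> = ennreal (near_const u * (2 * t) powr (real CARD('n) - d) * (c2 * (64 * t) powr d)) * ?X"
    by (rule ennreal_mult_mult[OF nc])
  also have "near_const u * (2 * t) powr (real CARD('n) - d) * (c2 * (64 * t) powr d) =
      near_const u * c2 * 32 powr d * (2 * t) ^ CARD('n)"
  proof -
    have "(64 * t) powr d = (32 * (2 * t)) powr d" by simp
    also have "\<dots> = 32 powr d * (2 * t) powr d" using t by (subst powr_mult) auto
    finally have "(2 * t) powr (real CARD('n) - d) * (64 * t) powr d = 32 powr d * (2 * t) ^ CARD('n)"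
      using t by (simp add: powr_diff powr_realpow)
    then show ?thesis by (simp add: mult_ac)
  qed
  finally have le: "(\<integral>\<^sup>+y\<in>cube x t. ennreal (\<bar>ext y - P y\<bar> powr u) \<partial>lebesgue) \<le>
      ennreal (near_const u * c2 * 32 powr d * (2 * t) ^ CARD('n)) * ?X" .
  have "best_approx lebesgue k u ext (cube x t) \<le>
      epowr (ennreal (near_const u * c2 * 32 powr d * (2 * t) ^ CARD('n) / (2 * t) ^ CARD('n)) * ?X) (1 / u)"
    using u near_const_pos[of u] c2 t by (intro best_approx_le[OF P t(1) _ _ le]) auto
  also have "\<dots> = ennreal ((near_const u * c2 * 32 powr d) powr (1 / u)) * epowr ?X (1 / u)"
    using u near_const_pos[of u] c2 t by (subst epowr_cmult[symmetric]) auto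
  finally show "best_approx lebesgue k u ext (cube x t) \<le>
      ennreal ((near_const u * c2 * 32 powr d) powr (1 / u)) * epowr ?X (1 / u)" .
qed

lemma err_power_mean:
  assumes P: "P \<in> polys m" and r: "0 < r" "r \<le> R" and v: "0 < v" "v \<le> w" and fin: "err v P (cube x r) < \<infinity>"
  shows "epowr (err v P (cube x r)) (w / v) \<le> ennreal ((c2 * r powr d) powr (w / v - 1)) * err w P (cube x r)"
proof -
  let ?V = "c2 * r powr d"
  have V: "0 < ?V" using c2 r by simp
  obtain b where b: "0 \<le> b" "err v P (cube x r) = ennreal b" using fin by (metis ennreal_cases infinity_ennreal_def less_irrefl)
  have "ennreal ((b / ?V) powr (w / v)) \<le>
      ennreal (1 / ?V) * (\<integral>\<^sup>+y. ennreal ((\<bar>f y - P y\<bar> powr v) powr (w / v)) * indicator (cube x r) y \<partial>N)"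
  proof (rule nn_integral_powr_jensen)
    show "(\<lambda>y. \<bar>f y - P y\<bar> powr v) \<in> borel_measurable N" using diff_measurable[OF P] by measurable
    show "(\<integral>\<^sup>+y. indicator (cube x r) y \<partial>N) \<le> ennreal ?V"
      unfolding nn_integral_indicator_cube by (rule upper[OF r])
    show "ennreal b = (\<integral>\<^sup>+y\<in>cube x r. ennreal (\<bar>f y - P y\<bar> powr v) \<partial>N)"
      using b by (simp add: err_def)
  qed (use V b v indicator_cube_measurable in auto)
  also have "(\<integral>\<^sup>+y. ennreal ((\<bar>f y - P y\<bar> powr v) powr (w / v)) * indicator (cube x r) y \<partial>N) = err w P (cube x r)"
    using v by (simp add: err_def powr_powr)
  finally have *: "ennreal ((b / ?V) powr (w / v)) \<le> ennreal (1 / ?V) * err w P (cube x r)" .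
  have "epowr (err v P (cube x r)) (w / v) = ennreal (?V powr (w / v)) * ennreal ((b / ?V) powr (w / v))"
    using b c2 r by (simp add: epowr_ennreal ennreal_mult[symmetric] powr_divide)
  also have "\<dots> \<le> ennreal (?V powr (w / v)) * (ennreal (1 / ?V) * err w P (cube x r))"
    by (intro mult_left_mono *) auto
  also have "\<dots> = ennreal (?V powr (w / v) * (1 / ?V)) * err w P (cube x r)"
    by (subst ennreal_mult) (use V in \<open>auto simp: mult.assoc\<close>)
  also have "?V powr (w / v) * (1 / ?V) = ?V powr (w / v - 1)" using V by (simp add: powr_diff)
  finally show ?thesis .
qed

lemma err_1_finite:
  assumes P: "P \<in> polys (int k - 1)" and y: "y \<in> S" and r: "0 < r" "r \<le> R"
  shows "err 1 P (cube y r) < \<infinity>"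
proof -
  from proj[OF y r f f_loc[OF r(2)] P] obtain I
    where "ennreal I = (\<integral>\<^sup>+y'\<in>cube y r. ennreal \<bar>f y' - P y'\<bar> \<partial>N)" by blast
  then have "err 1 P (cube y r) = ennreal I" by (simp add: err_def)
  then show ?thesis by simp
qed

text \<open>\<open>\<rho>\<close> replaces the true distance up to a factor 2, and the enlarged cube
  needs radius 4\<rho> + 27 * 2\<rho> = 58\<rho> around y. \<open>ext_far\<close> leaves an error
  with exponent 1, raised to u by the power mean inequality; the gain (t/\<rho>)^k survives
  unchanged.\<close>

lemma approx_far:
  assumes t: "0 < t" "t \<le> \<rho> / 2" and \<rho>: "\<rho> \<le> sdist S x" "sdist S x \<le> 2 * \<rho>" "\<rho> \<le> 500" and u: "1 \<le> u"
    and y: "y \<in> S" "infnorm (x - y) \<le> 4 * \<rho>"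
  shows "best_approx lebesgue k u ext (cube x t) \<le>
    ennreal (far_const * c2 * 64 powr d * (t / \<rho>) ^ k) * S_approx u y (64 * \<rho>)"
  unfolding S_approx_def
proof (rule le_mult_INF)
  define \<delta> where "\<delta> = sdist S x"
  have \<rho>0: "0 < \<rho>" using t by linarith
  show "0 < far_const * c2 * 64 powr d * (t / \<rho>) ^ k" using far_const_pos c2 t \<rho>0 by simp
  fix P :: "real ^ 'n \<Rightarrow> real" assume P: "P \<in> polys (int k - 1)"
  let ?E = "err 1 P (cube y (64 * \<rho>))"
  let ?X = "err u P (cube y (64 * \<rho>)) / emeasure N (cube y (64 * \<rho>) \<inter> S)"
  let ?V = "c2 * (64 * \<rho>) powr d"
  have r: "0 < 64 * \<rho>" "64 * \<rho> \<le> R" using \<rho>0 \<rho> R by auto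
  have V: "0 < ?V" using c2 \<rho>0 by simp
  obtain T where T: "T \<in> polys (int k - 1)" "\<forall>z\<in>cube x t. ennreal \<bar>ext z - T z\<bar> \<le>
      ennreal (far_const * (t / \<delta>) ^ k * \<delta> powr - d) * err 1 P (cube x (27 * \<delta>))"
    using ext_far[OF P \<delta>_def t(1)] t \<rho> unfolding \<delta>_def by auto
  have "epowr ?E (u / 1) \<le> ennreal (?V powr (u / 1 - 1)) * err u P (cube y (64 * \<rho>))"
    using u by (intro err_power_mean[OF P r] err_1_finite[OF P y(1) r]) auto
  also have "\<dots> \<le> ennreal (?V powr (u / 1 - 1)) * (ennreal ?V * ?X)"
    by (intro mult_left_mono err_le_average[OF y(1) r]) auto
  also have "\<dots> = ennreal (?V powr u) * ?X"
    using V by (simp add: mult.assoc[symmetric] ennreal_mult[symmetric] powr_diff)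
  finally have "epowr (epowr ?E u) (1 / u) \<le> epowr (ennreal (?V powr u) * ?X) (1 / u)"
    using u by (intro epowr_mono) auto
  then have E: "?E \<le> ennreal ?V * epowr ?X (1 / u)"
    using u epowr_cmult[of "?V powr u" "1 / u" ?X] powr_cancel[OF V, of u] V c2 \<rho>0
    by (simp add: epowr_epowr)
  have "best_approx lebesgue k u ext (cube x t) \<le>
      ennreal (far_const * (t / \<delta>) ^ k * \<delta> powr - d) * err 1 P (cube x (27 * \<delta>))"
    using T t u by (intro best_approx_le_sup[OF T(1)]) auto
  also have "\<dots> \<le> ennreal (far_const * (t / \<rho>) ^ k * \<rho> powr - d) * ?E"
  proof (rule mult_mono[OF ennreal_leI])
    have 1: "(t / \<delta>) ^ k \<le> (t / \<rho>) ^ k"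
      using \<rho> \<rho>0 t by (intro power_mono) (auto simp: \<delta>_def intro!: divide_left_mono mult_pos_pos)
    have 2: "\<delta> powr - d \<le> \<rho> powr - d" using \<rho> \<rho>0 d_nonneg by (intro powr_mono2') (auto simp: \<delta>_def)
    show "far_const * (t / \<delta>) ^ k * \<delta> powr - d \<le> far_const * (t / \<rho>) ^ k * \<rho> powr - d"
      using far_const_pos t \<rho> \<rho>0 by (intro mult_mono 1 2 mult_left_mono) (auto simp: \<delta>_def)
    show "err 1 P (cube x (27 * \<delta>)) \<le> ?E"
      using y \<rho> \<rho>0 by (intro err_mono cube_mono) (auto simp: infnorm_sub \<delta>_def)
  qed auto
  also have "\<dots> \<le> ennreal (far_const * (t / \<rho>) ^ k * \<rho> powr - d) * (ennreal ?V * epowr ?X (1 / u))"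
    by (intro mult_left_mono E) auto
  also have "\<dots> = ennreal (far_const * (t / \<rho>) ^ k * \<rho> powr - d * ?V) * epowr ?X (1 / u)"
    using far_const_pos t \<rho>0 V by (simp add: ennreal_mult mult.assoc)
  also have "far_const * (t / \<rho>) ^ k * \<rho> powr - d * ?V = far_const * c2 * 64 powr d * (t / \<rho>) ^ k"
    using \<rho>0 by (simp add: powr_mult powr_minus field_simps)
  finally show "best_approx lebesgue k u ext (cube x t) \<le>
      ennreal (far_const * c2 * 64 powr d * (t / \<rho>) ^ k) * epowr ?X (1 / u)" .
qed

end

context whitney_extension begin

section \<open>Points far from the set and large cubes\<close>

lemma approx_zero:
  assumes x: "100000 \<le> sdist S x" and t: "0 < t" "t \<le> 1" and u: "1 \<le> u"
  shows "best_approx lebesgue k u ext (cube x t) = 0"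
proof -
  have "best_approx lebesgue k u ext (cube x t) \<le> 0"
  proof (rule best_approx_le_sup[OF polys_zero t(1)])
    fix y assume y: "y \<in> cube x t"
    have sy: "99999 \<le> sdist S y"
      using sdist_triangle[OF S_ne, of x y] y t x by (simp add: mem_cube_infnorm)
    then have "y \<notin> S" using sdist_nonpos[of y S] by auto
    moreover have "local_poly Q y = 0" if "Q \<in> touching y" for Q
    proof -
      have "sdist S y \<le> 12 * snd Q" using that expanded_cube(3)[of Q y] by (auto simp: touching_def)
      then show ?thesis using sy by (simp add: local_poly_def)
    qed
    ultimately have "ext y = 0" by (simp add: ext_def)
    then show "ennreal \<bar>ext y - 0\<bar> \<le> 0" by simp
  qed (use u in auto)
  then show ?thesis by simp
qed

text \<open>27 times the cutoff distance 100000.\<close>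

abbreviation big_radius :: real where "big_radius \<equiv> 2700000"

lemma big_radius: "0 < big_radius" "big_radius \<le> R"
  using R by auto

definition far_zero_const :: "real \<Rightarrow> real" where
  "far_zero_const p = (far_const * 32 ^ k * 32 powr d) powr p * (c2 * big_radius powr d) powr (p - 1)"

text \<open>Here the comparison polynomial is zero, so the error is the local norm of f. Distance at
  least 1/32 and t \<le> 1/64 meet the condition of \<open>ext_far\<close>, and the kept factor t^k
  is what beats the weight of the left side.\<close>

lemma approx_far_zero:
  assumes x: "1 / 32 \<le> sdist S x" "sdist S x \<le> 100000" and t: "0 < t" "t \<le> 1 / 64" and u: "1 \<le> u" and p: "1 \<le> p"
  shows "epowr (best_approx lebesgue k u ext (cube x t)) p \<le>
    ennreal (far_zero_const p * (t ^ k) powr p) * err p (\<lambda>x. 0) (cube x big_radius)"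
proof -
  define \<delta> where "\<delta> = sdist S x"
  let ?z = "(\<lambda>x. 0) :: real ^ 'n \<Rightarrow> real"
  let ?A = "far_const * 32 ^ k * 32 powr d"
  have A: "0 < ?A" using far_const_pos by simp
  obtain T where T: "T \<in> polys (int k - 1)" "\<forall>y\<in>cube x t. ennreal \<bar>ext y - T y\<bar> \<le>
      ennreal (far_const * (t / \<delta>) ^ k * \<delta> powr - d) * err 1 ?z (cube x (27 * \<delta>))"
    using ext_far[OF polys_zero \<delta>_def t(1)] t x unfolding \<delta>_def by auto
  have "best_approx lebesgue k u ext (cube x t) \<le>
      ennreal (far_const * (t / \<delta>) ^ k * \<delta> powr - d) * err 1 ?z (cube x (27 * \<delta>))"
    using T t u by (intro best_approx_le_sup[OF T(1)]) auto
  also have "\<dots> \<le> ennreal (?A * t ^ k) * err 1 ?z (cube x big_radius)"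
  proof (rule mult_mono[OF ennreal_leI])
    have 1: "(t / \<delta>) ^ k \<le> (32 * t) ^ k"
      using x t by (intro power_mono) (auto simp: \<delta>_def field_simps)
    have 2: "\<delta> powr - d \<le> 32 powr d"
    proof -
      have "\<delta> powr - d \<le> (1 / 32) powr - d" using x d_nonneg by (intro powr_mono2') (auto simp: \<delta>_def)
      also have "\<dots> = 32 powr d" by (simp add: powr_divide powr_minus)
      finally show ?thesis .
    qed
    have "far_const * (t / \<delta>) ^ k * \<delta> powr - d \<le> far_const * (32 * t) ^ k * 32 powr d"
      using far_const_pos t x by (intro mult_mono 1 2 mult_left_mono) (auto simp: \<delta>_def)
    then show "far_const * (t / \<delta>) ^ k * \<delta> powr - d \<le> ?A * t ^ k" by (simp add: power_mult_distrib mult_ac)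
    show "err 1 ?z (cube x (27 * \<delta>)) \<le> err 1 ?z (cube x big_radius)"
      using x by (intro err_mono cube_mono) (auto simp: infnorm_0 \<delta>_def)
  qed auto
  finally have "epowr (best_approx lebesgue k u ext (cube x t)) p \<le>
      epowr (ennreal (?A * t ^ k) * err 1 ?z (cube x big_radius)) p"
    using p by (intro epowr_mono) auto
  also have "\<dots> = ennreal ((?A * t ^ k) powr p) * epowr (err 1 ?z (cube x big_radius)) (p / 1)"
    using A t p by (subst epowr_cmult) auto
  also have "\<dots> \<le> ennreal ((?A * t ^ k) powr p) *
      (ennreal ((c2 * big_radius powr d) powr (p / 1 - 1)) * err p ?z (cube x big_radius))"
    using p f_loc[OF big_radius(2)]
    by (intro mult_left_mono err_power_mean[OF polys_zero big_radius]) (auto simp: err_def)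
  also have "\<dots> = ennreal ((?A * t ^ k) powr p * (c2 * big_radius powr d) powr (p / 1 - 1)) * err p ?z (cube x big_radius)"
    by (rule ennreal_mult_mult) simp
  also have "(?A * t ^ k) powr p * (c2 * big_radius powr d) powr (p / 1 - 1) = far_zero_const p * (t ^ k) powr p"
    using A t far_const_pos by (simp add: far_zero_const_def powr_mult)
  finally show ?thesis .
qed

lemma err_finite:
  assumes "0 < u" "u \<le> p" and "err p (\<lambda>x. 0) UNIV < \<infinity>" and "r \<le> R"
  shows "err u (\<lambda>x. 0) (cube x r) < \<infinity>"
  using local_integral_finite[OF assms(1,2) f] assms(3,4) by (simp add: err_def)

definition small_const :: "real \<Rightarrow> real \<Rightarrow> real" where
  "small_const u p = (near_const u * 200000 powr (real CARD('n) - d) * 16 ^ CARD('n)) powr (p / u) *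
     (c2 * big_radius powr d) powr (p / u - 1) * (32 ^ k) powr p"

text \<open>No gain is available at these bounded scales. The factor t^k is inserted at the cost of
  32^k, using 32t \<ge> 1, so that both estimates by the local norm have the same shape.\<close>

lemma approx_small:
  assumes x: "sdist S x \<le> 100000" and t: "1 / 32 \<le> t" "t \<le> 1" and u: "1 \<le> u" "u \<le> p"
    and fin: "err p (\<lambda>x. 0) UNIV < \<infinity>"
  shows "epowr (best_approx lebesgue k u ext (cube x t)) p \<le>
    ennreal (small_const u p * (t ^ k) powr p) * err p (\<lambda>x. 0) (cube x big_radius)"
proof -
  let ?z = "(\<lambda>x. 0) :: real ^ 'n \<Rightarrow> real"
  let ?B = "near_const u * 200000 powr (real CARD('n) - d)"
  have B: "0 < ?B" using near_const_pos[of u] by simp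
  have t0: "0 < t" using t by linarith
  \<comment> \<open>The cube is enlarged to radius 100000 so that the distance of x is admissible
    for \<open>ext_near_ball\<close>.\<close>
  have "(\<integral>\<^sup>+y\<in>cube x t. ennreal (\<bar>ext y - 0\<bar> powr u) \<partial>lebesgue) \<le>
      (\<integral>\<^sup>+y\<in>cube x 100000. ennreal (\<bar>ext y - 0\<bar> powr u) \<partial>lebesgue)"
    using cube_mono[of x x t 100000] t by (intro nn_integral_mono) (auto simp: indicator_def infnorm_0)
  also have "\<dots> \<le> ennreal (near_const u * (2 * 100000) powr (real CARD('n) - d)) * err u ?z (cube x (27 * 100000))"
    using x by (intro ext_near_ball[OF polys_zero u(1)]) auto
  finally have "(\<integral>\<^sup>+y\<in>cube x t. ennreal (\<bar>ext y - 0\<bar> powr u) \<partial>lebesgue) \<le>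
      ennreal ?B * err u ?z (cube x big_radius)" by simp
  from best_approx_le[OF polys_zero t0 _ _ this]
  have "best_approx lebesgue k u ext (cube x t) \<le>
      epowr (ennreal (?B / (2 * t) ^ CARD('n)) * err u ?z (cube x big_radius)) (1 / u)"
    using u B by auto
  then have "epowr (best_approx lebesgue k u ext (cube x t)) p \<le>
      epowr (epowr (ennreal (?B / (2 * t) ^ CARD('n)) * err u ?z (cube x big_radius)) (1 / u)) p"
    using u by (intro epowr_mono) auto
  also have "\<dots> = epowr (ennreal (?B / (2 * t) ^ CARD('n)) * err u ?z (cube x big_radius)) (p / u)"
    using u by (subst epowr_epowr) auto
  also have "\<dots> \<le> epowr (ennreal (?B * 16 ^ CARD('n)) * err u ?z (cube x big_radius)) (p / u)"
  proof (intro epowr_mono mult_right_mono ennreal_leI)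
    have "(1 / (2 * t)) ^ CARD('n) \<le> 16 ^ CARD('n)"
      using t t0 by (intro power_mono) (auto simp: field_simps)
    then have "?B * (1 / (2 * t)) ^ CARD('n) \<le> ?B * 16 ^ CARD('n)" using B by (intro mult_left_mono) auto
    then show "?B / (2 * t) ^ CARD('n) \<le> ?B * 16 ^ CARD('n)" by (simp add: power_divide)
  qed (use u in auto)
  also have "\<dots> = ennreal ((?B * 16 ^ CARD('n)) powr (p / u)) * epowr (err u ?z (cube x big_radius)) (p / u)"
    using B u by (intro epowr_cmult) auto
  also have "\<dots> \<le> ennreal ((?B * 16 ^ CARD('n)) powr (p / u)) *
      (ennreal ((c2 * big_radius powr d) powr (p / u - 1)) * err p ?z (cube x big_radius))"
    using u fin big_radius
    by (intro mult_left_mono err_power_mean[OF polys_zero big_radius] err_finite[where p = p]) auto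
  also have "\<dots> = ennreal ((?B * 16 ^ CARD('n)) powr (p / u) * (c2 * big_radius powr d) powr (p / u - 1)) * err p ?z (cube x big_radius)"
    by (rule ennreal_mult_mult) simp
  also have "\<dots> \<le> ennreal (small_const u p * (t ^ k) powr p) * err p ?z (cube x big_radius)"
  proof (intro mult_right_mono ennreal_leI)
    have "1 ^ k \<le> (32 * t) ^ k" using t by (intro power_mono) auto
    then have "1 powr p \<le> (32 ^ k * t ^ k) powr p" using u by (intro powr_mono2) (auto simp: power_mult_distrib)
    then have one: "1 \<le> (32 ^ k) powr p * (t ^ k) powr p" using t0 by (simp add: powr_mult)
    have "(?B * 16 ^ CARD('n)) powr (p / u) * (c2 * big_radius powr d) powr (p / u - 1) * 1 \<le>
      (?B * 16 ^ CARD('n)) powr (p / u) * (c2 * big_radius powr d) powr (p / u - 1) * ((32 ^ k) powr p * (t ^ k) powr p)"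
      by (intro mult_left_mono one) auto
    then show "(?B * 16 ^ CARD('n)) powr (p / u) * (c2 * big_radius powr d) powr (p / u - 1) \<le>
        small_const u p * (t ^ k) powr p"
      by (simp add: small_const_def mult.assoc)
  qed auto
  finally show ?thesis .
qed

definition local_const :: "real \<Rightarrow> real" where
  "local_const u = (near_const u * c2 * 32 powr d) powr (1 / u) + far_const * c2 * 64 powr d"

lemma local_const_pos: "0 < local_const u"
  using near_const_pos[of u] far_const_pos c2 by (simp add: local_const_def add_pos_pos)

text \<open>Level \<open>i\<close> records the distance of x: either i = j and the cube is near S,
  or the distance lies between 2^-i and twice that. The radius 64 * 2^-i equals 2^-(i - 6), which is
  why levels start at 6.\<close>

lemma approx_active:
  fixes i j :: nat
  assumes ij: "6 \<le> i" "i \<le> j" and x: "sdist S x < 2 * (1 / 2) ^ i" "i = j \<or> (1 / 2) ^ i \<le> sdist S x"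
    and u: "1 \<le> u" and y: "y \<in> S" "infnorm (x - y) \<le> 4 * (1 / 2) ^ i"
  shows "best_approx lebesgue k u ext (cube x ((1 / 2) ^ j)) \<le>
    ennreal (local_const u * (1 / 2) ^ (k * (j - i))) * S_approx u y ((1 / 2) ^ (i - 6))"
proof -
  have h: "64 * (1 / 2) ^ i = (1 / 2 :: real) ^ (i - 6)"
  proof -
    have "(1 / 2 :: real) ^ i = (1 / 2) ^ (i - 6) * (1 / 2) ^ 6" using ij by (simp flip: power_add)
    then show ?thesis by (simp add: power_divide)
  qed
  have i1: "(1 / 2 :: real) ^ i \<le> 1" by (simp add: power_le_one)
  consider "i = j" | "i < j" "(1 / 2) ^ i \<le> sdist S x" using ij x by linarith
  then show ?thesis
  proof cases
    case 1
    have "best_approx lebesgue k u ext (cube x ((1 / 2) ^ j)) \<le>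
        ennreal ((near_const u * c2 * 32 powr d) powr (1 / u)) * S_approx u y (64 * (1 / 2) ^ j)"
      using x y u i1 1 by (intro approx_near) auto
    also have "\<dots> \<le> ennreal (local_const u * (1 / 2) ^ (k * (j - i))) * S_approx u y (64 * (1 / 2) ^ j)"
      using 1 far_const_pos c2 by (intro mult_right_mono ennreal_leI) (auto simp: local_const_def)
    finally show ?thesis using h 1 by simp
  next
    case 2
    have "(1 / 2 :: real) ^ j \<le> (1 / 2) ^ Suc i" using 2 by (intro power_decreasing) auto
    then have "best_approx lebesgue k u ext (cube x ((1 / 2) ^ j)) \<le>
        ennreal (far_const * c2 * 64 powr d * ((1 / 2) ^ j / (1 / 2) ^ i) ^ k) * S_approx u y (64 * (1 / 2) ^ i)"
      using x y u i1 2 by (intro approx_far) auto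
    also have "((1 / 2 :: real) ^ j / (1 / 2) ^ i) ^ k = (1 / 2) ^ (k * (j - i))"
      using ij by (simp add: power_diff[symmetric] power_mult[symmetric] mult.commute)
    also have "ennreal (far_const * c2 * 64 powr d * (1 / 2) ^ (k * (j - i))) * S_approx u y (64 * (1 / 2) ^ i)
        \<le> ennreal (local_const u * (1 / 2) ^ (k * (j - i))) * S_approx u y (64 * (1 / 2) ^ i)"
      by (intro mult_right_mono ennreal_leI) (auto simp: local_const_def)
    finally show ?thesis using h by simp
  qed
qed

text \<open>One sequence holds all of the right side: level 0 carries the global norm, levels 1 to 5
  are empty, and level i \<ge> 6 carries level i - 6 with the factor from
  \<open>discretize\<close>.\<close>

definition beta :: "real \<Rightarrow> real \<Rightarrow> nat \<Rightarrow> ennreal" where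
  "beta u p i = (if i = 0 then err p (\<lambda>x. 0) UNIV
     else if 6 \<le> i then ennreal (((1 / 2) ^ i) powr (real CARD('n) - d)) *
       (\<integral>\<^sup>+y. epowr (S_approx u y ((1 / 2) ^ (i - 6))) p \<partial>N)
     else 0)"

definition level_const :: "real \<Rightarrow> real \<Rightarrow> real" where
  "level_const u p = (local_const u) powr p * (18 ^ CARD('n) / c1) +
     (far_zero_const p + small_const u p) * (2 ^ CARD('n) * (2 * big_radius + 3) ^ CARD('n))"

lemma far_zero_const_nonneg: "0 \<le> far_zero_const p"
  by (simp add: far_zero_const_def)

lemma small_const_nonneg: "0 \<le> small_const u p"
  by (simp add: small_const_def)

lemma level_const_pos: "0 < level_const u p"
  unfolding level_const_def using local_const_pos[of u] c1 far_zero_const_nonneg small_const_nonneg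
  by (intro add_pos_nonneg mult_nonneg_nonneg add_nonneg_nonneg) auto

text \<open>Every x is bounded by one active level or by the local norm of f, each with its own
  measurable majorant. In both cases the decay is (2^-k)^(j-i), with i = 0 for the local
  norm.\<close>

theorem level_estimate:
  assumes u: "1 \<le> u" "u \<le> p" and fin: "err p (\<lambda>x. 0) UNIV < \<infinity>"
  shows "(\<integral>\<^sup>+x. epowr (best_approx lebesgue k u ext (cube x ((1 / 2) ^ j))) p \<partial>lebesgue) \<le>
    ennreal (level_const u p) * (\<Sum>i\<le>j. ennreal (((1 / 2) ^ (k * (j - i))) powr p) * beta u p i)"
proof -
  define e where "e x = epowr (best_approx lebesgue k u ext (cube x ((1 / 2) ^ j))) p" for x
  have p: "1 \<le> p" using u by linarith
  \<comment> \<open>At i = j only the upper bound on the distance is asked, since all closer points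
    belong to the near case.\<close>
  define act where "act i x \<longleftrightarrow> sdist S x < 2 * (1 / 2) ^ i \<and> (i = j \<or> (1 / 2) ^ i \<le> sdist S x)" for i x
  define c where "c i = (local_const u * (1 / 2) ^ (k * (j - i))) powr p" for i
  have c: "0 < c i" for i using local_const_pos[of u] by (simp add: c_def)
  have "\<forall>i\<in>{6..j}. \<exists>G. G \<in> borel_measurable borel \<and> (\<forall>x. act i x \<longrightarrow> e x \<le> ennreal (c i) * G x) \<and>
    (\<integral>\<^sup>+x. G x \<partial>lebesgue) \<le> ennreal (18 ^ CARD('n) / c1 * ((1 / 2) ^ i) powr (real CARD('n) - d)) *
      (\<integral>\<^sup>+y. epowr (S_approx u y ((1 / 2) ^ (i - 6))) p \<partial>N)"
  proof
    fix i assume i: "i \<in> {6..j}"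
    \<comment> \<open>Cut off outside the active points, where neither the pointwise bound nor the
      closeness to S required by \<open>discretize\<close> holds.\<close>
    define g where "g x = (if act i x then ennreal (1 / c i) * e x else 0)" for x
    have inv: "ennreal (c i) * (ennreal (1 / c i) * X) = X" "ennreal (1 / c i) * (ennreal (c i) * X) = X" for X
      using c[of i] by (simp_all add: mult.assoc[symmetric] ennreal_mult[symmetric])
    have "\<exists>G\<in>borel_measurable borel. (\<forall>x. g x \<le> G x) \<and>
      (\<integral>\<^sup>+x. G x \<partial>lebesgue) \<le> ennreal (18 ^ CARD('n) / c1 * ((1 / 2) ^ i) powr (real CARD('n) - d)) *
        (\<integral>\<^sup>+y. epowr (S_approx u y ((1 / 2) ^ (i - 6))) p \<partial>N)"
    proof (rule discretize)
      show "(1 / 2 :: real) ^ i \<le> R" using R power_le_one[of "1 / 2 :: real" i] by simp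
      fix x y assume y: "y \<in> S" "infnorm (x - y) \<le> 4 * (1 / 2) ^ i"
      show "g x \<le> epowr (S_approx u y ((1 / 2) ^ (i - 6))) p"
      proof (cases "act i x")
        case True
        have "e x \<le> epowr (ennreal (local_const u * (1 / 2) ^ (k * (j - i))) * S_approx u y ((1 / 2) ^ (i - 6))) p"
          unfolding e_def using True i y u p by (intro epowr_mono approx_active) (auto simp: act_def)
        also have "\<dots> = ennreal (c i) * epowr (S_approx u y ((1 / 2) ^ (i - 6))) p"
          unfolding c_def using local_const_pos[of u] p by (intro epowr_cmult) auto
        finally have "ennreal (1 / c i) * e x \<le> ennreal (1 / c i) * (ennreal (c i) * epowr (S_approx u y ((1 / 2) ^ (i - 6))) p)"
          by (intro mult_left_mono) auto
        then show ?thesis using True by (simp only: inv g_def if_True)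
      qed (simp add: g_def)
    next
      fix x assume "g x \<noteq> 0"
      then have "sdist S x < 2 * (1 / 2) ^ i" by (auto simp: g_def act_def split: if_splits)
      from sdist_less[OF S_ne this] show "\<exists>s\<in>S. infnorm (x - s) \<le> 2 * (1 / 2) ^ i" by (auto intro: less_imp_le)
    qed auto
    then obtain G where G: "G \<in> borel_measurable borel" "\<And>x. g x \<le> G x"
      "(\<integral>\<^sup>+x. G x \<partial>lebesgue) \<le> ennreal (18 ^ CARD('n) / c1 * ((1 / 2) ^ i) powr (real CARD('n) - d)) *
        (\<integral>\<^sup>+y. epowr (S_approx u y ((1 / 2) ^ (i - 6))) p \<partial>N)" by blast
    have "e x \<le> ennreal (c i) * G x" if "act i x" for x
    proof -
      have "ennreal (c i) * (ennreal (1 / c i) * e x) \<le> ennreal (c i) * G x"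
        using G(2)[of x] that by (intro mult_left_mono) (auto simp: g_def)
      then show ?thesis by (simp only: inv)
    qed
    with G show "\<exists>G. G \<in> borel_measurable borel \<and> (\<forall>x. act i x \<longrightarrow> e x \<le> ennreal (c i) * G x) \<and>
      (\<integral>\<^sup>+x. G x \<partial>lebesgue) \<le> ennreal (18 ^ CARD('n) / c1 * ((1 / 2) ^ i) powr (real CARD('n) - d)) *
        (\<integral>\<^sup>+y. epowr (S_approx u y ((1 / 2) ^ (i - 6))) p \<partial>N)" by (intro exI[of _ G] conjI allI impI)
  qed
  then obtain G where G_all: "\<forall>i\<in>{6..j}. G i \<in> borel_measurable borel \<and> (\<forall>x. act i x \<longrightarrow> e x \<le> ennreal (c i) * G i x) \<and>
    (\<integral>\<^sup>+x. G i x \<partial>lebesgue) \<le> ennreal (18 ^ CARD('n) / c1 * ((1 / 2) ^ i) powr (real CARD('n) - d)) *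
      (\<integral>\<^sup>+y. epowr (S_approx u y ((1 / 2) ^ (i - 6))) p \<partial>N)"
    by (subst (asm) bchoice_iff) (elim exE)
  have G_meas: "G i \<in> borel_measurable lebesgue" if "i \<in> {6..j}" for i
    using G_all that by (intro measurable_completion) auto
  obtain H where H: "H \<in> borel_measurable borel" "\<And>x. err p (\<lambda>x. 0) (cube x big_radius) \<le> H x"
    "(\<integral>\<^sup>+x. H x \<partial>lebesgue) \<le> ennreal (2 ^ CARD('n) * (2 * big_radius + 3) ^ CARD('n)) *
      (\<integral>\<^sup>+y. ennreal (\<bar>f y - 0\<bar> powr p) \<partial>N)"
    using discretize_local_integral[OF less_imp_le[OF big_radius(1)] powr_measurable[OF polys_zero, of p],
        of "\<lambda>x. err p (\<lambda>x. 0) (cube x big_radius)"] unfolding err_def by blast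
  have H_meas: "H \<in> borel_measurable lebesgue" using H(1) by (intro measurable_completion) auto
  define D where "D = (far_zero_const p + small_const u p) * (((1 / 2) ^ j) ^ k) powr p"
  \<comment> \<open>Beyond 100000 the extension vanishes. For j < 6, or at distance at least 1/32,
    the local norm term \<open>D * H x\<close> suffices; in the remaining case some level from 6 to
    j is active.\<close>
  have pointwise: "e x \<le> (\<Sum>i\<in>{6..j}. ennreal (c i) * G i x) + ennreal D * H x" for x
  proof (cases "100000 \<le> sdist S x")
    case True
    have "e x = 0" unfolding e_def using True u by (subst approx_zero) (auto simp: power_le_one)
    then show ?thesis by simp
  next
    case False
    have eH: "e x \<le> ennreal D * H x" if "e x \<le> ennreal (K * (((1 / 2) ^ j) ^ k) powr p) * err p (\<lambda>x. 0) (cube x big_radius)"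
      "K \<le> far_zero_const p + small_const u p" for K
    proof -
      note that(1)
      also have "ennreal (K * (((1 / 2) ^ j) ^ k) powr p) * err p (\<lambda>x. 0) (cube x big_radius) \<le> ennreal D * H x"
        unfolding D_def using that(2) by (intro mult_mono ennreal_leI mult_right_mono H(2)) auto
      finally show ?thesis .
    qed
    consider "j < 6" | "6 \<le> j" "1 / 32 \<le> sdist S x" | "6 \<le> j" "sdist S x < 1 / 32" by linarith
    then show ?thesis
    proof cases
      case 1
      have "(1 / 2 :: real) ^ 5 \<le> (1 / 2) ^ j" using 1 by (intro power_decreasing) auto
      then have t: "1 / 32 \<le> (1 / 2 :: real) ^ j" by (simp add: power_divide)
      have "e x \<le> ennreal D * H x"
        by (rule eH[of "small_const u p"])
          (use approx_small[OF _ t _ u fin, of x] False far_zero_const_nonneg in \<open>auto simp: e_def power_le_one\<close>)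
      then show ?thesis by (simp add: add_increasing)
    next
      case 2
      have "(1 / 2 :: real) ^ j \<le> (1 / 2) ^ 6" using 2 by (intro power_decreasing) auto
      then have t: "(1 / 2 :: real) ^ j \<le> 1 / 64" by (simp add: power_divide)
      have "e x \<le> ennreal D * H x"
        by (rule eH[of "far_zero_const p"])
          (use approx_far_zero[OF 2(2) _ _ t u(1) p] False small_const_nonneg in \<open>auto simp: e_def\<close>)
      then show ?thesis by (simp add: add_increasing)
    next
      case 3
      have "\<exists>i\<in>{6..j}. act i x"
      proof (cases "sdist S x < 2 * (1 / 2) ^ j")
        case True
        then show ?thesis using 3 by (auto simp: act_def)
      next
        case nlt: False
        have ex: "\<exists>i. (1 / 2) ^ i \<le> sdist S x" using nlt by (intro exI[of _ j]) (use zero_less_power[of "1 / 2 :: real" j] in linarith)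
        \<comment> \<open>The least such level gives the upper bound on the distance: its
          predecessor fails, and \<open>2 ^ -(i - 1)\<close> is twice \<open>2 ^ -i\<close>.\<close>
        define i where "i = (LEAST i. (1 / 2) ^ i \<le> sdist S x)"
        have i: "(1 / 2) ^ i \<le> sdist S x" unfolding i_def using ex by (rule LeastI_ex)
        have "i \<le> j" unfolding i_def using nlt
          by (intro Least_le) (use zero_less_power[of "1 / 2 :: real" j] in linarith)
        moreover have "6 \<le> i"
        proof (rule ccontr)
          assume "\<not> 6 \<le> i"
          then have "(1 / 2 :: real) ^ 5 \<le> (1 / 2) ^ i" by (intro power_decreasing) auto
          then have "1 / 32 \<le> (1 / 2 :: real) ^ i" by (simp add: power_divide)
          then show False using i 3 by linarith
        qed
        moreover have "sdist S x < 2 * (1 / 2) ^ i"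
        proof -
          have "\<not> (1 / 2) ^ (i - 1) \<le> sdist S x"
            using \<open>6 \<le> i\<close> unfolding i_def by (intro not_less_Least) auto
          moreover have "(1 / 2 :: real) ^ (i - 1) = 2 * (1 / 2) ^ i"
            using \<open>6 \<le> i\<close> by (cases i) auto
          ultimately show ?thesis by simp
        qed
        ultimately show ?thesis using i by (auto simp: act_def)
      qed
      then obtain i where i: "i \<in> {6..j}" "act i x" by blast
      then have "e x \<le> ennreal (c i) * G i x" using G_all by blast
      also have "\<dots> \<le> (\<Sum>i\<in>{6..j}. ennreal (c i) * G i x)"
        using i by (intro member_le_sum) auto
      finally show ?thesis by (simp add: add_increasing2)
    qed
  qed
  have "(\<integral>\<^sup>+x. e x \<partial>lebesgue) \<le> (\<integral>\<^sup>+x. (\<Sum>i\<in>{6..j}. ennreal (c i) * G i x) + ennreal D * H x \<partial>lebesgue)"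
    by (intro nn_integral_mono pointwise)
  \<comment> \<open>Only here is the integral split, with all integrands measurable.\<close>
  also have "\<dots> = (\<integral>\<^sup>+x. (\<Sum>i\<in>{6..j}. ennreal (c i) * G i x) \<partial>lebesgue) + (\<integral>\<^sup>+x. ennreal D * H x \<partial>lebesgue)"
    using G_meas H_meas by (intro nn_integral_add borel_measurable_sum borel_measurable_times_ennreal) auto
  also have "(\<integral>\<^sup>+x. (\<Sum>i\<in>{6..j}. ennreal (c i) * G i x) \<partial>lebesgue) = (\<Sum>i\<in>{6..j}. ennreal (c i) * (\<integral>\<^sup>+x. G i x \<partial>lebesgue))"
    using G_meas by (subst nn_integral_sum) (auto intro!: sum.cong nn_integral_cmult)
  also have "(\<integral>\<^sup>+x. ennreal D * H x \<partial>lebesgue) = ennreal D * (\<integral>\<^sup>+x. H x \<partial>lebesgue)"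
    by (rule nn_integral_cmult[OF H_meas])
  also have "(\<Sum>i\<in>{6..j}. ennreal (c i) * (\<integral>\<^sup>+x. G i x \<partial>lebesgue)) + ennreal D * (\<integral>\<^sup>+x. H x \<partial>lebesgue) \<le>
      (\<Sum>i\<in>{6..j}. ennreal (level_const u p) * (ennreal (((1 / 2) ^ (k * (j - i))) powr p) * beta u p i)) +
      ennreal (level_const u p) * (ennreal (((1 / 2) ^ (k * (j - 0))) powr p) * beta u p 0)"
  proof (intro add_mono sum_mono)
    fix i assume i: "i \<in> {6..j}"
    let ?I = "\<integral>\<^sup>+y. epowr (S_approx u y ((1 / 2) ^ (i - 6))) p \<partial>N"
    have "ennreal (c i) * (\<integral>\<^sup>+x. G i x \<partial>lebesgue) \<le>
        ennreal (c i) * (ennreal (18 ^ CARD('n) / c1 * ((1 / 2) ^ i) powr (real CARD('n) - d)) * ?I)"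
      using G_all i by (intro mult_left_mono) auto
    also have "\<dots> = ennreal (((local_const u) powr p * (18 ^ CARD('n) / c1)) * (((1 / 2) ^ (k * (j - i))) powr p * ((1 / 2) ^ i) powr (real CARD('n) - d))) * ?I"
      using c[of i] local_const_pos[of u] by (subst ennreal_mult_mult) (auto simp: c_def powr_mult mult_ac)
    also have "\<dots> \<le> ennreal (level_const u p * (((1 / 2) ^ (k * (j - i))) powr p * ((1 / 2) ^ i) powr (real CARD('n) - d))) * ?I"
      using far_zero_const_nonneg small_const_nonneg
      by (intro mult_right_mono ennreal_leI) (auto simp: level_const_def)
    also have "\<dots> = ennreal (level_const u p) * (ennreal (((1 / 2) ^ (k * (j - i))) powr p) * beta u p i)"
      using i level_const_pos[of u p] by (simp add: beta_def ennreal_mult_mult mult.assoc)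
    finally show "ennreal (c i) * (\<integral>\<^sup>+x. G i x \<partial>lebesgue) \<le>
        ennreal (level_const u p) * (ennreal (((1 / 2) ^ (k * (j - i))) powr p) * beta u p i)" .
  next
    have D: "0 \<le> D" using far_zero_const_nonneg small_const_nonneg by (simp add: D_def)
    have eq: "((1 / 2 :: real) ^ j) ^ k = (1 / 2) ^ (k * (j - 0))" by (simp add: power_mult[symmetric] mult.commute)
    have "ennreal D * (\<integral>\<^sup>+x. H x \<partial>lebesgue) \<le>
        ennreal D * (ennreal (2 ^ CARD('n) * (2 * big_radius + 3) ^ CARD('n)) * beta u p 0)"
      using H(3) by (intro mult_left_mono) (auto simp: beta_def err_def)
    also have "\<dots> = ennreal (((far_zero_const p + small_const u p) * (2 ^ CARD('n) * (2 * big_radius + 3) ^ CARD('n))) *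
        ((1 / 2) ^ (k * (j - 0))) powr p) * beta u p 0"
      unfolding ennreal_mult_mult[OF D] unfolding D_def eq by (simp only: mult_ac)
    also have "\<dots> \<le> ennreal (level_const u p * ((1 / 2) ^ (k * (j - 0))) powr p) * beta u p 0"
      using c1 by (intro mult_right_mono ennreal_leI) (auto simp: level_const_def)
    also have "\<dots> = ennreal (level_const u p) * (ennreal (((1 / 2) ^ (k * (j - 0))) powr p) * beta u p 0)"
      using level_const_pos[of u p] by (subst ennreal_mult_mult) auto
    finally show "ennreal D * (\<integral>\<^sup>+x. H x \<partial>lebesgue) \<le>
      ennreal (level_const u p) * (ennreal (((1 / 2) ^ (k * (j - 0))) powr p) * beta u p 0)" .
  qed
  also have "\<dots> = (\<Sum>i\<in>insert 0 {6..j}. ennreal (level_const u p) * (ennreal (((1 / 2) ^ (k * (j - i))) powr p) * beta u p i))"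
    by (subst sum.insert) (auto simp: add.commute)
  also have "\<dots> \<le> (\<Sum>i\<le>j. ennreal (level_const u p) * (ennreal (((1 / 2) ^ (k * (j - i))) powr p) * beta u p i))"
    by (intro sum_mono2) auto
  finally show ?thesis by (simp add: e_def sum_distrib_left)
qed

text \<open>Cubes with a nonzero local polynomial have size at most 8000, so P = 0 is admissible in
  \<open>ext_near\<close> with both sets equal to the whole space.\<close>

theorem ext_Lp:
  assumes p: "1 \<le> p"
  shows "(\<integral>\<^sup>+y. ennreal (\<bar>ext y\<bar> powr p) \<partial>lebesgue) \<le>
    ennreal (near_const p * 8000 powr (real CARD('n) - d)) * err p (\<lambda>x. 0) UNIV"
  using ext_near[OF polys_zero p, of 8000 UNIV UNIV] by simp

end

section \<open>Summation over the scales\<close>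

lemma suminf_shift_geometric:
  fixes x :: real
  assumes "0 \<le> x" "x < 1"
  shows "(\<Sum>j. ennreal (if i \<le> j then x ^ (j - i) else 0)) = ennreal (1 / (1 - x))"
proof (rule suminf_ennreal_eq)
  have "(\<lambda>j. if i \<le> j + i then x ^ (j + i - i) else 0) sums (1 / (1 - x))"
    using geometric_sums[of x] assms by simp
  then show "(\<lambda>j. if i \<le> j then x ^ (j - i) else 0) sums (1 / (1 - x))"
    by (subst (asm) sums_iff_shift) simp
qed (use assms in auto)

lemma suminf_swap_ennreal: "(\<Sum>j. \<Sum>i. F i j) = (\<Sum>i. \<Sum>j. F i j :: ennreal)"
  unfolding nn_integral_count_space_nat[symmetric, of "\<lambda>j. \<Sum>i. F i j"]
  by (subst nn_integral_suminf) (auto simp: nn_integral_count_space_nat)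

text \<open>Splitting \<open>\<lambda> = \<mu>\<^sup>2\<close> replaces the convolution by its largest term, which
  treats all exponents \<open>s > 0\<close> at once.\<close>

lemma discrete_hardy:
  fixes a b :: "nat \<Rightarrow> ennreal"
  assumes K: "0 < K" and \<mu>: "0 < \<mu>" "\<mu> < 1" and s: "0 < s"
    and le: "\<And>j. b j \<le> ennreal K * (\<Sum>i\<le>j. ennreal ((\<mu> * \<mu>) ^ (j - i)) * a i)"
  shows "(\<Sum>j. epowr (b j) s) \<le> ennreal ((K / (1 - \<mu>)) powr s / (1 - \<mu> powr s)) * (\<Sum>i. epowr (a i) s)"
proof -
  define c where "c = K / (1 - \<mu>)"
  have c: "0 < c" using K \<mu> by (simp add: c_def)
  define x where "x = \<mu> powr s"
  have x: "0 \<le> x" "x < 1" using \<mu> s powr_less_mono2[of s \<mu> 1] by (auto simp: x_def)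
  define F where "F i j = ennreal (if i \<le> j then x ^ (j - i) else 0) * (ennreal (c powr s) * epowr (a i) s)" for i j
  have bF: "epowr (b j) s \<le> (\<Sum>i. F i j)" for j
  proof -
    \<comment> \<open>One of the two factors \<open>\<mu> ^ (j - i)\<close> stays with
      \<open>a i\<close> inside the maximum, the other is summed as a geometric series.\<close>
    define M where "M = Max ((\<lambda>i. ennreal (\<mu> ^ (j - i)) * a i) ` {..j})"
    have "M \<in> (\<lambda>i. ennreal (\<mu> ^ (j - i)) * a i) ` {..j}" unfolding M_def by (intro Max_in) auto
    then obtain i0 where i0: "i0 \<le> j" "M = ennreal (\<mu> ^ (j - i0)) * a i0" by auto
    have "(\<Sum>i\<le>j. ennreal ((\<mu> * \<mu>) ^ (j - i)) * a i) \<le> (\<Sum>i\<le>j. ennreal (\<mu> ^ (j - i)) * M)"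
    proof (intro sum_mono)
      fix i assume i: "i \<in> {..j}"
      have "ennreal ((\<mu> * \<mu>) ^ (j - i)) * a i = ennreal (\<mu> ^ (j - i)) * (ennreal (\<mu> ^ (j - i)) * a i)"
        using \<mu> by (simp add: ennreal_mult_mult power_mult_distrib)
      also have "\<dots> \<le> ennreal (\<mu> ^ (j - i)) * M"
        using i by (intro mult_left_mono) (auto simp: M_def)
      finally show "ennreal ((\<mu> * \<mu>) ^ (j - i)) * a i \<le> ennreal (\<mu> ^ (j - i)) * M" .
    qed
    also have "\<dots> = ennreal (\<Sum>i\<le>j. \<mu> ^ (j - i)) * M"
      using \<mu> by (simp add: sum_distrib_right[symmetric] sum_ennreal)
    also have "\<dots> \<le> ennreal (1 / (1 - \<mu>)) * M"
    proof (intro mult_right_mono ennreal_leI)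
      have "(\<Sum>i\<le>j. \<mu> ^ (j - i)) = (\<Sum>i\<le>j. \<mu> ^ i)"
        by (rule sum.reindex_bij_witness[of _ "\<lambda>i. j - i" "\<lambda>i. j - i"]) auto
      also have "\<dots> \<le> (\<Sum>i. \<mu> ^ i)"
        using \<mu> by (intro sum_le_suminf summable_geometric) auto
      also have "\<dots> = 1 / (1 - \<mu>)" using \<mu> by (intro suminf_geometric) auto
      finally show "(\<Sum>i\<le>j. \<mu> ^ (j - i)) \<le> 1 / (1 - \<mu>)" .
    qed auto
    finally have "b j \<le> ennreal K * (ennreal (1 / (1 - \<mu>)) * M)"
      using le[of j] by (meson mult_left_mono order_trans zero_le)
    also have "\<dots> = ennreal c * M" using K by (simp add: ennreal_mult_mult c_def)
    also have "\<dots> = ennreal (c * \<mu> ^ (j - i0)) * a i0" unfolding i0(2) using c by (simp add: ennreal_mult_mult)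
    finally have "epowr (b j) s \<le> epowr (ennreal (c * \<mu> ^ (j - i0)) * a i0) s"
      using s by (intro epowr_mono) auto
    also have "\<dots> = ennreal ((c * \<mu> ^ (j - i0)) powr s) * epowr (a i0) s"
      using c \<mu> s by (intro epowr_cmult) auto
    also have "(c * \<mu> ^ (j - i0)) powr s = x ^ (j - i0) * c powr s"
    proof -
      have "(\<mu> ^ (j - i0)) powr s = x ^ (j - i0)"
        using \<mu> by (simp add: x_def powr_realpow[symmetric] powr_powr mult.commute)
      then show ?thesis using c \<mu> by (simp add: powr_mult)
    qed
    \<comment> \<open>The index \<open>i0\<close> depends on j; passing to the full nonnegative
      series in i removes this dependence before the sums are exchanged.\<close>
    also have "ennreal (x ^ (j - i0) * c powr s) * epowr (a i0) s = (\<Sum>i\<in>{i0}. F i j)"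
      using i0 x by (simp add: F_def ennreal_mult_mult)
    also have "\<dots> \<le> (\<Sum>i. F i j)" by (rule sum_le_suminf) (auto intro: summableI)
    finally show ?thesis .
  qed
  have "(\<Sum>j. epowr (b j) s) \<le> (\<Sum>j. \<Sum>i. F i j)" by (intro suminf_le bF summableI)
  also have "\<dots> = (\<Sum>i. \<Sum>j. F i j)" by (rule suminf_swap_ennreal)
  also have "\<dots> = (\<Sum>i. ennreal (1 / (1 - x)) * (ennreal (c powr s) * epowr (a i) s))"
    unfolding F_def ennreal_suminf_multc suminf_shift_geometric[OF x] ..
  also have "\<dots> = ennreal (1 / (1 - x)) * (ennreal (c powr s) * (\<Sum>i. epowr (a i) s))"
    by (simp only: ennreal_suminf_cmult)
  also have "\<dots> = ennreal (c powr s / (1 - x)) * (\<Sum>i. epowr (a i) s)"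
    using x by (subst ennreal_mult_mult) auto
  finally show ?thesis by (simp only: c_def x_def)
qed

text \<open>After division by x + y both fractions lie in the unit interval, where z \<le> z^a, and
  they add up to 1. It is used with a = 1/q.\<close>

lemma epowr_subadditive:
  assumes "0 < a" "a \<le> 1" shows "epowr (X + Y) a \<le> epowr X a + epowr Y a"
proof (cases "X = top \<or> Y = top")
  case True
  then show ?thesis by auto
next
  case False
  then obtain x y where xy: "X = ennreal x" "Y = ennreal y" "0 \<le> x" "0 \<le> y"
    by (metis ennreal_cases)
  have "(x + y) powr a \<le> x powr a + y powr a"
  proof (cases "x + y = 0")
    case False
    then have s: "0 < x + y" using xy by linarith
    have *: "z / (x + y) \<le> (z / (x + y)) powr a" if "0 \<le> z" "z \<le> x + y" for z
    proof (cases "z = 0")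
      case False
      have "(z / (x + y)) powr 1 \<le> (z / (x + y)) powr a"
        using that False s assms by (intro powr_mono') auto
      then show ?thesis using that s by simp
    qed auto
    have "1 = x / (x + y) + y / (x + y)" using s by (simp add: add_divide_distrib[symmetric])
    also have "\<dots> \<le> (x / (x + y)) powr a + (y / (x + y)) powr a" using xy by (intro add_mono *) auto
    finally have "(x + y) powr a * 1 \<le> (x + y) powr a * ((x / (x + y)) powr a + (y / (x + y)) powr a)"
      by (intro mult_left_mono) auto
    also have "\<dots> = x powr a + y powr a" using xy s by (simp add: distrib_left powr_divide)
    finally show ?thesis by simp
  qed (use xy in auto)
  then have "ennreal ((x + y) powr a) \<le> ennreal (x powr a + y powr a)" by (rule ennreal_leI)
  then show ?thesis unfolding xy(1,2)
    using xy(3,4) by (simp add: ennreal_plus[symmetric] epowr_ennreal del: ennreal_plus)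
qed

text \<open>Fitted to the shape of \<open>beta\<close>: one term at 0, a gap, then a shifted
  sequence.\<close>

lemma suminf_le_shift:
  fixes f g :: "nat \<Rightarrow> ennreal"
  assumes f0: "\<And>i. 0 < i \<Longrightarrow> i < m \<Longrightarrow> f i = 0" and m: "0 < m" and fg: "\<And>i. f (i + m) = g i"
  shows "(\<Sum>i. f i) \<le> f 0 + (\<Sum>i. g i)"
proof (rule suminf_le_const[OF summableI])
  fix n
  have "sum f {..<n} \<le> sum f {..<m + n}" by (intro sum_mono2) auto
  also have "\<dots> = sum f {..<m} + (\<Sum>i<n. f (m + i))" by (induction n) (auto simp: add.assoc)
  also have "sum f {..<m} = f 0"
    using f0 m by (subst sum.remove[of _ 0]) (auto intro!: sum.neutral)
  also have "(\<Sum>i<n. f (m + i)) = sum g {..<n}" using fg by (simp add: add.commute)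
  also have "f 0 + sum g {..<n} \<le> f 0 + (\<Sum>i. g i)"
    by (intro add_left_mono sum_le_suminf summableI) auto
  finally show "sum f {..<n} \<le> f 0 + (\<Sum>i. g i)" .
qed

lemma half_power_powr: "((1 / 2 :: real) ^ i) powr s = 2 powr (- (real i * s))"
proof -
  have "((1 / 2 :: real) ^ i) = 2 powr (- real i)" by (simp add: powr_minus powr_realpow power_divide inverse_eq_divide)
  then show ?thesis by (simp add: powr_powr)
qed

context whitney_extension begin

text \<open>The first factor is the constant of \<open>discrete_hardy\<close> with exponent q/p; the
  second pays for the shift by six levels. The outer power 1/q undoes the sum of q-th
  powers.\<close>

definition seq_const :: "real \<Rightarrow> real \<Rightarrow> real \<Rightarrow> real \<Rightarrow> real" where
  "seq_const u p q \<alpha> = (let \<mu> = 2 powr (- ((real k - \<alpha>) * p / 2)) in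
     ((level_const u p / (1 - \<mu>)) powr (q / p) / (1 - \<mu> powr (q / p)) *
      (1 + 2 powr (6 * (\<alpha> * p - (real CARD('n) - d)) * (q / p)))) powr (1 / q))"

text \<open>The level estimate is linear in p-th powers of the norms, so the sums of q-th powers are
  rewritten with exponent q/p. After multiplication by 2^(\<alpha> p j) its kernel decays like
  2^(-(k - \<alpha>) p (j - i)).\<close>

theorem sequence_estimate:
  assumes u: "1 \<le> u" "u \<le> p" and q: "1 \<le> q" and \<alpha>: "\<alpha> < real k" and fin: "err p (\<lambda>x. 0) UNIV < \<infinity>"
  shows "epowr (\<Sum>j. epowr (ennreal (2 powr (\<alpha> * real j)) *
      epowr (\<integral>\<^sup>+x. epowr (best_approx lebesgue k u ext (cube x ((1 / 2) ^ j))) p \<partial>lebesgue) (1 / p)) q) (1 / q) \<le>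
    ennreal (seq_const u p q \<alpha>) *
      (epowr (\<Sum>i. epowr (ennreal (2 powr (real i * (\<alpha> - (real CARD('n) - d) / p))) *
        epowr (\<integral>\<^sup>+y. epowr (S_approx u y ((1 / 2) ^ i)) p \<partial>N) (1 / p)) q) (1 / q) +
       epowr (err p (\<lambda>x. 0) UNIV) (1 / p))"
proof -
  have p: "1 \<le> p" using u by linarith
  define I where "I j = (\<integral>\<^sup>+x. epowr (best_approx lebesgue k u ext (cube x ((1 / 2) ^ j))) p \<partial>lebesgue)" for j
  define J where "J i = (\<integral>\<^sup>+y. epowr (S_approx u y ((1 / 2) ^ i)) p \<partial>N)" for i
  define s where "s = q / p"
  have s: "0 < s" using p q by (simp add: s_def)
  \<comment> \<open>Half of the available decay, as \<open>discrete_hardy\<close> takes the kernel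
    in the form of a square.\<close>
  define \<mu> where "\<mu> = (2 :: real) powr (- ((real k - \<alpha>) * p / 2))"
  have \<mu>: "0 < \<mu>" "\<mu> < 1"
  proof -
    have "\<mu> < 2 powr 0" unfolding \<mu>_def using \<alpha> p by (intro powr_less_mono) auto
    then show "\<mu> < 1" by simp
  qed (simp add: \<mu>_def)
  define K where "K = level_const u p"
  have K: "0 < K" by (simp add: K_def level_const_pos)
  define b where "b j = ennreal (2 powr (\<alpha> * p * real j)) * I j" for j
  define a where "a i = ennreal (2 powr (\<alpha> * p * real i)) * beta u p i" for i
  have \<mu>pow: "(\<mu> * \<mu>) ^ m = 2 powr (- ((real k - \<alpha>) * p * real m))" for m
  proof -
    have "\<mu> * \<mu> = 2 powr (- ((real k - \<alpha>) * p))" by (simp add: \<mu>_def powr_add[symmetric] mult.commute)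
    then show ?thesis by (simp add: powr_realpow[symmetric] powr_powr)
  qed
  have ba: "b j \<le> ennreal K * (\<Sum>i\<le>j. ennreal ((\<mu> * \<mu>) ^ (j - i)) * a i)" for j
  proof -
    have "b j \<le> ennreal (2 powr (\<alpha> * p * real j)) * (ennreal K * (\<Sum>i\<le>j. ennreal (((1 / 2) ^ (k * (j - i))) powr p) * beta u p i))"
      unfolding b_def I_def K_def by (intro mult_left_mono level_estimate u fin) auto
    also have "\<dots> = ennreal K * (\<Sum>i\<le>j. ennreal (2 powr (\<alpha> * p * real j)) * (ennreal (((1 / 2) ^ (k * (j - i))) powr p) * beta u p i))"
      by (simp add: sum_distrib_left mult_ac)
    also have "(\<Sum>i\<le>j. ennreal (2 powr (\<alpha> * p * real j)) * (ennreal (((1 / 2) ^ (k * (j - i))) powr p) * beta u p i)) =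
        (\<Sum>i\<le>j. ennreal ((\<mu> * \<mu>) ^ (j - i)) * a i)"
    proof (intro sum.cong refl)
      fix i assume i: "i \<in> {..j}"
      have "2 powr (\<alpha> * p * real j) * ((1 / 2) ^ (k * (j - i))) powr p = (\<mu> * \<mu>) ^ (j - i) * 2 powr (\<alpha> * p * real i)"
        unfolding half_power_powr \<mu>pow using i by (simp add: powr_add[symmetric] of_nat_diff algebra_simps)
      then show "ennreal (2 powr (\<alpha> * p * real j)) * (ennreal (((1 / 2) ^ (k * (j - i))) powr p) * beta u p i) =
          ennreal ((\<mu> * \<mu>) ^ (j - i)) * a i"
        using \<mu> by (simp add: a_def ennreal_mult_mult)
    qed
    finally show ?thesis .
  qed
  define H where "H = (K / (1 - \<mu>)) powr s / (1 - \<mu> powr s)"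
  have "\<mu> powr s < 1" using \<mu> s powr_less_mono2[of s \<mu> 1] by auto
  then have H: "0 < H" using K \<mu> by (simp add: H_def)
  have hardy: "(\<Sum>j. epowr (b j) s) \<le> ennreal H * (\<Sum>i. epowr (a i) s)"
    unfolding H_def by (rule discrete_hardy[OF K \<mu> s ba])
  \<comment> \<open>The ratio of the weights at levels i + 6 and i, raised to the power s.\<close>
  define c6 where "c6 = 2 powr (6 * (\<alpha> * p - (real CARD('n) - d)) * s)"
  define Y where "Y = (\<Sum>i. epowr (ennreal (2 powr (real i * (\<alpha> - (real CARD('n) - d) / p))) * epowr (J i) (1 / p)) q)"
  define F where "F = epowr (err p (\<lambda>x. 0) UNIV) (1 / p)"
  \<comment> \<open>Moves the inner power 1/p into the weight, since the outer exponent is q = s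
    p.\<close>
  have collapse: "epowr (ennreal (2 powr t) * epowr X (1 / p)) q = epowr (ennreal (2 powr (t * p)) * X) s" for t X
  proof -
    have "epowr (ennreal (2 powr t) * epowr X (1 / p)) q = ennreal ((2 powr t) powr q) * epowr (epowr X (1 / p)) q"
      using q by (intro epowr_cmult) auto
    also have "\<dots> = ennreal ((2 powr (t * p)) powr s) * epowr X s"
      using p q by (simp add: epowr_epowr powr_powr s_def)
    also have "\<dots> = epowr (ennreal (2 powr (t * p)) * X) s" using s by (intro epowr_cmult[symmetric]) auto
    finally show ?thesis .
  qed
  have "(\<Sum>i. epowr (a i) s) \<le> epowr (a 0) s + (\<Sum>i. ennreal c6 * epowr (ennreal (2 powr (real i * (\<alpha> - (real CARD('n) - d) / p))) * epowr (J i) (1 / p)) q)"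
  proof (rule suminf_le_shift[where m = 6])
    fix i :: nat
    have e: "2 powr (\<alpha> * p * real (i + 6)) * ((1 / 2) ^ (i + 6)) powr (real CARD('n) - d) =
        2 powr (6 * (\<alpha> * p - (real CARD('n) - d))) * 2 powr (real i * (\<alpha> - (real CARD('n) - d) / p) * p)"
    proof -
      have "(\<alpha> - (real CARD('n) - d) / p) * p = \<alpha> * p - (real CARD('n) - d)"
        using p by (subst left_diff_distrib) simp
      then have "real i * (\<alpha> - (real CARD('n) - d) / p) * p = real i * (\<alpha> * p - (real CARD('n) - d))"
        by (simp only: mult.assoc)
      then show ?thesis
        unfolding half_power_powr by (simp only:) (simp add: powr_add[symmetric] algebra_simps)
    qed
    have "a (i + 6) = ennreal (2 powr (\<alpha> * p * real (i + 6))) * (ennreal (((1 / 2) ^ (i + 6)) powr (real CARD('n) - d)) * J i)"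
      by (simp add: a_def beta_def J_def)
    also have "\<dots> = ennreal (2 powr (6 * (\<alpha> * p - (real CARD('n) - d)))) * (ennreal (2 powr (real i * (\<alpha> - (real CARD('n) - d) / p) * p)) * J i)"
      unfolding ennreal_mult_mult[OF powr_ge_zero] e ..
    finally have "epowr (a (i + 6)) s = ennreal ((2 powr (6 * (\<alpha> * p - (real CARD('n) - d)))) powr s) *
        epowr (ennreal (2 powr (real i * (\<alpha> - (real CARD('n) - d) / p) * p)) * J i) s"
      using s by (simp only:) (intro epowr_cmult, auto)
    then show "epowr (a (i + 6)) s = ennreal c6 * epowr (ennreal (2 powr (real i * (\<alpha> - (real CARD('n) - d) / p))) * epowr (J i) (1 / p)) q"
      unfolding collapse by (simp only: c6_def powr_powr)
  qed (auto simp: a_def beta_def)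
  also have "\<dots> = epowr F q + ennreal c6 * Y"
    using p q by (simp add: a_def beta_def F_def epowr_epowr s_def Y_def)
  also have "\<dots> \<le> ennreal (1 + c6) * (Y + epowr F q)"
  proof -
    \<comment> \<open>The two missing cross terms are added so that the sum factors.\<close>
    have "epowr F q + ennreal c6 * Y \<le> (epowr F q + ennreal c6 * Y) + (Y + ennreal c6 * epowr F q)" by simp
    also have "\<dots> = (ennreal 1 + ennreal c6) * (Y + epowr F q)" by (simp add: distrib_left distrib_right add_ac)
    also have "ennreal 1 + ennreal c6 = ennreal (1 + c6)" by (intro ennreal_plus[symmetric]) (auto simp: c6_def)
    finally show ?thesis .
  qed
  finally have sumA: "(\<Sum>i. epowr (a i) s) \<le> ennreal (1 + c6) * (Y + epowr F q)" .
  have c6: "0 \<le> c6" by (simp add: c6_def)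
  have "(\<Sum>j. epowr (ennreal (2 powr (\<alpha> * real j)) * epowr (I j) (1 / p)) q) = (\<Sum>j. epowr (b j) s)"
    unfolding collapse b_def by (simp add: mult_ac)
  also have "\<dots> \<le> ennreal H * (ennreal (1 + c6) * (Y + epowr F q))"
    by (rule order_trans[OF hardy]) (intro mult_left_mono sumA, simp)
  also have "\<dots> = ennreal (H * (1 + c6)) * (Y + epowr F q)" using H by (simp add: ennreal_mult_mult)
  finally have "epowr (\<Sum>j. epowr (ennreal (2 powr (\<alpha> * real j)) * epowr (I j) (1 / p)) q) (1 / q) \<le>
      epowr (ennreal (H * (1 + c6)) * (Y + epowr F q)) (1 / q)"
    using q by (intro epowr_mono) auto
  also have "\<dots> = ennreal ((H * (1 + c6)) powr (1 / q)) * epowr (Y + epowr F q) (1 / q)"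
    using H c6 q by (intro epowr_cmult) auto
  also have "\<dots> \<le> ennreal ((H * (1 + c6)) powr (1 / q)) * (epowr Y (1 / q) + epowr (epowr F q) (1 / q))"
    using q by (intro mult_left_mono epowr_subadditive) auto
  also have "epowr (epowr F q) (1 / q) = F" using q by (simp add: epowr_epowr)
  also have "(H * (1 + c6)) powr (1 / q) = seq_const u p q \<alpha>"
    by (simp add: seq_const_def Let_def H_def c6_def K_def \<mu>_def s_def)
  finally show ?thesis unfolding I_def J_def Y_def F_def .
qed

end

section \<open>The extension theorem\<close>

lemma infnorm_le_dist: "infnorm (x - y) \<le> dist x (y :: real ^ 'n)"
  by (simp add: dist_norm infnorm_le_norm)

lemma dist_le_infnorm: "dist x (y :: real ^ 'n) \<le> sqrt (real CARD('n)) * infnorm (x - y)"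
  using norm_le_infnorm[of "x - y"] by (simp add: dist_norm)

text \<open>Cubes of radius 1/(i + 1) centred in a countable dense subset of S form a countable base
  of S, and the hypothesis makes their traces measurable. Balls and cubes are comparable through the
  equivalence of the Euclidean and supremum norms.\<close>

lemma open_Int_measurable:
  fixes S :: "(real ^ 'n) set"
  assumes cubes: "\<And>w r. w \<in> S \<Longrightarrow> 0 < r \<Longrightarrow> r \<le> 1 \<Longrightarrow> cube w r \<inter> S \<in> sets M" and U: "open U"
  shows "U \<inter> S \<in> sets M"
proof -
  obtain T where T: "countable T" "T \<subseteq> S" "S \<subseteq> closure T" by (rule separable)
  define r where "r i = 1 / real (Suc i)" for i
  have r: "0 < r i" "r i \<le> 1" for i by (auto simp: r_def)
  define I where "I = {(w, i). w \<in> T \<and> cube w (r i) \<inter> S \<subseteq> U}"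
  have "countable I"
    by (rule countable_subset[of _ "T \<times> (UNIV :: nat set)"]) (use T(1) in \<open>auto simp: I_def\<close>)
  have "U \<inter> S = (\<Union>(w, i)\<in>I. cube w (r i) \<inter> S)"
  proof (intro equalityI subsetI)
    fix y assume y: "y \<in> U \<inter> S"
    then obtain e where e: "0 < e" "ball y e \<subseteq> U" using U openE by blast
    define \<sigma> where "\<sigma> = sqrt (real CARD('n))"
    have \<sigma>: "0 < \<sigma>" by (simp add: \<sigma>_def)
    obtain i where i: "r i < e / (2 * \<sigma>)"
      using reals_Archimedean[of "e / (2 * \<sigma>)"] e \<sigma> by (auto simp: r_def inverse_eq_divide)
    obtain w where w: "w \<in> T" "dist w y < r i" using y T(3) r(1)[of i] closure_approachable[of y T] by blast
    have wy: "infnorm (w - y) \<le> r i" using infnorm_le_dist[of w y] w by linarith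
    have "cube w (r i) \<subseteq> U"
    proof
      fix z assume "z \<in> cube w (r i)"
      then have "infnorm (y - z) \<le> 2 * r i"
        using infnorm_triangle3[of y z w] wy by (simp add: mem_cube_infnorm infnorm_sub)
      then have "\<sigma> * infnorm (y - z) \<le> \<sigma> * (2 * r i)" using \<sigma> by (intro mult_left_mono) auto
      also have "\<dots> < e" using i \<sigma> by (simp add: field_simps)
      finally have "dist y z < e" using dist_le_infnorm[of y z] by (simp add: \<sigma>_def)
      then show "z \<in> U" using e by auto
    qed
    then have "(w, i) \<in> I" using w by (auto simp: I_def)
    moreover have "y \<in> cube w (r i) \<inter> S" using wy y by (simp add: mem_cube_infnorm)
    ultimately show "y \<in> (\<Union>(w, i)\<in>I. cube w (r i) \<inter> S)" by blast
  qed (auto simp: I_def)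
  also have "\<dots> \<in> sets M"
  proof (rule sets.countable_UN''[OF \<open>countable I\<close>])
    fix p assume "p \<in> I"
    then show "(case p of (w, i) \<Rightarrow> cube w (r i) \<inter> S) \<in> sets M"
      using T(2) cubes[OF _ r, of "fst p" "snd p"] by (auto simp: I_def)
  qed
  finally show ?thesis .
qed

text \<open>Regularity is extended from radius 1 to 10^7. For the lower bound the radius is shrunk
  to \<open>r / ?R\<close>; for the upper bound the cube is covered by boundedly many cubes of that
  radius centred in S, so its own centre may be arbitrary.\<close>

lemma d_set_regular:
  fixes S :: "(real ^ 'n::finite) set"
  assumes dS: "d_set d S" and d: "real CARD('n) - 1 < d" "d < real CARD('n)"
  obtains c1 c2 where "S \<in> sets (hausdorff d)" "regular_set (restrict_space (hausdorff d) S) S d (10 ^ 7) c1 c2"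
proof -
  let ?M = "hausdorff d :: (real ^ 'n) measure" and ?R = "10 ^ 7 :: real"
  from dS obtain c1 c2 where S: "closed S" "S \<noteq> {}" and c: "0 < c1" "0 < c2"
    and reg: "\<And>w r. w \<in> S \<Longrightarrow> 0 < r \<Longrightarrow> r \<le> 1 \<Longrightarrow>
        ennreal (c1 * r powr d) \<le> emeasure ?M (cube w r \<inter> S) \<and> emeasure ?M (cube w r \<inter> S) \<le> ennreal (c2 * r powr d)"
    unfolding d_set_def by blast
  have "real CARD('n) \<ge> 1" by (simp add: Suc_le_eq)
  then have d0: "0 \<le> d" using d by linarith
  \<comment> \<open>A non-measurable set would have \<open>emeasure\<close> equal to \<open>0\<close>.\<close>
  have cubes: "cube w r \<inter> S \<in> sets ?M" if "w \<in> S" "0 < r" "r \<le> 1" for w r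
  proof (rule ccontr)
    assume "cube w r \<inter> S \<notin> sets ?M"
    then have "emeasure ?M (cube w r \<inter> S) = 0" by (rule emeasure_notin_sets)
    then have "ennreal (c1 * r powr d) \<le> 0" using reg[OF that] by simp
    moreover have "0 < c1 * r powr d" using c that by simp
    ultimately show False by (metis ennreal_less_zero_iff leD)
  qed
  have opn: "U \<inter> S \<in> sets ?M" if "open U" for U using open_Int_measurable[OF cubes that] .
  have S_sets: "S \<in> sets ?M" using opn[OF open_UNIV] by simp
  have space_M: "space ?M = UNIV" by (simp add: hausdorff_def space_measure_of_conv)
  define N where "N = restrict_space ?M S"
  have space_N: "space N = S" by (simp add: N_def space_restrict_space space_M)
  have emN: "emeasure N (A \<inter> S) = emeasure ?M (A \<inter> S)" for A
    unfolding N_def using S_sets by (intro emeasure_restrict_space) (auto simp: space_M)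
  have id_N: "(\<lambda>x. x) \<in> measurable N borel"
  proof (rule borel_measurableI)
    fix U :: "(real ^ 'n) set" assume "open U"
    then have "U \<inter> S \<in> sets N" unfolding N_def using opn[of U] S_sets
      by (subst sets_restrict_space_iff) (auto simp: space_M)
    then show "(\<lambda>x. x) -` U \<inter> space N \<in> sets N" by (simp add: space_N)
  qed
  have sets_N: "A \<inter> S \<in> sets N" if "A \<in> sets borel" for A
    using measurable_sets[OF id_N that] by (simp add: space_N)
  have "regular_set N S d ?R (c1 / ?R powr d) ((2 * ?R + 3) ^ CARD('n) * c2)"
  proof
    fix w r assume wr: "w \<in> S" "0 < r" "r \<le> ?R"
    have "ennreal (c1 / ?R powr d * r powr d) = ennreal (c1 * (r / ?R) powr d)"
      using wr by (simp add: powr_divide)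
    also have "\<dots> \<le> emeasure N (cube w (r / ?R) \<inter> S)"
      using reg[OF wr(1), of "r / ?R"] wr emN by auto
    also have "\<dots> \<le> emeasure N (cube w r \<inter> S)"
      using cube_mono[of w w "r / ?R" r] wr by (intro emeasure_mono sets_N) (auto simp: infnorm_0)
    finally show "ennreal (c1 / ?R powr d * r powr d) \<le> emeasure N (cube w r \<inter> S)" .
  next
    fix w :: "real ^ 'n" and r assume r: "0 < r" "r \<le> ?R"
    define \<rho> where "\<rho> = r / ?R"
    have \<rho>: "0 < \<rho>" "\<rho> \<le> 1" using r by (auto simp: \<rho>_def)
    \<comment> \<open>Points of the cube are within \<open>?R\<close> units of \<open>\<rho>\<close>
      of its centre, and a cell index adds one more unit; this yields 2 (?R + 1) + 1 = 2 ?R + 3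
      indices per coordinate.\<close>
    define B where "B = {m :: 'n \<Rightarrow> int. \<forall>i. \<bar>of_int (m i) - w $ i / \<rho>\<bar> \<le> ?R + 1}"
    have B: "finite B" "real (card B) \<le> (2 * ?R + 3) ^ CARD('n)"
    proof -
      show "finite B" unfolding B_def by (rule card_int_box(1)) auto
      have "real (card B) \<le> (\<Prod>i\<in>(UNIV :: 'n set). 2 * (?R + 1) + 1)"
        unfolding B_def by (rule card_int_box(2)) auto
      then show "real (card B) \<le> (2 * ?R + 3) ^ CARD('n)" by simp
    qed
    \<comment> \<open>One cube per grid cell that meets S, centred at a point of S in that cell; its
      radius \<open>\<rho>\<close> covers the whole cell.\<close>
    define V where "V m = (if \<exists>s\<in>S. grid_cell \<rho> s = m then cube (SOME s. s \<in> S \<and> grid_cell \<rho> s = m) \<rho> \<inter> S else {})" for m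
    have V: "V m \<in> sets N" "emeasure N (V m) \<le> ennreal (c2 * \<rho> powr d)" for m
    proof -
      show "V m \<in> sets N" unfolding V_def using sets_N by auto
      show "emeasure N (V m) \<le> ennreal (c2 * \<rho> powr d)"
      proof (cases "\<exists>s\<in>S. grid_cell \<rho> s = m")
        case True
        then have "(SOME s. s \<in> S \<and> grid_cell \<rho> s = m) \<in> S" using someI_ex[of "\<lambda>s. s \<in> S \<and> grid_cell \<rho> s = m"] by blast
        then show ?thesis using True reg[OF _ \<rho>] emN by (simp add: V_def)
      qed (simp add: V_def)
    qed
    have "cube w r \<inter> S \<subseteq> (\<Union>m\<in>B. V m)"
    proof
      fix y assume y: "y \<in> cube w r \<inter> S"
      let ?m = "grid_cell \<rho> y"
      have "?m \<in> B"
        unfolding B_def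
      proof (intro CollectI allI)
        fix i
        have "\<bar>y $ i - \<rho> * of_int (?m i)\<bar> \<le> \<rho>" by (rule grid_cell_dist[OF \<rho>(1) refl])
        moreover have "\<bar>y $ i - w $ i\<bar> \<le> \<rho> * ?R" using y by (simp add: mem_cube_iff \<rho>_def)
        ultimately have "\<bar>\<rho> * of_int (?m i) - w $ i\<bar> \<le> \<rho> * (?R + 1)" by (simp add: algebra_simps)
        also have "\<rho> * of_int (?m i) - w $ i = \<rho> * (of_int (?m i) - w $ i / \<rho>)" using \<rho> by (simp add: field_simps)
        finally show "\<bar>of_int (?m i) - w $ i / \<rho>\<bar> \<le> ?R + 1" using \<rho> by (simp add: abs_mult)
      qed
      moreover have "y \<in> V ?m"
      proof -
        define s where "s = (SOME s. s \<in> S \<and> grid_cell \<rho> s = ?m)"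
        have "s \<in> S \<and> grid_cell \<rho> s = ?m" unfolding s_def
          by (rule someI[of "\<lambda>s. s \<in> S \<and> grid_cell \<rho> s = ?m" y]) (use y in simp)
        then have eq: "grid_cell \<rho> s = ?m" by simp
        have "\<bar>y $ i - s $ i\<bar> \<le> \<rho>" for i
        proof -
          have "\<lfloor>s $ i / \<rho>\<rfloor> = \<lfloor>y $ i / \<rho>\<rfloor>" using fun_cong[OF eq, of i] by (simp add: grid_cell_def)
          then have "\<bar>y $ i / \<rho> - s $ i / \<rho>\<bar> \<le> 1" by linarith
          then show ?thesis using \<rho> by (simp add: diff_divide_distrib[symmetric] abs_divide pos_divide_le_eq)
        qed
        then have "y \<in> cube s \<rho>" by (simp add: mem_cube_iff)
        then show ?thesis using y unfolding V_def s_def[symmetric] by auto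
      qed
      ultimately show "y \<in> (\<Union>m\<in>B. V m)" by blast
    qed
    then have "emeasure N (cube w r \<inter> S) \<le> emeasure N (\<Union>m\<in>B. V m)"
      using B(1) V(1) by (intro emeasure_mono) auto
    also have "\<dots> \<le> (\<Sum>m\<in>B. emeasure N (V m))"
      using B(1) V(1) by (intro emeasure_subadditive_finite) auto
    also have "\<dots> \<le> (\<Sum>m\<in>B. ennreal (c2 * \<rho> powr d))" by (intro sum_mono V)
    also have "\<dots> = ennreal (real (card B) * (c2 * \<rho> powr d))"
      using c by (simp add: ennreal_mult ennreal_of_nat_eq_real_of_nat)
    also have "\<dots> \<le> ennreal ((2 * ?R + 3) ^ CARD('n) * (c2 * r powr d))"
    proof (intro ennreal_leI mult_mono B)
      show "\<rho> powr d \<le> r powr d" using r d0 by (intro powr_mono2) (auto simp: \<rho>_def)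
    qed (use c in auto)
    finally show "emeasure N (cube w r \<inter> S) \<le> ennreal ((2 * ?R + 3) ^ CARD('n) * c2 * r powr d)"
      by (simp only: mult.assoc)
  qed (use S d c space_N id_N in auto)
  with S_sets show ?thesis unfolding N_def by (intro that)
qed

lemma powr_two_minus: "2 powr (- real j) = (1 / 2 :: real) ^ j"
  by (simp add: powr_minus powr_realpow power_divide inverse_eq_divide)

section \<open>Passing to the restricted measure\<close>

context
  fixes d :: real and S :: "(real ^ 'n::finite) set"
  assumes S_sets: "S \<in> sets (hausdorff d)"
begin

private lemma S_space: "S \<inter> space (hausdorff d) \<in> sets (hausdorff d)"
  using S_sets by simp

lemma nn_integral_restrict_S:
  "(\<integral>\<^sup>+x. g x * indicator (A \<inter> S) x \<partial>hausdorff d) = (\<integral>\<^sup>+x. g x * indicator A x \<partial>restrict_space (hausdorff d) S)"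
  unfolding nn_integral_restrict_space[OF S_space] by (intro nn_integral_cong) (auto simp: indicator_def)

lemma set_integral_restrict_S:
  "(LINT x:A \<inter> S|hausdorff d. g x) = (LINT x:A|restrict_space (hausdorff d) S. (g x :: real))"
  unfolding set_lebesgue_integral_def integral_restrict_space[OF S_space]
  by (intro Bochner_Integration.integral_cong) (auto simp: indicator_def)

text \<open>The predicates defining an orthonormal basis coincide as functions, so the choice
  operator selects the same basis on both sides.\<close>

lemma poly_proj_restrict_S:
  "poly_proj (hausdorff d) (A \<inter> S) m f = poly_proj (restrict_space (hausdorff d) S) A m f"
proof -
  have "orthonormal_poly_basis (hausdorff d) (A \<inter> S) m = orthonormal_poly_basis (restrict_space (hausdorff d) S) A m"
    by (simp add: fun_eq_iff orthonormal_poly_basis_def set_integral_restrict_S)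
  then show ?thesis by (simp add: poly_proj_def[abs_def] set_integral_restrict_S)
qed

lemma Lp_norm_restrict_S:
  "Lp_norm (hausdorff d) S p g = epowr (\<integral>\<^sup>+x. epowr (g x) p \<partial>restrict_space (hausdorff d) S) (1 / p)"
  unfolding Lp_norm_def nn_integral_restrict_space[OF S_space] ..

end

theorem theorem6p1:
  fixes S :: "(real ^ 'n) set"
    and d \<alpha> p q u :: real
    and k :: nat
    and C :: "('n \<Rightarrow> nat) \<Rightarrow> real"
  assumes "d_set d S"
    and "real CARD('n) - 1 < d" and "d < real CARD('n)"
    and "0 < \<alpha>" and "\<alpha> < real k"
    and "1 \<le> p" and "1 \<le> q" and "1 \<le> u" and "u \<le> p"
  shows "\<exists>c>0. \<forall>W \<phi> a f.
    whitney_decomposition S W \<longrightarrow> whitney_partition C S W \<phi> \<longrightarrow> nearest_points S W a \<longrightarrow>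
    in_Lp (hausdorff d) S p f \<longrightarrow>
    (let f' = Ext 16000 d S W \<phi> a k f in
       epowr (\<Sum>j. epowr (ennreal (2 powr (\<alpha> * real j)) *
           Lp_norm lebesgue UNIV p
             (\<lambda>x. best_approx lebesgue k u f' (cube x (2 powr (- real j))))) q) (1 / q)
       + Lp_norm lebesgue UNIV p (\<lambda>x. ennreal \<bar>f' x\<bar>)
     \<le> ennreal c *
       (epowr (\<Sum>j. epowr (ennreal (2 powr (real j * (\<alpha> - (real CARD('n) - d) / p))) *
           Lp_norm (hausdorff d) S p
             (\<lambda>x. best_approx (hausdorff d) k u f (cube x (2 powr (- real j)) \<inter> S))) q) (1 / q)
       + Lp_norm (hausdorff d) S p (\<lambda>x. ennreal \<bar>f x\<bar>)))"
proof -
  obtain c1 c2 where S_sets: "S \<in> sets (hausdorff d)"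
    and reg: "regular_set (restrict_space (hausdorff d) S) S d (10 ^ 7) c1 c2"
    by (rule d_set_regular[OF assms(1-3)])
  define N where "N = restrict_space (hausdorff d) S"
  interpret regular_set N S d "10 ^ 7" c1 c2 using reg unfolding N_def .
  have k: "0 < k" using assms(4,5) by (cases k) auto
  have km: "int (k - 1) = int k - 1" using k by simp
  \<comment> \<open>The projection bound is stated for a natural degree; k - 1 is one because 0 <
    \<alpha> < k forces k to be positive.\<close>
  obtain Cp where Cp: "proj_bound N S d (10 ^ 7) c1 c2 k Cp"
    by (rule poly_proj_error[of "k - 1"], unfold km)
      (rule that, unfold_locales, use k in auto)
  interpret proj_bound N S d "10 ^ 7" c1 c2 k Cp by (rule Cp)
  define n where "n = real CARD('n)"
  \<comment> \<open>The constant is taken outside the locale: its argument list shows that it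
    depends on neither \<open>W\<close>, \<open>\<phi>\<close>, \<open>a\<close> nor
    \<open>f\<close>, so it can be fixed before them.\<close>
  define K1 where "K1 = whitney_extension.seq_const d c1 c2 k Cp C u p q \<alpha>"
  define K2 where "K2 = (near_const p * 8000 powr (n - d)) powr (1 / p)"
  define c where "c = 1 + \<bar>K1\<bar> + \<bar>K2\<bar>"
  have main: "epowr (\<Sum>j. epowr (ennreal (2 powr (\<alpha> * real j)) *
           Lp_norm lebesgue UNIV p
             (\<lambda>x. best_approx lebesgue k u f' (cube x (2 powr (- real j))))) q) (1 / q)
       + Lp_norm lebesgue UNIV p (\<lambda>x. ennreal \<bar>f' x\<bar>)
     \<le> ennreal c *
       (epowr (\<Sum>j. epowr (ennreal (2 powr (real j * (\<alpha> - (n - d) / p))) *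
           Lp_norm (hausdorff d) S p
             (\<lambda>x. best_approx (hausdorff d) k u f (cube x (2 powr (- real j)) \<inter> S))) q) (1 / q)
       + Lp_norm (hausdorff d) S p (\<lambda>x. ennreal \<bar>f x\<bar>))"
    if wd: "whitney_decomposition S W" and wp: "whitney_partition C S W \<phi>" and np: "nearest_points S W a"
      and f: "in_Lp (hausdorff d) S p f" and f': "f' = Ext 16000 d S W \<phi> a k f" for W \<phi> a f f'
  proof -
    have p: "0 < p" "1 \<le> p" using assms by auto
    have S_space: "S \<inter> space (hausdorff d) \<in> sets (hausdorff d)" using S_sets by simp
    have f_N: "f \<in> borel_measurable N"
      unfolding N_def borel_measurable_restrict_space_iff[OF S_space]
      using f by (simp add: in_Lp_def set_borel_measurable_def)
    have Lp_f: "Lp_norm (hausdorff d) S p (\<lambda>x. ennreal \<bar>f x\<bar>) = epowr (\<integral>\<^sup>+y. ennreal (\<bar>f y\<bar> powr p) \<partial>N) (1 / p)"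
      unfolding Lp_norm_restrict_S[OF S_sets] N_def by (simp add: epowr_ennreal)
    have fin: "(\<integral>\<^sup>+y. ennreal (\<bar>f y\<bar> powr p) \<partial>N) < \<infinity>"
    proof (rule ccontr)
      assume "\<not> (\<integral>\<^sup>+y. ennreal (\<bar>f y\<bar> powr p) \<partial>N) < \<infinity>"
      then have "(\<integral>\<^sup>+y. ennreal (\<bar>f y\<bar> powr p) \<partial>N) = \<infinity>" by (metis infinity_ennreal_def less_top)
      then show False using f Lp_f by (simp add: in_Lp_def)
    qed
    interpret E: whitney_extension N S d "10 ^ 7" c1 c2 k Cp W a \<phi> C f
    proof unfold_locales
      show "(\<integral>\<^sup>+y\<in>cube w r. ennreal \<bar>f y\<bar> \<partial>N) < \<infinity>" if "r \<le> 10 ^ 7" for w r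
        using local_integral_finite[of 1 p f r w] p f_N fin that by simp
    qed (use S_nonempty wd np wp f_N in auto)
    have ext: "f' = E.ext"
    proof
      fix x
      have wl: "whitney_poly 16000 d S a (int k - 1) f Q x = E.local_poly Q x" if "Q \<in> W" for Q
        unfolding whitney_poly_def E.local_poly_def poly_proj_restrict_S[OF S_sets] N_def[symmetric]
        using E.W_pos[OF that] by (simp add: sup_diam_cube)
      show "f' x = E.ext x"
      proof (cases "x \<in> S")
        case False
        have "f' x = (\<Sum>Q\<in>E.touching x. \<phi> Q x * whitney_poly 16000 d S a (int k - 1) f Q x)"
          unfolding f' Ext_def using False
          by (simp add: E.partition_sum(1)[OF wp False, of "\<lambda>Q. whitney_poly 16000 d S a (int k - 1) f Q x"])
        also have "\<dots> = (\<Sum>Q\<in>E.touching x. \<phi> Q x * E.local_poly Q x)"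
          by (intro sum.cong refl) (simp add: wl E.touching_def)
        finally show ?thesis using False by (simp add: E.ext_def)
      qed (simp add: f' Ext_def E.ext_def)
    qed
    have approx: "best_approx (hausdorff d) k u f (cube x r \<inter> S) = E.S_approx u x r" for x r
    proof -
      have "emeasure (hausdorff d) (cube x r \<inter> S) = emeasure N (cube x r \<inter> S)"
        unfolding N_def using S_space by (intro emeasure_restrict_space[symmetric]) auto
      then show ?thesis
        unfolding best_approx_def E.S_approx_def E.err_def nn_integral_restrict_S[OF S_sets] N_def[symmetric] by simp
    qed
    have err_p: "E.err p (\<lambda>x. 0) UNIV = (\<integral>\<^sup>+y. ennreal (\<bar>f y\<bar> powr p) \<partial>N)" by (simp add: E.err_def)
    define X where "X = epowr (\<Sum>i. epowr (ennreal (2 powr (real i * (\<alpha> - (n - d) / p))) *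
        epowr (\<integral>\<^sup>+y. epowr (E.S_approx u y ((1 / 2) ^ i)) p \<partial>N) (1 / p)) q) (1 / q)"
    define F where "F = epowr (E.err p (\<lambda>x. 0) UNIV) (1 / p)"
    have "epowr (\<Sum>j. epowr (ennreal (2 powr (\<alpha> * real j)) *
        epowr (\<integral>\<^sup>+x. epowr (best_approx lebesgue k u f' (cube x ((1 / 2) ^ j))) p \<partial>lebesgue) (1 / p)) q) (1 / q)
      \<le> ennreal K1 * (X + F)"
      unfolding K1_def X_def F_def ext n_def
      by (rule E.sequence_estimate) (use assms fin err_p in auto)
    moreover have "epowr (\<integral>\<^sup>+y. ennreal (\<bar>f' y\<bar> powr p) \<partial>lebesgue) (1 / p) \<le> ennreal K2 * F"
    proof -
      have "epowr (\<integral>\<^sup>+y. ennreal (\<bar>f' y\<bar> powr p) \<partial>lebesgue) (1 / p) \<le>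
          epowr (ennreal (near_const p * 8000 powr (n - d)) * E.err p (\<lambda>x. 0) UNIV) (1 / p)"
        unfolding ext n_def using p by (intro epowr_mono E.ext_Lp) auto
      also have "\<dots> = ennreal K2 * F"
        unfolding K2_def F_def using near_const_pos[of p] p by (intro epowr_cmult) auto
      finally show ?thesis .
    qed
    ultimately have "epowr (\<Sum>j. epowr (ennreal (2 powr (\<alpha> * real j)) *
        epowr (\<integral>\<^sup>+x. epowr (best_approx lebesgue k u f' (cube x ((1 / 2) ^ j))) p \<partial>lebesgue) (1 / p)) q) (1 / q) +
        epowr (\<integral>\<^sup>+y. ennreal (\<bar>f' y\<bar> powr p) \<partial>lebesgue) (1 / p)
      \<le> ennreal K1 * (X + F) + ennreal K2 * F" by (rule add_mono)
    \<comment> \<open>Absolute values make the constants nonnegative, as the addition of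
      \<open>ennreal\<close> factors demands, without inspecting their signs.\<close>
    also have "\<dots> \<le> ennreal \<bar>K1\<bar> * (X + F) + ennreal \<bar>K2\<bar> * (X + F)"
      by (intro add_mono mult_mono ennreal_leI) auto
    also have "\<dots> = ennreal (\<bar>K1\<bar> + \<bar>K2\<bar>) * (X + F)"
      by (subst ennreal_plus) (auto simp only: distrib_right abs_ge_zero)
    also have "\<dots> \<le> ennreal c * (X + F)"
      by (intro mult_right_mono ennreal_leI) (auto simp: c_def)
    finally have est: "epowr (\<Sum>j. epowr (ennreal (2 powr (\<alpha> * real j)) *
        epowr (\<integral>\<^sup>+x. epowr (best_approx lebesgue k u f' (cube x ((1 / 2) ^ j))) p \<partial>lebesgue) (1 / p)) q) (1 / q) +
        epowr (\<integral>\<^sup>+y. ennreal (\<bar>f' y\<bar> powr p) \<partial>lebesgue) (1 / p) \<le> ennreal c * (X + F)" .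
    have Lp_leb: "Lp_norm lebesgue UNIV p g = epowr (\<integral>\<^sup>+x. epowr (g x) p \<partial>lebesgue) (1 / p)" for g :: "real ^ 'n \<Rightarrow> ennreal"
      by (simp add: Lp_norm_def)
    have "(\<integral>\<^sup>+x. epowr (ennreal \<bar>f' x\<bar>) p \<partial>lebesgue) = (\<integral>\<^sup>+x. ennreal (\<bar>f' x\<bar> powr p) \<partial>lebesgue)"
      by (simp add: epowr_ennreal)
    then show ?thesis
      using est unfolding X_def F_def Lp_leb Lp_norm_restrict_S[OF S_sets] N_def[symmetric] powr_two_minus approx err_p
      by (simp add: epowr_ennreal)
  qed
  have "0 < c" by (simp add: c_def)
  then show ?thesis
    using main unfolding n_def Let_def by (intro exI[of _ c] conjI allI impI) auto
qed

end
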